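(* Let $1<q<\infty$ and $w\in A_q(\mathbb{R}^n)$. A function $f$ belongs to $W^{1,q}(\mathbb{R}^n,w)$ if and only if $f\in L^q(\mathbb{R}^n,w)$ and there exists a non-negative function $g\in L^q(\mathbb{R}^n,w)$ such that the inequality $$|f(x)-f(y)|\le|x-y|\,(g(x)+g(y))$$ holds for a.e. $x,y\in\mathbb{R}^n$, i.e. for all $x,y\in\mathbb{R}^n\setminus S$ with some set $S$ of Lebesgue measure zero.
   Context: A weight is a measurable function that is positive and finite a.e. A weight $w$ belongs to the Muckenhoupt class $A_q(\mathbb{R}^n)$, $1<q<\infty$, if $$\sup_{Q}\left(\frac1{|Q|}\int_Q w\,dx\right)\left(\frac1{|Q|}\int_Q w^{-\frac1{q-1}}\,dx\right)^{q-1}<\infty,$$ the supremum being over all cubes $Q\subset\mathbb{R}^n$ with edges parallel to the coordinate axes. $L^q(\mathbb{R}^n,w)$ is the space of measurable $f$ with $\|f\|_{L^q(\mathbb{R}^n,w)}=\left(\int_{\mathbb{R}^n}|f|^qw\,dx\right)^{1/q}<\infty$. $W^{1,q}(\mathbb{R}^n,w)$ is the space of $f\in L^q(\mathbb{R}^n,w)$ having a weak gradient $\nabla f$ with $|\nabla f|\in L^q(\mathbb{R}^n,w)$, normed by $\|f\|_{L^q(\mathbb{R}^n,w)}+\|\nabla f\|_{L^q(\mathbb{R}^n,w)}$. (A weak gradient requires $f,\nabla f\in L^1_{\mathrm{loc}}$.) *)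

theory Defs
  imports "HOL-Analysis.Analysis"
begin

definition ennreal_powr :: "ennreal \<Rightarrow> real \<Rightarrow> ennreal" where
  "ennreal_powr x p = (if x = \<infinity> then \<infinity> else ennreal (enn2real x powr p))"
  \<comment> \<open>intended for exponents \<open>p > 0\<close> only, where \<open>\<infinity>\<^sup>p = \<infinity>\<close> and \<open>0\<^sup>p = 0\<close>\<close>

definition weight :: "(real ^ 'n \<Rightarrow> ennreal) \<Rightarrow> bool" where
  "weight w \<longleftrightarrow> w \<in> borel_measurable lebesgue \<and> (AE x in lebesgue. 0 < w x \<and> w x < \<infinity>)"

definition cubes :: "(real ^ 'n) set set" where
  "cubes = {cbox a (\<chi> i. a $ i + l) | a l. 0 < l}"

definition mean_value :: "(real ^ 'n) set \<Rightarrow> (real ^ 'n \<Rightarrow> ennreal) \<Rightarrow> ennreal" where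
  "mean_value Q u = (\<integral>\<^sup>+x\<in>Q. u x \<partial>lebesgue) / emeasure lebesgue Q"

text \<open>
  In the negative power, \<open>enn2real\<close> only changes \<open>w\<close> where \<open>w = \<infinity>\<close>, a null set for a weight.
  For a weight both means are nonzero, so the convention \<open>0 * \<infinity> = 0\<close> plays no role:
  a finite supremum forces both integrals to be finite on every cube.
\<close>

definition Muckenhoupt :: "real \<Rightarrow> (real ^ 'n \<Rightarrow> ennreal) set" where
  "Muckenhoupt q = {w. weight w \<and>
     (SUP Q\<in>cubes. mean_value Q w *
        ennreal_powr (mean_value Q (\<lambda>x. ennreal (enn2real (w x) powr (- 1 / (q - 1))))) (q - 1)) < \<infinity>}"

definition weighted_Lq :: "real \<Rightarrow> (real ^ 'n \<Rightarrow> ennreal) \<Rightarrow> (real ^ 'n \<Rightarrow> real) set" where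
  "weighted_Lq q w = {f. f \<in> borel_measurable lebesgue \<and>
     (\<integral>\<^sup>+x. ennreal (\<bar>f x\<bar> powr q) * w x \<partial>lebesgue) < \<infinity>}"

definition locally_integrable :: "(real ^ 'n \<Rightarrow> 'b :: euclidean_space) \<Rightarrow> bool" where
  "locally_integrable f \<longleftrightarrow> (\<forall>K. compact K \<longrightarrow> set_integrable lebesgue K f)"

fun C_diff :: "nat \<Rightarrow> (real ^ 'n \<Rightarrow> real) \<Rightarrow> bool" where
  "C_diff 0 \<phi> \<longleftrightarrow> continuous_on UNIV \<phi>"
| "C_diff (Suc k) \<phi> \<longleftrightarrow> (\<forall>x. \<phi> differentiable (at x)) \<and>
     (\<forall>i. C_diff k (\<lambda>x. frechet_derivative \<phi> (at x) (axis i 1)))"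

definition test_function :: "(real ^ 'n \<Rightarrow> real) \<Rightarrow> bool" where
  "test_function \<phi> \<longleftrightarrow> (\<forall>k. C_diff k \<phi>) \<and> compact (closure {x. \<phi> x \<noteq> 0})"

definition weak_gradient :: "(real ^ 'n \<Rightarrow> real) \<Rightarrow> (real ^ 'n \<Rightarrow> real ^ 'n) \<Rightarrow> bool" where
  "weak_gradient f G \<longleftrightarrow> locally_integrable f \<and> locally_integrable G \<and>
     (\<forall>\<phi> i. test_function \<phi> \<longrightarrow>
        (\<integral>x. f x * frechet_derivative \<phi> (at x) (axis i 1) \<partial>lebesgue) =
        - (\<integral>x. G x $ i * \<phi> x \<partial>lebesgue))"

definition weighted_Sobolev :: "real \<Rightarrow> (real ^ 'n \<Rightarrow> ennreal) \<Rightarrow> (real ^ 'n \<Rightarrow> real) set" where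
  "weighted_Sobolev q w = {f. f \<in> weighted_Lq q w \<and>
     (\<exists>G. weak_gradient f G \<and> (\<lambda>x. norm (G x)) \<in> weighted_Lq q w)}"

end

theory Submission
  imports Defs "HOL-Real_Asymp.Real_Asymp"
begin

text \<open>
  Everything rests on the uncentred Hardy--Littlewood maximal function \<open>M\<close> over balls and on
  Muckenhoupt's theorem that \<open>M\<close> is bounded on \<open>L\<^sup>q(w)\<close> for \<open>w \<in> A\<^sub>q\<close>
  (\<open>maximal_function_bounded\<close>).  That theorem is obtained by Lerner's argument: with the dual
  weight \<open>\<sigma> = w powr (- 1 / (q - 1))\<close> the \<open>A\<^sub>q\<close> condition gives the pointwise bound
  \<open>(M f)\<^sup>q\<^sup>-\<^sup>1 \<le> A M\<^sub>w ((M\<^sub>\<sigma> (f / \<sigma>))\<^sup>q\<^sup>-\<^sup>1 / w)\<close>.  The measures \<open>w dx\<close> and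
  \<open>\<sigma> dx\<close> are doubling, so \<open>M\<^sub>w\<close> and \<open>M\<^sub>\<sigma>\<close> are bounded on the \<open>L\<^sup>p\<close> spaces of their own
  measures by Vitali's covering lemma and interpolation.

  From a weak gradient \<open>G\<close> to the pointwise inequality
  (\<open>weak_gradient_imp_pointwise_inequality\<close>): average \<open>f\<close> against a smooth bump dilated by \<open>s\<close> about \<open>x\<close>.
  The derivative of the average in \<open>s\<close> is an average of \<open>G\<close>, because the \<open>s\<close>-derivative of a dilated kernel is a
  divergence; hence it is at most \<open>C M\<bar>G\<bar>(x)\<close>.  Letting \<open>s\<close> tend to \<open>0\<close> at a Lebesgue point, \<open>f(x)\<close> differs from
  the average at scale \<open>R\<close> by at most \<open>C R M\<bar>G\<bar>(x)\<close>.  For two points at distance comparable to \<open>R\<close>, one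
  and the same average at scale \<open>R\<close> can be reached from either point by using a translated bump, and the triangle
  inequality gives the claim with \<open>g = C M\<bar>G\<bar>\<close>.

  From the pointwise inequality to a weak gradient
  (\<open>pointwise_inequality_imp_weak_gradient\<close>): the difference quotients of \<open>f\<close> with step \<open>h\<close>, averaged over
  balls of radius \<open>h\<close>, are bounded by \<open>C M g\<close> uniformly in \<open>h\<close>, and tested against \<open>\<phi>\<close> they converge to
  \<open>- \<integral> f \<partial>\<^sub>i\<phi>\<close>.  Such a dominated sequence has convex combinations of its tails which converge almost
  everywhere (\<open>convergent_midpoint_sequence\<close>, a concrete form of weak compactness in a Hilbert
  space), and dominated convergence identifies the limit as the weak derivative.

  In both directions Muckenhoupt's theorem carries membership in \<open>L\<^sup>q(w)\<close> over, and \<open>A\<^sub>q\<close> makes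
  functions in \<open>L\<^sup>q(w)\<close> locally integrable.
\<close>

section \<open>Powers of extended nonnegative reals\<close>

lemma ennreal_powr_top [simp]: "ennreal_powr top p = top"
  by (simp add: ennreal_powr_def)

lemma ennreal_powr_ennreal: "0 \<le> x \<Longrightarrow> ennreal_powr (ennreal x) p = ennreal (x powr p)"
  by (simp add: ennreal_powr_def)

lemma ennreal_powr_0 [simp]: "ennreal_powr 0 p = 0"
  by (simp add: ennreal_powr_def)

lemma ennreal_powr_1 [simp]: "ennreal_powr x 1 = x"
  by (cases x) (auto simp: ennreal_powr_ennreal)

lemma ennreal_powr_mono: "x \<le> y \<Longrightarrow> 0 \<le> p \<Longrightarrow> ennreal_powr x p \<le> ennreal_powr y p"
  by (cases x; cases y) (auto simp: ennreal_powr_ennreal top_unique intro!: ennreal_leI powr_mono2)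

lemma ennreal_powr_mult: "0 < p \<Longrightarrow> ennreal_powr (x * y) p = ennreal_powr x p * ennreal_powr y p"
  by (cases x; cases y)
     (auto simp: ennreal_powr_ennreal ennreal_mult[symmetric] powr_mult ennreal_top_mult ennreal_mult_top)

lemma ennreal_powr_powr: "ennreal_powr (ennreal_powr x p) r = ennreal_powr x (p * r)"
  by (cases x) (auto simp: ennreal_powr_ennreal powr_powr)

lemma ennreal_mult_powr: "1 < p \<Longrightarrow> x * ennreal_powr x (p - 1) = ennreal_powr x p"
  by (cases x)
     (auto simp: ennreal_powr_ennreal ennreal_mult[symmetric] powr_mult_base)

lemma borel_measurable_ennreal_powr [measurable (raw)]:
  assumes [measurable]: "f \<in> borel_measurable M"
  shows "(\<lambda>x. ennreal_powr (f x) p) \<in> borel_measurable M"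
  unfolding ennreal_powr_def by measurable

text \<open>
  The layer-cake formula: the integrand is the derivative of \<open>t powr p\<close>, integrated up to \<open>F\<close>.
\<close>
lemma nn_integral_powr_less:
  assumes p: "0 < p"
  shows "(\<integral>\<^sup>+t. ennreal (p * t powr (p - 1)) * indicator {t. 0 < t \<and> ennreal t < F} t \<partial>lborel)
    = ennreal_powr F p"
proof -
  have fin: "(\<integral>\<^sup>+t. ennreal (p * t powr (p - 1)) * indicator {t. 0 < t \<and> ennreal t < ennreal c} t \<partial>lborel)
    = ennreal (c powr p)" if c: "0 \<le> c" for c
  proof -
    have "((\<lambda>x. p * x powr (p - 1)) has_integral p * (c powr (p - 1 + 1) / (p - 1 + 1))) {0..c}"
      using p c by (intro has_integral_mult_right has_integral_powr_from_0) auto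
    hence "((\<lambda>x. p * x powr (p - 1)) has_integral c powr p) {0..c}" using p by simp
    hence "(\<integral>\<^sup>+t. ennreal (p * t powr (p - 1)) * indicator {0..c} t \<partial>lborel) = ennreal (c powr p)"
      using p by (intro nn_integral_has_integral_lebesgue') auto
    moreover have "(\<integral>\<^sup>+t. ennreal (p * t powr (p - 1)) * indicator {0..c} t \<partial>lborel)
       = (\<integral>\<^sup>+t. ennreal (p * t powr (p - 1)) * indicator {t. 0 < t \<and> ennreal t < ennreal c} t \<partial>lborel)"
    proof (rule nn_integral_cong_AE)
      show "AE t in lborel. ennreal (p * t powr (p - 1)) * indicator {0..c} t =
          ennreal (p * t powr (p - 1)) * indicator {t. 0 < t \<and> ennreal t < ennreal c} t"
        using AE_lborel_singleton[of 0] AE_lborel_singleton[of c]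
        by eventually_elim (auto simp: indicator_def ennreal_less_iff)
    qed
    ultimately show ?thesis by simp
  qed
  show ?thesis
  proof (cases F)
    case (real c)
    then show ?thesis using fin by (simp add: ennreal_powr_ennreal)
  next
    case top
    let ?I = "\<integral>\<^sup>+t. ennreal (p * t powr (p - 1)) * indicator {t. 0 < t \<and> ennreal t < F} t \<partial>lborel"
    have "ennreal r \<le> ?I" if "0 \<le> r" for r
    proof -
      have "ennreal r = ennreal ((r powr (1/p)) powr p)" using p that by (simp add: powr_powr)
      also have "\<dots> = (\<integral>\<^sup>+t. ennreal (p * t powr (p - 1)) *
          indicator {t. 0 < t \<and> ennreal t < ennreal (r powr (1/p))} t \<partial>lborel)"
        by (rule fin[symmetric]) simp
      also have "\<dots> \<le> ?I"
        using top by (intro nn_integral_mono) (auto simp: indicator_def)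
      finally show ?thesis .
    qed
    note le = this
    have "?I = top"
    proof (rule ccontr)
      assume "?I \<noteq> top"
      then obtain c where c: "0 \<le> c" "?I = ennreal c" by (cases ?I) auto
      show False using le[of "c + 1"] c by simp
    qed
    then show ?thesis using top by simp
  qed
qed

section \<open>The maximal function of a doubling measure\<close>

text \<open>
  The balls need not be centred at the point \<open>x\<close>, and they are open.  Therefore the sets where the function exceeds a
  threshold are unions of open balls, and measurability comes for free.
\<close>
definition maximal_function :: "'a::euclidean_space measure \<Rightarrow> ('a \<Rightarrow> ennreal) \<Rightarrow> 'a \<Rightarrow> ennreal" where
  "maximal_function \<mu> f x = (SUP (a, r)\<in>{(a, r). 0 < r \<and> x \<in> ball a r}.
     (\<integral>\<^sup>+y\<in>ball a r. f y \<partial>\<mu>) / emeasure \<mu> (ball a r))"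

lemma average_le_maximal_function:
  "x \<in> ball a r \<Longrightarrow> (\<integral>\<^sup>+y\<in>ball a r. f y \<partial>\<mu>) / emeasure \<mu> (ball a r) \<le> maximal_function \<mu> f x"
  unfolding maximal_function_def
  by (rule SUP_upper2[of "(a, r)"]) (auto simp: le_less_trans[OF zero_le_dist])

lemma maximal_function_leI:
  assumes "\<And>a r. 0 < r \<Longrightarrow> x \<in> ball a r \<Longrightarrow> (\<integral>\<^sup>+y\<in>ball a r. f y \<partial>\<mu>) / emeasure \<mu> (ball a r) \<le> c"
  shows "maximal_function \<mu> f x \<le> c"
  unfolding maximal_function_def using assms by (intro SUP_least) auto

lemma open_maximal_function_greater: "open {x. t < maximal_function \<mu> f x}"
proof -
  have "{x. t < maximal_function \<mu> f x} =
     (\<Union>(a, r)\<in>{(a, r). 0 < r \<and> t < (\<integral>\<^sup>+y\<in>ball a r. f y \<partial>\<mu>) / emeasure \<mu> (ball a r)}. ball a r)"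
    unfolding maximal_function_def less_SUP_iff by fastforce
  thus ?thesis by (auto intro!: open_UN)
qed

lemma borel_measurable_maximal_function:
  assumes "sets borel \<subseteq> sets M" "space M = UNIV"
  shows "maximal_function \<mu> f \<in> borel_measurable M"
proof (rule borel_measurableI_greater)
  fix t :: ennreal
  show "{x \<in> space M. t < maximal_function \<mu> f x} \<in> sets M"
    using borel_open[OF open_maximal_function_greater, of t \<mu> f] assms by auto
qed

text \<open>
  The dilation factor is \<open>6\<close> because the Vitali covering lemma enlarges closed balls five times, and
  a closed ball lies in any larger open one.
\<close>
locale doubling_measure =
  fixes \<mu> :: "'a::euclidean_space measure" and C :: real
  assumes sets_eq: "sets \<mu> = sets lebesgue"
    and ball_pos: "\<And>a r. 0 < r \<Longrightarrow> 0 < emeasure \<mu> (ball a r)"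
    and ball_finite: "\<And>a r. emeasure \<mu> (ball a r) < \<infinity>"
    and doubling: "\<And>a r. 0 < r \<Longrightarrow> emeasure \<mu> (ball a (6 * r)) \<le> ennreal C * emeasure \<mu> (ball a r)"
begin

lemma space_eq: "space \<mu> = UNIV"
  using sets_eq_imp_space_eq[OF sets_eq] by simp

lemma borel_sets: "A \<in> sets borel \<Longrightarrow> A \<in> sets \<mu>"
  by (simp add: sets_eq)

lemma open_sets: "open A \<Longrightarrow> A \<in> sets \<mu>"
  by (intro borel_sets borel_open)

lemma ball_sets [measurable]: "ball a r \<in> sets \<mu>"
  by (rule open_sets) simp

lemma measurable_maximal_function [measurable]: "maximal_function \<mu> f \<in> borel_measurable \<mu>"
  by (rule borel_measurable_maximal_function) (auto simp: space_eq borel_sets)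

lemma sigma_finite: "sigma_finite_measure \<mu>"
proof
  show "\<exists>A. countable A \<and> A \<subseteq> sets \<mu> \<and> \<Union>A = space \<mu> \<and> (\<forall>a\<in>A. emeasure \<mu> a \<noteq> \<infinity>)"
  proof (intro exI[of _ "range (\<lambda>n::nat. ball 0 (real n))"] conjI)
    show "\<Union>(range (\<lambda>n::nat. ball (0::'a) (real n))) = space \<mu>"
      using reals_Archimedean2 by (auto simp: space_eq)
    show "\<forall>a\<in>range (\<lambda>n::nat. ball (0::'a) (real n)). emeasure \<mu> a \<noteq> \<infinity>"
      using ball_finite by (auto simp: less_top)
  qed auto
qed

text \<open>
  Each point where the maximal function exceeds \<open>t\<close> lies in a ball on which the average of \<open>f\<close> exceeds \<open>t\<close>.
  Vitali's lemma selects disjoint balls among these whose dilates still cover, and the doubling property pays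
  for the dilation.  Vitali's lemma requires bounded radii; hence the bound \<open>N\<close>, removed by monotone convergence.
\<close>
lemma maximal_function_weak_type:
  assumes [measurable]: "f \<in> borel_measurable \<mu>" and t: "0 < t"
  shows "t * emeasure \<mu> {x. t < maximal_function \<mu> f x} \<le> ennreal C * (\<integral>\<^sup>+x. f x \<partial>\<mu>)"
proof -
  define K where "K N = {(a, r). 0 < r \<and> r \<le> real N \<and>
      t * emeasure \<mu> (ball a r) \<le> (\<integral>\<^sup>+y\<in>ball a r. f y \<partial>\<mu>)}" for N
  define A where "A N = (\<Union>(a, r)\<in>K N. ball a r)" for N
  have A_open: "open (A N)" for N
    unfolding A_def by (auto intro!: open_UN)
  have bound: "t * emeasure \<mu> (A N) \<le> ennreal C * (\<integral>\<^sup>+x. f x \<partial>\<mu>)" for N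
  proof -
    have r: "0 < snd i \<and> snd i \<le> real N" if "i \<in> K N" for i
      using that by (auto simp: K_def)
    have cover: "A N \<subseteq> (\<Union>i\<in>K N. cball (fst i) (snd i))"
      unfolding A_def by (auto simp: less_imp_le)
    obtain D where D: "countable D" "D \<subseteq> K N"
        "pairwise (\<lambda>i j. disjnt (cball (fst i) (snd i)) (cball (fst j) (snd j))) D"
        "A N \<subseteq> (\<Union>i\<in>D. cball (fst i) (5 * snd i))"
      by (rule Vitali_covering_lemma_cballs[OF cover r])
    have D_pos: "0 < snd i" if "i \<in> D" for i using that D(2) by (auto simp: K_def)
    have "emeasure \<mu> (A N) = (\<integral>\<^sup>+x. indicator (A N) x \<partial>\<mu>)"
      using open_sets[OF A_open] by simp
    also have "\<dots> \<le> (\<integral>\<^sup>+x. \<integral>\<^sup>+i. indicator (ball (fst i) (6 * snd i)) x \<partial>count_space D \<partial>\<mu>)"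
    proof (rule nn_integral_mono)
      fix x
      show "indicator (A N) x \<le> (\<integral>\<^sup>+i. indicator (ball (fst i) (6 * snd i)) x \<partial>count_space D)"
      proof (cases "x \<in> A N")
        case True
        then obtain i where i: "i \<in> D" "x \<in> cball (fst i) (5 * snd i)" using D(4) by auto
        have "x \<in> ball (fst i) (6 * snd i)" using i D_pos[OF i(1)] by auto
        hence "(1::ennreal) = (\<integral>\<^sup>+j. indicator {i} j \<partial>count_space D) "
          using i by simp
        also have "\<dots> \<le> (\<integral>\<^sup>+i. indicator (ball (fst i) (6 * snd i)) x \<partial>count_space D)"
          using \<open>x \<in> ball (fst i) (6 * snd i)\<close> by (intro nn_integral_mono) (auto simp: indicator_def)
        finally show ?thesis using True by simp
      qed simp
    qed
    also have "\<dots> = (\<integral>\<^sup>+i. emeasure \<mu> (ball (fst i) (6 * snd i)) \<partial>count_space D)"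
      by (subst nn_integral_count_space_nn_integral[OF D(1)]) auto
    finally have "t * emeasure \<mu> (A N) \<le>
        t * (\<integral>\<^sup>+i. emeasure \<mu> (ball (fst i) (6 * snd i)) \<partial>count_space D)"
      by (rule mult_left_mono) simp
    also have "\<dots> = (\<integral>\<^sup>+i. t * emeasure \<mu> (ball (fst i) (6 * snd i)) \<partial>count_space D)"
      by (rule nn_integral_cmult[symmetric]) simp
    also have "\<dots> \<le> (\<integral>\<^sup>+i. ennreal C * (\<integral>\<^sup>+y\<in>ball (fst i) (snd i). f y \<partial>\<mu>) \<partial>count_space D)"
    proof (rule nn_integral_mono)
      fix i assume "i \<in> space (count_space D)"
      hence i: "i \<in> D" by simp
      have "t * emeasure \<mu> (ball (fst i) (6 * snd i)) \<le> t * (ennreal C * emeasure \<mu> (ball (fst i) (snd i)))"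
        by (intro mult_left_mono doubling D_pos i) simp
      also have "\<dots> = ennreal C * (t * emeasure \<mu> (ball (fst i) (snd i)))" by (simp add: ac_simps)
      also have "\<dots> \<le> ennreal C * (\<integral>\<^sup>+y\<in>ball (fst i) (snd i). f y \<partial>\<mu>)"
        using i D(2) by (intro mult_left_mono) (auto simp: K_def)
      finally show "t * emeasure \<mu> (ball (fst i) (6 * snd i))
          \<le> ennreal C * (\<integral>\<^sup>+y\<in>ball (fst i) (snd i). f y \<partial>\<mu>)" .
    qed
    also have "\<dots> = ennreal C * (\<integral>\<^sup>+i. (\<integral>\<^sup>+y\<in>ball (fst i) (snd i). f y \<partial>\<mu>) \<partial>count_space D)"
      by (rule nn_integral_cmult) simp
    also have "(\<integral>\<^sup>+i. (\<integral>\<^sup>+y\<in>ball (fst i) (snd i). f y \<partial>\<mu>) \<partial>count_space D)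
        = (\<integral>\<^sup>+y. \<integral>\<^sup>+i. f y * indicator (ball (fst i) (snd i)) y \<partial>count_space D \<partial>\<mu>)"
      by (rule nn_integral_count_space_nn_integral[OF D(1), symmetric]) measurable
    also have "\<dots> \<le> (\<integral>\<^sup>+y. f y \<partial>\<mu>)"
    proof (rule nn_integral_mono)
      fix y
      have "(\<integral>\<^sup>+i. indicator (ball (fst i) (snd i)) y \<partial>count_space D) \<le> (1::ennreal)"
      proof (cases "\<exists>i\<in>D. y \<in> ball (fst i) (snd i)")
        case True
        then obtain i where i: "i \<in> D" "y \<in> ball (fst i) (snd i)" by auto
        have "j = i" if "j \<in> D" "y \<in> ball (fst j) (snd j)" for j
          using D(3) i that unfolding pairwise_def disjnt_iff by (meson ball_subset_cball subsetD)
        hence "(\<integral>\<^sup>+j. indicator (ball (fst j) (snd j)) y \<partial>count_space D) \<le>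
            (\<integral>\<^sup>+j. indicator {i} j \<partial>count_space D)"
          by (intro nn_integral_mono) (auto simp: indicator_def)
        also have "\<dots> = (1::ennreal)" using i by simp
        finally show ?thesis .
      next
        case False
        hence "(\<integral>\<^sup>+i. indicator (ball (fst i) (snd i)) y \<partial>count_space D) = (\<integral>\<^sup>+i. 0 \<partial>count_space D)"
          by (intro nn_integral_cong) (auto simp: indicator_def)
        thus ?thesis by simp
      qed
      hence "f y * (\<integral>\<^sup>+i. indicator (ball (fst i) (snd i)) y \<partial>count_space D) \<le> f y * 1"
        by (rule mult_left_mono) simp
      thus "(\<integral>\<^sup>+i. f y * indicator (ball (fst i) (snd i)) y \<partial>count_space D) \<le> f y"
        by (subst nn_integral_cmult) auto
    qed
    finally show ?thesis by (simp add: mult_left_mono)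
  qed
  have "{x. t < maximal_function \<mu> f x} \<subseteq> (\<Union>N. A N)"
  proof
    fix x assume "x \<in> {x. t < maximal_function \<mu> f x}"
    then obtain a r where ar: "0 < r" "x \<in> ball a r"
        "t < (\<integral>\<^sup>+y\<in>ball a r. f y \<partial>\<mu>) / emeasure \<mu> (ball a r)"
      unfolding maximal_function_def less_SUP_iff by auto
    have "t * emeasure \<mu> (ball a r) \<le>
        (\<integral>\<^sup>+y\<in>ball a r. f y \<partial>\<mu>) / emeasure \<mu> (ball a r) * emeasure \<mu> (ball a r)"
      using ar by (intro mult_right_mono) auto
    also have "\<dots> = (\<integral>\<^sup>+y\<in>ball a r. f y \<partial>\<mu>)"
      using ball_pos[OF ar(1), of a] ball_finite[of a r] by (simp add: ennreal_divide_times less_le)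
    finally show "x \<in> (\<Union>N. A N)"
      using ar real_arch_simple[of r] unfolding A_def K_def by fastforce
  qed
  hence "t * emeasure \<mu> {x. t < maximal_function \<mu> f x} \<le> t * emeasure \<mu> (\<Union>N. A N)"
    using A_open by (intro mult_left_mono emeasure_mono open_sets) auto
  also have "emeasure \<mu> (\<Union>N. A N) = (SUP N. emeasure \<mu> (A N))"
    using A_open by (intro SUP_emeasure_incseq[symmetric])
      (force intro!: open_sets monoI simp: A_def K_def mono_def)+
  also have "t * \<dots> = (SUP N. t * emeasure \<mu> (A N))"
    by (rule SUP_mult_left_ennreal)
  also have "\<dots> \<le> ennreal C * (\<integral>\<^sup>+x. f x \<partial>\<mu>)"
    by (intro SUP_least bound)
  finally show ?thesis .
qed

text \<open>
  Only the values of \<open>f\<close> above \<open>t\<close> can lift an average by more than \<open>t\<close>.  This lets the weak-type estimate be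
  applied, at each level, to the large part of \<open>f\<close> alone.
\<close>
lemma maximal_function_le_large_part:
  assumes [measurable]: "f \<in> borel_measurable \<mu>"
  shows "maximal_function \<mu> f x \<le> maximal_function \<mu> (\<lambda>y. f y * indicator {y. t < f y} y) x + t"
proof (rule maximal_function_leI)
  fix a r assume ar: "0 < r" "x \<in> ball a r"
  let ?f = "\<lambda>y. f y * indicator {y. t < f y} y"
  have m: "emeasure \<mu> (ball a r) \<noteq> 0" "emeasure \<mu> (ball a r) < top"
    using ball_pos[OF ar(1), of a] ball_finite[of a r] by auto
  have "(\<integral>\<^sup>+y\<in>ball a r. f y \<partial>\<mu>) \<le> (\<integral>\<^sup>+y. ?f y * indicator (ball a r) y + t * indicator (ball a r) y \<partial>\<mu>)"
    by (intro nn_integral_mono) (auto simp: indicator_def)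
  also have "\<dots> = (\<integral>\<^sup>+y\<in>ball a r. ?f y \<partial>\<mu>) + t * emeasure \<mu> (ball a r)"
    by (subst nn_integral_add) (auto simp: nn_integral_cmult space_eq)
  finally have "(\<integral>\<^sup>+y\<in>ball a r. f y \<partial>\<mu>) / emeasure \<mu> (ball a r)
      \<le> ((\<integral>\<^sup>+y\<in>ball a r. ?f y \<partial>\<mu>) + t * emeasure \<mu> (ball a r)) / emeasure \<mu> (ball a r)"
    by (rule divide_right_mono_ennreal)
  also have "\<dots> = (\<integral>\<^sup>+y\<in>ball a r. ?f y \<partial>\<mu>) / emeasure \<mu> (ball a r) + t"
    using m by (simp add: add_divide_distrib_ennreal ennreal_mult_divide_eq)
  also have "\<dots> \<le> maximal_function \<mu> ?f x + t"
    by (intro add_right_mono average_le_maximal_function ar)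
  finally show "(\<integral>\<^sup>+y\<in>ball a r. f y \<partial>\<mu>) / emeasure \<mu> (ball a r) \<le> maximal_function \<mu> ?f x + t" .
qed

text \<open>
  Marcinkiewicz interpolation between the weak-type estimate and the trivial \<open>L\<^sup>\<infinity>\<close> bound: at level \<open>t\<close> the
  weak-type estimate is applied to the part of \<open>f\<close> above \<open>t / 2\<close>, and the levels are then integrated by the layer-cake
  formula and Tonelli's theorem.
\<close>
theorem maximal_function_strong_type:
  assumes p: "1 < p"
  obtains K where "0 \<le> K" "\<And>f. f \<in> borel_measurable \<mu> \<Longrightarrow>
     (\<integral>\<^sup>+x. ennreal_powr (maximal_function \<mu> f x) p \<partial>\<mu>) \<le> ennreal K * (\<integral>\<^sup>+x. ennreal_powr (f x) p \<partial>\<mu>)"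
proof
  interpret sigma_finite_measure \<mu> by (rule sigma_finite)
  interpret P: pair_sigma_finite lborel \<mu> ..
  define K where "K = p * 2 * \<bar>C\<bar> * 2 powr (p - 1) / (p - 1)"
  show "0 \<le> K" using p by (simp add: K_def)
  fix f :: "'a \<Rightarrow> ennreal" assume [measurable]: "f \<in> borel_measurable \<mu>"
  let ?M = "maximal_function \<mu> f"
  let ?m = "\<lambda>x t. ennreal (p * t powr (p - 1)) * indicator {t. 0 < t \<and> ennreal t < ?M x} t"
  let ?k = "\<lambda>x t. ennreal (2 * p * \<bar>C\<bar> / (p - 1)) * f x *
    (ennreal ((p - 1) * t powr (p - 1 - 1)) * indicator {t. 0 < t \<and> ennreal t < 2 * f x} t)"
  have distr: "ennreal (p * t powr (p - 1)) * emeasure \<mu> {x. ennreal t < ?M x}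
      \<le> (\<integral>\<^sup>+x. ?k x t \<partial>\<mu>)" if t: "0 < t" for t
  proof -
    let ?f = "\<lambda>y. f y * indicator {y. ennreal (t/2) < f y} y"
    have t2: "ennreal t = ennreal (t/2) + ennreal (t/2)" using t by (simp flip: ennreal_plus)
    have "{x. ennreal t < ?M x} \<subseteq> {x. ennreal (t/2) < maximal_function \<mu> ?f x}"
    proof safe
      fix x assume "ennreal t < ?M x"
      also have "?M x \<le> maximal_function \<mu> ?f x + ennreal (t/2)"
        by (rule maximal_function_le_large_part) simp
      finally show "ennreal (t/2) < maximal_function \<mu> ?f x"
        unfolding t2 by (meson add_right_mono linorder_not_le)
    qed
    hence "ennreal (t/2) * emeasure \<mu> {x. ennreal t < ?M x} \<le>
        ennreal (t/2) * emeasure \<mu> {x. ennreal (t/2) < maximal_function \<mu> ?f x}"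
      by (intro mult_left_mono emeasure_mono open_sets open_maximal_function_greater) auto
    also have "\<dots> \<le> ennreal C * (\<integral>\<^sup>+x. ?f x \<partial>\<mu>)"
      using t by (intro maximal_function_weak_type) auto
    also have "\<dots> \<le> ennreal \<bar>C\<bar> * (\<integral>\<^sup>+x. ?f x \<partial>\<mu>)"
      by (intro mult_right_mono ennreal_leI) auto
    finally have *: "ennreal (t/2) * emeasure \<mu> {x. ennreal t < ?M x} \<le> ennreal \<bar>C\<bar> * (\<integral>\<^sup>+x. ?f x \<partial>\<mu>)" .
    have f_eq: "?f x = f x * indicator {t. 0 < t \<and> ennreal t < 2 * f x} t" for x
    proof -
      have "ennreal (t/2) < f x \<longleftrightarrow> ennreal t < 2 * f x"
        using t by (cases "f x") (auto simp: ennreal_less_iff ennreal_mult_top numeral_mult_ennreal)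
      thus ?thesis using t by (simp add: indicator_def)
    qed
    have "ennreal (p * t powr (p - 1)) * emeasure \<mu> {x. ennreal t < ?M x}
       = ennreal (2 * p * t powr (p - 1 - 1)) * (ennreal (t/2) * emeasure \<mu> {x. ennreal t < ?M x})"
    proof -
      have "t powr (p - 1 - 1) * t = t powr (p - 1)"
        using t powr_mult_base[of t "p - 1 - 1"] by (simp add: mult.commute)
      hence "p * t powr (p - 1) = 2 * p * t powr (p - 1 - 1) * (t/2)" by simp
      hence "ennreal (p * t powr (p - 1)) = ennreal (2 * p * t powr (p - 1 - 1)) * ennreal (t/2)"
        using p t by (subst ennreal_mult[symmetric]) auto
      thus ?thesis by (simp only: mult.assoc)
    qed
    also have "\<dots> \<le> ennreal (2 * p * t powr (p - 1 - 1)) * (ennreal \<bar>C\<bar> * (\<integral>\<^sup>+x. ?f x \<partial>\<mu>))"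
      by (intro mult_left_mono *) simp
    also have "\<dots> = (\<integral>\<^sup>+x. ennreal (2 * p * t powr (p - 1 - 1)) * ennreal \<bar>C\<bar> * ?f x \<partial>\<mu>)"
      by (subst nn_integral_cmult) (auto simp: mult.assoc)
    also have "\<dots> = (\<integral>\<^sup>+x. ?k x t \<partial>\<mu>)"
    proof (rule nn_integral_cong)
      fix x
      have "ennreal (2 * p * t powr (p - 1 - 1)) * ennreal \<bar>C\<bar>
          = ennreal (2 * p * \<bar>C\<bar> / (p - 1)) * ennreal ((p - 1) * t powr (p - 1 - 1))"
        using p by (simp flip: ennreal_mult)
      thus "ennreal (2 * p * t powr (p - 1 - 1)) * ennreal \<bar>C\<bar> * ?f x =
        ?k x t"
        unfolding f_eq by (simp add: ac_simps)
    qed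
    finally show ?thesis .
  qed
  have "(\<integral>\<^sup>+x. ennreal_powr (?M x) p \<partial>\<mu>) =
     (\<integral>\<^sup>+x. \<integral>\<^sup>+t. ?m x t \<partial>lborel \<partial>\<mu>)"
    using p by (simp add: nn_integral_powr_less)
  also have "\<dots> = (\<integral>\<^sup>+t. \<integral>\<^sup>+x. ?m x t \<partial>\<mu> \<partial>lborel)"
    by (rule P.Fubini') (simp only: indicator_def of_bool_def, measurable)
  also have "\<dots> \<le> (\<integral>\<^sup>+t. \<integral>\<^sup>+x. ?k x t \<partial>\<mu> \<partial>lborel)"
  proof (rule nn_integral_mono)
    fix t :: real
    show "(\<integral>\<^sup>+x. ?m x t \<partial>\<mu>) \<le>
      (\<integral>\<^sup>+x. ?k x t \<partial>\<mu>)"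
    proof (cases "0 < t")
      case True
      have "(\<integral>\<^sup>+x. ?m x t \<partial>\<mu>)
        = (\<integral>\<^sup>+x. ennreal (p * t powr (p - 1)) * indicator {x. ennreal t < ?M x} x \<partial>\<mu>)"
        using True by (intro nn_integral_cong) (auto simp: indicator_def)
      also have "\<dots> = ennreal (p * t powr (p - 1)) * emeasure \<mu> {x. ennreal t < ?M x}"
        by (rule nn_integral_cmult_indicator) (intro open_sets open_maximal_function_greater)
      finally show ?thesis using distr[OF True] by simp
    qed simp
  qed
  also have "\<dots> = (\<integral>\<^sup>+x. \<integral>\<^sup>+t. ?k x t \<partial>lborel \<partial>\<mu>)"
    by (rule P.Fubini'[symmetric]) (simp only: indicator_def of_bool_def, measurable)
  also have "\<dots> = (\<integral>\<^sup>+x. ennreal (2 * p * \<bar>C\<bar> / (p - 1)) * f x * ennreal_powr (2 * f x) (p - 1) \<partial>\<mu>)"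
  proof (rule nn_integral_cong)
    fix x
    have "(\<integral>\<^sup>+t. ?k x t \<partial>lborel)
      = ennreal (2 * p * \<bar>C\<bar> / (p - 1)) * f x * (\<integral>\<^sup>+t. (ennreal ((p - 1) * t powr (p - 1 - 1)) *
           indicator {t. 0 < t \<and> ennreal t < 2 * f x} t) \<partial>lborel)"
      by (rule nn_integral_cmult) measurable
    also have "(\<integral>\<^sup>+t. (ennreal ((p - 1) * t powr (p - 1 - 1)) *
           indicator {t. 0 < t \<and> ennreal t < 2 * f x} t) \<partial>lborel) = ennreal_powr (2 * f x) (p - 1)"
      using p by (intro nn_integral_powr_less) simp
    finally show "(\<integral>\<^sup>+t. ?k x t \<partial>lborel)
      = ennreal (2 * p * \<bar>C\<bar> / (p - 1)) * f x * ennreal_powr (2 * f x) (p - 1)" .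
  qed
  also have "\<dots> = (\<integral>\<^sup>+x. ennreal K * ennreal_powr (f x) p \<partial>\<mu>)"
  proof (rule nn_integral_cong)
    fix x
    have "ennreal_powr 2 (p - 1) = ennreal (2 powr (p - 1))"
      using ennreal_powr_ennreal[of 2 "p - 1"] by simp
    hence "ennreal (2 * p * \<bar>C\<bar> / (p - 1)) * f x * ennreal_powr (2 * f x) (p - 1)
       = (ennreal (2 * p * \<bar>C\<bar> / (p - 1)) * ennreal (2 powr (p - 1))) * (f x * ennreal_powr (f x) (p - 1))"
      using p by (simp add: ennreal_powr_mult ac_simps)
    also have "\<dots> = ennreal K * ennreal_powr (f x) p"
      using p by (simp add: ennreal_mult_powr K_def mult.commute mult.left_commute flip: ennreal_mult)
    finally show "ennreal (2 * p * \<bar>C\<bar> / (p - 1)) * f x * ennreal_powr (2 * f x) (p - 1)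
       = ennreal K * ennreal_powr (f x) p" .
  qed
  also have "\<dots> = ennreal K * (\<integral>\<^sup>+x. ennreal_powr (f x) p \<partial>\<mu>)"
    by (rule nn_integral_cmult) simp
  finally show "(\<integral>\<^sup>+x. ennreal_powr (?M x) p \<partial>\<mu>) \<le> ennreal K * (\<integral>\<^sup>+x. ennreal_powr (f x) p \<partial>\<mu>)" .
qed

end

section \<open>Muckenhoupt weights\<close>

lemma ball_sets_lebesgue [measurable]: "ball a r \<in> sets lebesgue"
  by simp

abbreviation ball_mass :: "('a::euclidean_space \<Rightarrow> real) \<Rightarrow> 'a \<Rightarrow> real \<Rightarrow> ennreal" where
  "ball_mass u a r \<equiv> \<integral>\<^sup>+x\<in>ball a r. ennreal (u x) \<partial>lebesgue"

text \<open>
  The \<open>A\<^sub>q\<close> condition is stated over balls to fit the maximal function, and for a real positive weight so that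
  powers of \<open>w\<close> with either sign can be taken.
\<close>
locale muckenhoupt_weight =
  fixes q A :: real and w :: "'a::euclidean_space \<Rightarrow> real"
  assumes q: "1 < q"
    and w_measurable [measurable]: "w \<in> borel_measurable lebesgue"
    and w_pos: "\<And>x. 0 < w x"
    and A_nonneg: "0 \<le> A"
    and Aq: "\<And>a r. 0 < r \<Longrightarrow>
      ball_mass w a r *
        ennreal_powr (\<integral>\<^sup>+x\<in>ball a r. ennreal (w x powr (- 1 / (q - 1))) \<partial>lebesgue) (q - 1)
      \<le> ennreal A * ennreal_powr (emeasure lebesgue (ball a r)) q"
begin

text \<open>
  The dual weight of \<open>w\<close>.
\<close>
definition \<sigma> :: "'a \<Rightarrow> real" where "\<sigma> x = w x powr (- 1 / (q - 1))"

abbreviation "\<mu>w \<equiv> density lebesgue (\<lambda>x. ennreal (w x))"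
abbreviation "\<mu>\<sigma> \<equiv> density lebesgue (\<lambda>x. ennreal (\<sigma> x))"

lemma \<sigma>_pos: "0 < \<sigma> x"
  using w_pos[of x] by (simp add: \<sigma>_def)

lemma \<sigma>_measurable [measurable]: "\<sigma> \<in> borel_measurable lebesgue"
  unfolding \<sigma>_def[abs_def] by measurable

lemma \<sigma>_powr: "\<sigma> x powr (1 - q) = w x"
proof -
  have "- 1 / (q - 1) * (1 - q) = 1" using q by (simp add: divide_simps)
  thus ?thesis using w_pos[of x] by (simp only: \<sigma>_def powr_powr) simp
qed

lemma \<sigma>_powr': "\<sigma> x powr (q - 1) = 1 / w x"
  using \<sigma>_powr[of x] powr_minus_divide[of "\<sigma> x" "q - 1"] w_pos[of x] by simp

text \<open>
  The masses of a ball under \<open>w\<close> and \<open>\<sigma>\<close> do not vanish since both weights are positive; the \<open>A\<^sub>q\<close> bound on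
  their product then forces both to be finite, so that further estimates can be made in the reals.
\<close>
lemma ball_mass_finite:
  assumes r: "0 < r"
  obtains b \<omega> s where "0 < b" "0 < \<omega>" "0 < s"
    "emeasure lebesgue (ball a r) = ennreal b"
    "ball_mass w a r = ennreal \<omega>"
    "ball_mass \<sigma> a r = ennreal s"
    "\<omega> * s powr (q - 1) \<le> A * b powr q"
proof -
  let ?B = "ball a r"
  let ?W = "\<integral>\<^sup>+x\<in>?B. ennreal (w x) \<partial>lebesgue" and ?S = "\<integral>\<^sup>+x\<in>?B. ennreal (\<sigma> x) \<partial>lebesgue"
  define b where "b = unit_ball_vol (DIM('a)) * r ^ DIM('a)"
  have b: "0 < b" "emeasure lebesgue ?B = ennreal b"
    using r by (auto simp: b_def emeasure_ball)
  have pos: "(\<integral>\<^sup>+x\<in>?B. ennreal (u x) \<partial>lebesgue) \<noteq> 0"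
    if [measurable]: "u \<in> borel_measurable lebesgue" and u: "\<And>x. 0 < u x" for u :: "'a \<Rightarrow> real"
  proof
    assume "(\<integral>\<^sup>+x\<in>?B. ennreal (u x) \<partial>lebesgue) = 0"
    hence "AE x in lebesgue. ennreal (u x) * indicator ?B x = 0"
      by (subst (asm) nn_integral_0_iff_AE) measurable
    hence "AE x in lebesgue. x \<notin> ?B"
      by eventually_elim (use u in \<open>auto simp: indicator_def ennreal_eq_0_iff not_le[symmetric] split: if_splits\<close>)
    hence "emeasure lebesgue ?B = 0"
      by (subst (asm) AE_iff_measurable[where N="?B"]) auto
    thus False using b by simp
  qed
  have W0: "?W \<noteq> 0" and S0: "?S \<noteq> 0"
    by (intro pos w_measurable w_pos \<sigma>_measurable \<sigma>_pos)+
  have le: "?W * ennreal_powr ?S (q - 1) \<le> ennreal (A * b powr q)"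
    using Aq[OF r, of a] b A_nonneg by (simp add: \<sigma>_def ennreal_powr_ennreal ennreal_mult)
  have SS: "ennreal_powr ?S (q - 1) \<noteq> 0"
    using S0 by (cases ?S) (auto simp: ennreal_powr_ennreal)
  have "?W \<noteq> top" using le SS by (auto simp: ennreal_top_mult top_unique)
  moreover have "?S \<noteq> top" using le W0 by (auto simp: ennreal_mult_top top_unique)
  ultimately obtain \<omega> s where ws: "0 \<le> \<omega>" "?W = ennreal \<omega>" "0 \<le> s" "?S = ennreal s"
    by (cases ?W; cases ?S) auto
  show thesis
  proof (rule that[OF b(1) _ _ b(2) ws(2,4)])
    show "0 < \<omega>" "0 < s" using ws W0 S0 by (auto simp: less_le)
    have "ennreal (\<omega> * s powr (q - 1)) \<le> ennreal (A * b powr q)"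
      using le ws by (simp add: ennreal_powr_ennreal ennreal_mult)
    thus "\<omega> * s powr (q - 1) \<le> A * b powr q"
      using A_nonneg by (subst (asm) ennreal_le_iff) auto
  qed
qed

text \<open>
  This inequality, opposite to the \<open>A\<^sub>q\<close> condition, holds for any weight.  It is Hoelder's inequality for
  \<open>1 = w\<^sup>1\<^sup>/\<^sup>q w\<^sup>-\<^sup>1\<^sup>/\<^sup>q\<close> up to a constant, and the proof integrates the elementary
  bound \<open>1 \<le> y + y powr (- 1 / (q - 1))\<close> at \<open>y = l w(x)\<close>.
\<close>
lemma reverse_Aq:
  assumes r: "0 < r" and b: "0 < b" "emeasure lebesgue (ball a r) = ennreal b"
    and w: "0 < \<omega>" "ball_mass w a r = ennreal \<omega>"
    and s: "0 < s" "ball_mass \<sigma> a r = ennreal s"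
  shows "b powr q \<le> 2 powr q * \<omega> * s powr (q - 1)"
proof -
  \<comment> \<open>With this \<open>l\<close> the first summand contributes exactly \<open>b / 2\<close> and can be absorbed.\<close>
  define l where "l = b / (2 * \<omega>)"
  define m where "m = l powr (- 1 / (q - 1))"
  have l: "0 < l" using b w by (simp add: l_def)
  have m: "0 < m" using l by (simp add: m_def)
  have pt: "1 \<le> l * w x + m * \<sigma> x" for x
  proof (cases "1 \<le> l * w x")
    case True
    thus ?thesis using m \<sigma>_pos[of x] by (smt (verit) mult_pos_pos)
  next
    case False
    hence "(l * w x) powr (1 / (q - 1)) \<le> 1" "0 < (l * w x) powr (1 / (q - 1))"
      using l w_pos[of x] q by (auto intro!: powr_le1)
    hence "1 \<le> (l * w x) powr (- 1 / (q - 1))"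
      by (simp add: powr_minus_divide divide_simps)
    hence "1 \<le> m * \<sigma> x" using l w_pos[of x] by (simp add: m_def \<sigma>_def powr_mult)
    thus ?thesis using l w_pos[of x] by (smt (verit) mult_pos_pos)
  qed
  have "ennreal b = (\<integral>\<^sup>+x. 1 * indicator (ball a r) x \<partial>lebesgue)" using b by simp
  also have "\<dots> \<le> (\<integral>\<^sup>+x. ennreal l * (ennreal (w x) * indicator (ball a r) x) +
      ennreal m * (ennreal (\<sigma> x) * indicator (ball a r) x) \<partial>lebesgue)"
  proof (rule nn_integral_mono)
    fix x
    have "1 \<le> ennreal (l * w x + m * \<sigma> x)" using pt[of x] by simp
    also have "\<dots> = ennreal l * ennreal (w x) + ennreal m * ennreal (\<sigma> x)"
      using l m w_pos[of x] \<sigma>_pos[of x] by (simp add: ennreal_mult less_imp_le)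
    finally show "1 * indicator (ball a r) x \<le> ennreal l * (ennreal (w x) * indicator (ball a r) x) +
      ennreal m * (ennreal (\<sigma> x) * indicator (ball a r) x)" by (auto simp: indicator_def)
  qed
  also have "\<dots> = ennreal l * ennreal \<omega> + ennreal m * ennreal s"
    using w s by (subst nn_integral_add) (auto simp: nn_integral_cmult)
  also have "\<dots> = ennreal (l * \<omega> + m * s)" using l m w s by (simp add: ennreal_mult)
  finally have "b \<le> l * \<omega> + m * s" using l m w s by (subst (asm) ennreal_le_iff) auto
  hence "b / 2 \<le> m * s" using w by (simp add: l_def)
  hence "(b / 2) powr (q - 1) \<le> (m * s) powr (q - 1)" using b q by (intro powr_mono2) auto
  also have "(m * s) powr (q - 1) = s powr (q - 1) / l"
  proof -
    have "- 1 / (q - 1) * (q - 1) = - 1" using q by simp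
    hence "m powr (q - 1) = 1 / l" using l unfolding m_def powr_powr by (simp add: powr_minus_divide)
    thus ?thesis using m s by (simp add: powr_mult)
  qed
  also have "\<dots> = 2 * \<omega> * s powr (q - 1) / b" by (simp add: l_def)
  finally have *: "(b / 2) powr (q - 1) * b \<le> 2 * \<omega> * s powr (q - 1)"
    using b by (simp add: pos_le_divide_eq)
  have "b powr q = 2 powr (q - 1) * ((b / 2) powr (q - 1) * b)"
    using b powr_mult_base[of b "q - 1"] by (simp add: powr_divide mult.commute)
  also have "\<dots> \<le> 2 powr (q - 1) * (2 * \<omega> * s powr (q - 1))"
    by (intro mult_left_mono *) simp
  also have "\<dots> = 2 powr q * \<omega> * s powr (q - 1)"
    using powr_mult_base[of 2 "q - 1"] by simp
  finally show ?thesis .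
qed

text \<open>
  The \<open>A\<^sub>q\<close> condition on the large ball, combined with its converse on the small one.  Cancelling either
  factor gives the doubling property of \<open>w\<close> and of \<open>\<sigma>\<close>.
\<close>
lemma ball_mass_dilation:
  assumes r: "0 < r"
    and w: "ball_mass w a r = ennreal \<omega>" "0 < \<omega>"
    and s: "ball_mass \<sigma> a r = ennreal s" "0 < s"
    and w': "ball_mass w a (6*r) = ennreal \<omega>'" "0 < \<omega>'"
    and s': "ball_mass \<sigma> a (6*r) = ennreal s'" "0 < s'"
  shows "\<omega>' * s' powr (q - 1) \<le> A * (2 * 6 ^ DIM('a)) powr q * \<omega> * s powr (q - 1)"
    "\<omega> \<le> \<omega>'" "s \<le> s'"
proof -
  obtain b' \<omega>1 s1 where 1: "0 < b'" "0 < \<omega>1" "0 < s1" "emeasure lebesgue (ball a (6*r)) = ennreal b'"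
    "ball_mass w a (6*r) = ennreal \<omega>1"
    "ball_mass \<sigma> a (6*r) = ennreal s1"
    "\<omega>1 * s1 powr (q - 1) \<le> A * b' powr q"
    using r by (rule_tac ball_mass_finite[of "6*r" a]) auto
  obtain b where 2: "0 < b" "emeasure lebesgue (ball a r) = ennreal b"
    using ball_mass_finite[OF r, of a] by metis
  have "b' = 6 ^ DIM('a) * b"
    using 1(1,4) 2 r by (auto simp: emeasure_ball power_mult_distrib)
  hence "b' powr q = (6 ^ DIM('a)) powr q * b powr q" using 2 by (simp add: powr_mult)
  moreover have "\<omega>1 = \<omega>'" "s1 = s'" using 1 w' s' by auto
  ultimately have "\<omega>' * s' powr (q - 1) \<le> A * ((6 ^ DIM('a)) powr q * b powr q)" using 1 by simp
  also have "\<dots> \<le> A * ((6 ^ DIM('a)) powr q * (2 powr q * \<omega> * s powr (q - 1)))"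
    using A_nonneg by (intro mult_left_mono reverse_Aq[OF r 2 w(2,1) s(2,1)]) auto
  finally show "\<omega>' * s' powr (q - 1) \<le> A * (2 * 6 ^ DIM('a)) powr q * \<omega> * s powr (q - 1)"
    by (simp add: powr_mult ac_simps)
  have mono: "ball_mass u a r \<le> (ball_mass u a (6*r))" for u
    using r by (intro nn_integral_mono) (auto simp: indicator_def)
  show "\<omega> \<le> \<omega>'" using mono[of w] w w' by (simp add: ennreal_le_iff)
  show "s \<le> s'" using mono[of \<sigma>] s s' by (simp add: ennreal_le_iff)
qed

lemma emeasure_density_ball:
  "u \<in> borel_measurable lebesgue \<Longrightarrow>
    emeasure (density lebesgue (\<lambda>x. ennreal (u x))) (ball a r) = (ball_mass u a r)"
  by (subst emeasure_density) auto

lemma ball_mass_less_top: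
  "ball_mass w a r < \<infinity>" "ball_mass \<sigma> a r < \<infinity>"
proof -
  have "ball_mass w a r < \<infinity> \<and> ball_mass \<sigma> a r < \<infinity>"
  proof (cases "0 < r")
    case True
    thus ?thesis by (rule ball_mass_finite[of r a]) auto
  next
    case False
    hence "ball a r = {}" by simp
    show ?thesis unfolding \<open>ball a r = {}\<close> by simp
  qed
  thus "ball_mass w a r < \<infinity>" "ball_mass \<sigma> a r < \<infinity>"
    by auto
qed

lemma doubling_w: "\<exists>D. doubling_measure \<mu>w D"
proof (intro exI, unfold_locales)
  define D where "D = A * (2 * 6 ^ DIM('a)) powr q"
  have D_nonneg: "0 \<le> D" using A_nonneg by (simp add: D_def)
  fix a :: 'a and r :: real
  show "emeasure \<mu>w (ball a r) < \<infinity>"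
    using ball_mass_less_top by (simp add: emeasure_density_ball)
  assume r: "0 < r"
  obtain \<omega> s where 1: "0 < \<omega>" "0 < s"
    "ball_mass w a r = ennreal \<omega>"
    "ball_mass \<sigma> a r = ennreal s"
    by (rule ball_mass_finite[OF r, of a])
  obtain \<omega>' s' where 2: "0 < \<omega>'" "0 < s'"
    "ball_mass w a (6*r) = ennreal \<omega>'"
    "ball_mass \<sigma> a (6*r) = ennreal s'"
    using r by (rule_tac ball_mass_finite[of "6*r" a]) auto
  show "0 < emeasure \<mu>w (ball a r)"
    using 1 by (simp add: emeasure_density_ball)
  note d = ball_mass_dilation[OF r 1(3,1,4,2) 2(3,1,4,2)]
  have "\<omega>' * s powr (q - 1) \<le> \<omega>' * s' powr (q - 1)"
    using d(3) 1 2 q by (intro mult_left_mono powr_mono2) auto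
  also have "\<dots> \<le> D * \<omega> * s powr (q - 1)" using d(1) by (simp add: D_def)
  finally have "\<omega>' \<le> D * \<omega>" using 1 by simp
  hence "ennreal \<omega>' \<le> ennreal D * ennreal \<omega>"
    using 1 D_nonneg by (simp add: ennreal_leI flip: ennreal_mult)
  thus "emeasure \<mu>w (ball a (6 * r))
        \<le> ennreal (A * (2 * 6 ^ DIM('a)) powr q) * emeasure \<mu>w (ball a r)"
    using 1 2 by (simp add: emeasure_density_ball D_def)
qed simp

lemma doubling_\<sigma>: "\<exists>D. doubling_measure \<mu>\<sigma> D"
proof (intro exI, unfold_locales)
  define D where "D = A * (2 * 6 ^ DIM('a)) powr q"
  have D_nonneg: "0 \<le> D" using A_nonneg by (simp add: D_def)
  fix a :: 'a and r :: real
  show "emeasure \<mu>\<sigma> (ball a r) < \<infinity>"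
    using ball_mass_less_top by (simp add: emeasure_density_ball)
  assume r: "0 < r"
  obtain \<omega> s where 1: "0 < \<omega>" "0 < s"
    "ball_mass w a r = ennreal \<omega>"
    "ball_mass \<sigma> a r = ennreal s"
    by (rule ball_mass_finite[OF r, of a])
  obtain \<omega>' s' where 2: "0 < \<omega>'" "0 < s'"
    "ball_mass w a (6*r) = ennreal \<omega>'"
    "ball_mass \<sigma> a (6*r) = ennreal s'"
    using r by (rule_tac ball_mass_finite[of "6*r" a]) auto
  show "0 < emeasure \<mu>\<sigma> (ball a r)"
    using 1 by (simp add: emeasure_density_ball)
  note d = ball_mass_dilation[OF r 1(3,1,4,2) 2(3,1,4,2)]
  have "s' powr (q - 1) * \<omega> \<le> s' powr (q - 1) * \<omega>'"
    using d(2) by (intro mult_left_mono) auto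
  also have "\<dots> \<le> D * s powr (q - 1) * \<omega>" using d(1) by (simp add: D_def ac_simps)
  finally have "s' powr (q - 1) \<le> D * s powr (q - 1)" using 1 by simp
  hence "(s' powr (q - 1)) powr (1 / (q - 1)) \<le> (D * s powr (q - 1)) powr (1 / (q - 1))"
    using q by (intro powr_mono2) auto
  hence "s' \<le> D powr (1 / (q - 1)) * s"
    using q 1 2 D_nonneg by (simp add: powr_mult powr_powr)
  hence "ennreal s' \<le> ennreal (D powr (1 / (q - 1))) * ennreal s"
    using 1 by (simp add: ennreal_leI flip: ennreal_mult)
  thus "emeasure \<mu>\<sigma> (ball a (6 * r))
        \<le> ennreal ((A * (2 * 6 ^ DIM('a)) powr q) powr (1 / (q - 1))) * emeasure \<mu>\<sigma> (ball a r)"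
    using 1 2 by (simp add: emeasure_density_ball D_def)
qed simp

text \<open>
  Lerner's pointwise inequality.  On a ball \<open>B\<close> that contains \<open>x\<close>, the \<open>\<sigma>\<close>-average of \<open>f / \<sigma>\<close> is a lower bound for
  \<open>Ms\<close> throughout \<open>B\<close>.  Raising it to the power \<open>q - 1\<close> and averaging over \<open>B\<close> with respect to \<open>w\<close> gives a
  lower bound for the maximal function of \<open>H\<close> at \<open>x\<close>; the \<open>A\<^sub>q\<close> condition converts the two weighted averages into the
  Lebesgue average of \<open>f\<close>.
\<close>
lemma maximal_function_lebesgue_le:
  fixes f :: "'a \<Rightarrow> ennreal"
  assumes [measurable]: "f \<in> borel_measurable lebesgue"
  defines "Ms \<equiv> maximal_function \<mu>\<sigma> (\<lambda>y. f y * ennreal (1 / \<sigma> y))"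
  defines "H \<equiv> \<lambda>y. ennreal_powr (Ms y) (q - 1) * ennreal (1 / w y)"
  shows "maximal_function lebesgue f x \<le>
    ennreal_powr (ennreal A * maximal_function \<mu>w H x) (1 / (q - 1))"
proof (rule maximal_function_leI)
  fix a r assume ar: "0 < r" "x \<in> ball a r"
  let ?B = "ball a r"
  let ?I = "\<integral>\<^sup>+y\<in>?B. f y \<partial>lebesgue"
  have Ms_meas[measurable]: "Ms \<in> borel_measurable lebesgue"
    unfolding Ms_def by (intro borel_measurable_maximal_function) auto
  have H_meas[measurable]: "H \<in> borel_measurable lebesgue"
    unfolding H_def by measurable
  obtain b \<omega> s where bws: "0 < b" "0 < \<omega>" "0 < s"
    "emeasure lebesgue ?B = ennreal b"
    "(\<integral>\<^sup>+x\<in>?B. ennreal (w x) \<partial>lebesgue) = ennreal \<omega>"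
    "(\<integral>\<^sup>+x\<in>?B. ennreal (\<sigma> x) \<partial>lebesgue) = ennreal s"
    "\<omega> * s powr (q - 1) \<le> A * b powr q"
    by (rule ball_mass_finite[OF ar(1), of a])
  have avg: "?I / ennreal s \<le> Ms y" if y: "y \<in> ?B" for y
  proof -
    have "(\<integral>\<^sup>+y\<in>?B. f y * ennreal (1 / \<sigma> y) \<partial>\<mu>\<sigma>)
       = (\<integral>\<^sup>+y. ennreal (\<sigma> y) * (f y * ennreal (1 / \<sigma> y) * indicator ?B y) \<partial>lebesgue)"
      by (rule nn_integral_density) measurable
    also have "\<dots> = ?I"
    proof (rule nn_integral_cong)
      fix y
      have "ennreal (\<sigma> y) * ennreal (1 / \<sigma> y) = 1" using \<sigma>_pos[of y] by (simp flip: ennreal_mult)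
      thus "ennreal (\<sigma> y) * (f y * ennreal (1 / \<sigma> y) * indicator ?B y) = f y * indicator ?B y"
        by (metis mult.assoc mult.commute mult.right_neutral)
    qed
    finally show ?thesis
      using average_le_maximal_function[OF y, of "\<mu>\<sigma>"
          "\<lambda>y. f y * ennreal (1 / \<sigma> y)"] bws
      unfolding Ms_def by (simp add: emeasure_density_ball)
  qed
  have "ennreal b * ennreal_powr (?I / ennreal s) (q - 1)
      = (\<integral>\<^sup>+y. ennreal_powr (?I / ennreal s) (q - 1) * indicator ?B y \<partial>lebesgue)"
    using bws by (subst nn_integral_cmult_indicator) (auto simp: mult.commute)
  also have "\<dots> \<le> (\<integral>\<^sup>+y. ennreal (w y) * (H y * indicator ?B y) \<partial>lebesgue)"
  proof (rule nn_integral_mono)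
    fix y
    have "ennreal (w y) * ennreal (1 / w y) = 1" using w_pos[of y] by (simp flip: ennreal_mult)
    hence "ennreal (w y) * (H y * indicator ?B y) = ennreal_powr (Ms y) (q - 1) * indicator ?B y"
      unfolding H_def by (metis mult.assoc mult.commute mult.right_neutral)
    moreover have "ennreal_powr (?I / ennreal s) (q - 1) \<le> ennreal_powr (Ms y) (q - 1)" if "y \<in> ?B"
      using avg[OF that] q by (intro ennreal_powr_mono) auto
    ultimately show "ennreal_powr (?I / ennreal s) (q - 1) * indicator ?B y
        \<le> ennreal (w y) * (H y * indicator ?B y)" by (auto simp: indicator_def)
  qed
  also have "\<dots> = (\<integral>\<^sup>+y\<in>?B. H y \<partial>\<mu>w)"
    by (rule nn_integral_density[symmetric]) auto
  finally have "ennreal b * ennreal_powr (?I / ennreal s) (q - 1) / ennreal \<omega>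
      \<le> (\<integral>\<^sup>+y\<in>?B. H y \<partial>\<mu>w) / emeasure \<mu>w ?B"
    using bws by (simp add: emeasure_density_ball divide_right_mono_ennreal)
  also have "\<dots> \<le> maximal_function \<mu>w H x"
    by (rule average_le_maximal_function[OF ar(2)])
  finally have *: "ennreal b * ennreal_powr (?I / ennreal s) (q - 1) / ennreal \<omega>
      \<le> maximal_function \<mu>w H x" .
  have "ennreal_powr (?I / ennreal b) (q - 1) \<le>
      ennreal A * (ennreal b * ennreal_powr (?I / ennreal s) (q - 1) / ennreal \<omega>)"
  proof -
    have i: "?I / ennreal c = ?I * ennreal (1 / c)" if "0 < c" for c
      using that by (simp add: divide_ennreal_def inverse_ennreal inverse_eq_divide)
    have "b powr q = b * b powr (q - 1)" using bws by (simp add: powr_mult_base)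
    hence real: "(1 / b) powr (q - 1) \<le> A * (b * (1 / s) powr (q - 1) / \<omega>)"
      using bws q by (simp add: powr_divide field_simps)
    have "ennreal_powr (?I / ennreal b) (q - 1) = ennreal_powr ?I (q - 1) * ennreal ((1 / b) powr (q - 1))"
      using q bws i[of b] by (simp add: ennreal_powr_mult ennreal_powr_ennreal)
    also have "\<dots> \<le> ennreal_powr ?I (q - 1) * ennreal (A * (b * (1 / s) powr (q - 1) / \<omega>))"
      by (intro mult_left_mono ennreal_leI real) simp
    also have "\<dots> = ennreal A * (ennreal b * ennreal_powr (?I / ennreal s) (q - 1) / ennreal \<omega>)"
    proof -
      have "ennreal (A * (b * (1 / s) powr (q - 1) / \<omega>)) =
         ennreal A * (ennreal b * ennreal ((1 / s) powr (q - 1)) / ennreal \<omega>)"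
        using bws A_nonneg by (simp add: ennreal_mult divide_ennreal[symmetric] ennreal_times_divide)
      thus ?thesis
        using q bws i[of s] by (simp add: ennreal_powr_mult ennreal_powr_ennreal divide_ennreal_def ac_simps)
    qed
    finally show ?thesis .
  qed
  also have "\<dots> \<le> ennreal A * maximal_function \<mu>w H x"
    by (intro mult_left_mono *) simp
  finally have "ennreal_powr (ennreal_powr (?I / ennreal b) (q - 1)) (1 / (q - 1)) \<le>
     ennreal_powr (ennreal A * maximal_function \<mu>w H x) (1 / (q - 1))"
    using q by (intro ennreal_powr_mono) auto
  thus "?I / emeasure lebesgue ?B \<le>
     ennreal_powr (ennreal A * maximal_function \<mu>w H x) (1 / (q - 1))"
    using q bws by (simp add: ennreal_powr_powr)
qed

text \<open>
  Muckenhoupt's theorem.  In Lerner's inequality the outer maximal function is bounded on \<open>L\<^sup>q\<^sup>'(w)\<close>, where \<open>q' = q / (q - 1)\<close>,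
  and the inner one on \<open>L\<^sup>q(\<sigma>)\<close>; the powers of the weights combine because
  \<open>w\<^sup>1\<^sup>-\<^sup>q\<^sup>' = \<sigma>\<close> and \<open>\<sigma>\<^sup>1\<^sup>-\<^sup>q = w\<close>.
\<close>
theorem maximal_function_bounded:
  obtains K where "0 \<le> K" "\<And>f. f \<in> borel_measurable lebesgue \<Longrightarrow>
    (\<integral>\<^sup>+x. ennreal_powr (maximal_function lebesgue f x) q * ennreal (w x) \<partial>lebesgue)
     \<le> ennreal K * (\<integral>\<^sup>+x. ennreal_powr (f x) q * ennreal (w x) \<partial>lebesgue)"
proof -
  obtain D1 D2 where D12: "doubling_measure \<mu>w D1" "doubling_measure \<mu>\<sigma> D2"
    using doubling_w doubling_\<sigma> by blast
  interpret W: doubling_measure \<mu>w D1 by (rule D12)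
  interpret S: doubling_measure \<mu>\<sigma> D2 by (rule D12)
  define q' where "q' = q / (q - 1)"
  have q': "1 < q'" "1 / (q - 1) * q = q'" "(q - 1) * q' = q" using q by (auto simp: q'_def)
  obtain K1 where K1: "0 \<le> K1" "\<And>f. f \<in> borel_measurable \<mu>w \<Longrightarrow>
     (\<integral>\<^sup>+x. ennreal_powr (maximal_function \<mu>w f x) q' \<partial>\<mu>w) \<le> ennreal K1 * (\<integral>\<^sup>+x. ennreal_powr (f x) q' \<partial>\<mu>w)"
    using W.maximal_function_strong_type[OF q'(1)] by metis
  obtain K2 where K2: "0 \<le> K2" "\<And>f. f \<in> borel_measurable \<mu>\<sigma> \<Longrightarrow>
     (\<integral>\<^sup>+x. ennreal_powr (maximal_function \<mu>\<sigma> f x) q \<partial>\<mu>\<sigma>) \<le> ennreal K2 * (\<integral>\<^sup>+x. ennreal_powr (f x) q \<partial>\<mu>\<sigma>)"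
    using S.maximal_function_strong_type[OF q] by metis
  show thesis
  proof (rule that)
    show "0 \<le> A powr q' * K1 * K2" using K1 K2 by simp
    fix f :: "'a \<Rightarrow> ennreal" assume [measurable]: "f \<in> borel_measurable lebesgue"
    define h where "h y = f y * ennreal (1 / \<sigma> y)" for y
    define H where "H y = ennreal_powr (maximal_function \<mu>\<sigma> h y) (q - 1) * ennreal (1 / w y)" for y
    have meas_M[measurable]: "maximal_function \<mu> g \<in> borel_measurable lebesgue" for \<mu> g
      by (intro borel_measurable_maximal_function) auto
    have [measurable]: "h \<in> borel_measurable lebesgue" unfolding h_def by measurable
    have [measurable]: "H \<in> borel_measurable lebesgue" unfolding H_def by measurable
    have "(\<integral>\<^sup>+x. ennreal_powr (maximal_function lebesgue f x) q * ennreal (w x) \<partial>lebesgue)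
       \<le> (\<integral>\<^sup>+x. ennreal (A powr q') * (ennreal (w x) * ennreal_powr (maximal_function \<mu>w H x) q') \<partial>lebesgue)"
    proof (rule nn_integral_mono)
      fix x
      have "ennreal_powr (maximal_function lebesgue f x) q \<le>
         ennreal_powr (ennreal_powr (ennreal A * maximal_function \<mu>w H x) (1 / (q - 1))) q"
        using maximal_function_lebesgue_le[of f x] q unfolding H_def h_def
        by (intro ennreal_powr_mono) auto
      also have "\<dots> = ennreal_powr (ennreal A * maximal_function \<mu>w H x) q'"
        by (simp only: ennreal_powr_powr q')
      also have "\<dots> = ennreal (A powr q') * ennreal_powr (maximal_function \<mu>w H x) q'"
        using q' A_nonneg by (simp add: ennreal_powr_mult ennreal_powr_ennreal)
      finally show "ennreal_powr (maximal_function lebesgue f x) q * ennreal (w x) \<le>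
         ennreal (A powr q') * (ennreal (w x) * ennreal_powr (maximal_function \<mu>w H x) q')"
        by (metis mult.assoc mult.commute mult_right_mono zero_le)
    qed
    also have "\<dots> = ennreal (A powr q') * (\<integral>\<^sup>+x. ennreal_powr (maximal_function \<mu>w H x) q' \<partial>\<mu>w)"
      by (subst nn_integral_cmult) (auto simp: nn_integral_density)
    also have "\<dots> \<le> ennreal (A powr q') * (ennreal K1 * (\<integral>\<^sup>+x. ennreal_powr (H x) q' \<partial>\<mu>w))"
      by (intro mult_left_mono K1) auto
    also have "(\<integral>\<^sup>+x. ennreal_powr (H x) q' \<partial>\<mu>w) = (\<integral>\<^sup>+x. ennreal_powr (maximal_function \<mu>\<sigma> h x) q \<partial>\<mu>\<sigma>)"
    proof -
      have "ennreal (w x) * ennreal_powr (H x) q' = ennreal (\<sigma> x) * ennreal_powr (maximal_function \<mu>\<sigma> h x) q" for x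
      proof -
        have "(1 / w x) powr q' = w x powr (- q')" using w_pos[of x] by (simp add: powr_divide powr_minus divide_simps)
        hence "w x * (1 / w x) powr q' = w x powr (1 + - q')"
          using w_pos[of x] by (simp add: powr_mult_base)
        also have "1 + - q' = - 1 / (q - 1)" using q by (simp add: q'_def field_simps)
        finally have e: "ennreal (w x) * ennreal ((1 / w x) powr q') = ennreal (\<sigma> x)"
          using w_pos[of x] by (simp add: \<sigma>_def less_imp_le flip: ennreal_mult)
        have "ennreal_powr (H x) q' = ennreal_powr (maximal_function \<mu>\<sigma> h x) q * ennreal ((1 / w x) powr q')"
          using q' w_pos[of x] unfolding H_def
          by (simp add: ennreal_powr_mult ennreal_powr_powr ennreal_powr_ennreal less_imp_le)
        thus ?thesis using e by (metis mult.assoc mult.commute)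
      qed
      thus ?thesis by (simp add: nn_integral_density)
    qed
    also have "ennreal (A powr q') * (ennreal K1 * (\<integral>\<^sup>+x. ennreal_powr (maximal_function \<mu>\<sigma> h x) q \<partial>\<mu>\<sigma>))
      \<le> ennreal (A powr q') * (ennreal K1 * (ennreal K2 * (\<integral>\<^sup>+x. ennreal_powr (h x) q \<partial>\<mu>\<sigma>)))"
      by (intro mult_left_mono K2) auto
    also have "(\<integral>\<^sup>+x. ennreal_powr (h x) q \<partial>\<mu>\<sigma>) = (\<integral>\<^sup>+x. ennreal_powr (f x) q * ennreal (w x) \<partial>lebesgue)"
    proof -
      have "ennreal (\<sigma> x) * ennreal_powr (h x) q = ennreal_powr (f x) q * ennreal (w x)" for x
      proof -
        have "(1 / \<sigma> x) powr q = \<sigma> x powr (- q)" using \<sigma>_pos[of x] by (simp add: powr_divide powr_minus divide_simps)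
        hence "\<sigma> x * (1 / \<sigma> x) powr q = \<sigma> x powr (1 + - q)"
          using \<sigma>_pos[of x] by (simp add: powr_mult_base)
        hence e: "ennreal (\<sigma> x) * ennreal ((1 / \<sigma> x) powr q) = ennreal (w x)"
          using \<sigma>_powr[of x] \<sigma>_pos[of x] by (simp add: less_imp_le flip: ennreal_mult)
        have "ennreal_powr (h x) q = ennreal_powr (f x) q * ennreal ((1 / \<sigma> x) powr q)"
          using q \<sigma>_pos[of x] unfolding h_def
          by (simp add: ennreal_powr_mult ennreal_powr_ennreal less_imp_le)
        thus ?thesis using e by (metis mult.assoc mult.commute)
      qed
      thus ?thesis by (simp add: nn_integral_density)
    qed
    also have "ennreal (A powr q') * (ennreal K1 * (ennreal K2 * (\<integral>\<^sup>+x. ennreal_powr (f x) q * ennreal (w x) \<partial>lebesgue)))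
      = ennreal (A powr q' * K1 * K2) * (\<integral>\<^sup>+x. ennreal_powr (f x) q * ennreal (w x) \<partial>lebesgue)"
      using K1 K2 by (simp add: ennreal_mult mult.assoc)
    finally show "(\<integral>\<^sup>+x. ennreal_powr (maximal_function lebesgue f x) q * ennreal (w x) \<partial>lebesgue)
      \<le> ennreal (A powr q' * K1 * K2) * (\<integral>\<^sup>+x. ennreal_powr (f x) q * ennreal (w x) \<partial>lebesgue)" .
  qed
qed

text \<open>
  Functions in \<open>L\<^sup>q(w)\<close> are locally integrable because \<open>\<bar>f\<bar> \<le> \<bar>f\<bar>\<^sup>q w + \<sigma>\<close>: where \<open>\<bar>f\<bar>\<close> exceeds \<open>\<sigma>\<close>,
  the factor \<open>\<bar>f\<bar>\<^sup>q\<^sup>-\<^sup>1 w\<close> is at least \<open>1\<close>.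
\<close>
lemma nn_integral_ball_finite:
  fixes f :: "'a \<Rightarrow> real"
  assumes [measurable]: "f \<in> borel_measurable lebesgue"
    and f: "(\<integral>\<^sup>+x. ennreal (\<bar>f x\<bar> powr q) * ennreal (w x) \<partial>lebesgue) < \<infinity>"
  shows "(\<integral>\<^sup>+x\<in>ball a r. ennreal \<bar>f x\<bar> \<partial>lebesgue) < \<infinity>"
proof -
  have pt: "\<bar>f x\<bar> \<le> \<bar>f x\<bar> powr q * w x + \<sigma> x" for x
  proof (cases "\<bar>f x\<bar> \<le> \<sigma> x")
    case True
    thus ?thesis using w_pos[of x] by (simp add: add_increasing)
  next
    case False
    have "1 / w x \<le> \<bar>f x\<bar> powr (q - 1)" unfolding \<sigma>_powr'[symmetric]
      using False \<sigma>_pos[of x] q by (intro powr_mono2) auto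
    hence "1 \<le> \<bar>f x\<bar> powr (q - 1) * w x" using w_pos[of x] by (simp add: pos_divide_le_eq)
    hence "\<bar>f x\<bar> * 1 \<le> \<bar>f x\<bar> * (\<bar>f x\<bar> powr (q - 1) * w x)" by (intro mult_left_mono) auto
    also have "\<dots> = \<bar>f x\<bar> powr q * w x" using powr_mult_base[of "\<bar>f x\<bar>" "q - 1"] by simp
    finally show ?thesis using \<sigma>_pos[of x] by simp
  qed
  have "(\<integral>\<^sup>+x\<in>ball a r. ennreal \<bar>f x\<bar> \<partial>lebesgue) \<le>
     (\<integral>\<^sup>+x. ennreal (\<bar>f x\<bar> powr q) * ennreal (w x) + ennreal (\<sigma> x) * indicator (ball a r) x \<partial>lebesgue)"
  proof (rule nn_integral_mono)
    fix x
    have "ennreal \<bar>f x\<bar> \<le> ennreal (\<bar>f x\<bar> powr q * w x + \<sigma> x)" by (intro ennreal_leI pt)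
    also have "\<dots> = ennreal (\<bar>f x\<bar> powr q) * ennreal (w x) + ennreal (\<sigma> x)"
      using w_pos[of x] \<sigma>_pos[of x] by (simp add: ennreal_mult less_imp_le)
    finally show "ennreal \<bar>f x\<bar> * indicator (ball a r) x \<le>
       ennreal (\<bar>f x\<bar> powr q) * ennreal (w x) + ennreal (\<sigma> x) * indicator (ball a r) x"
      by (auto simp: indicator_def)
  qed
  also have "\<dots> < \<infinity>"
    using f ball_mass_less_top(2)[of a r] by (subst nn_integral_add) auto
  finally show ?thesis .
qed

end

lemma emeasure_cube:
  fixes a :: "real ^ 'n"
  assumes "0 < l"
  shows "emeasure lebesgue (cbox a (\<chi> i. a $ i + l)) = ennreal (l ^ CARD('n))"
proof -
  have "measure lborel (cbox a (\<chi> i. a $ i + l)) = l ^ CARD('n)"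
    using assms by (subst content_cbox_cart) (auto simp: interval_ne_empty_cart)
  moreover have "emeasure lborel (cbox a (\<chi> i. a $ i + l)) \<noteq> top"
    using emeasure_lborel_cbox_finite[of a "\<chi> i. a $ i + l"] by simp
  hence "emeasure lborel (cbox a (\<chi> i. a $ i + l)) = ennreal (measure lborel (cbox a (\<chi> i. a $ i + l)))"
    by (rule emeasure_eq_ennreal_measure)
  ultimately show ?thesis by simp
qed

text \<open>
  A ball of radius \<open>r\<close> lies in a cube of edge \<open>2 r\<close>, and their volumes have a fixed ratio.  The weight is changed to
  \<open>1\<close> on the null set where it is zero or infinite.
\<close>
lemma Muckenhoupt_imp_muckenhoupt_weight:
  fixes w :: "real ^ 'n \<Rightarrow> ennreal"
  assumes q: "1 < q" and w: "w \<in> Muckenhoupt q"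
  obtains A w' where "muckenhoupt_weight q A w'" "AE x in lebesgue. w x = ennreal (w' x)"
proof -
  define w' where "w' x = (if 0 < w x \<and> w x < \<infinity> then enn2real (w x) else 1)" for x
  have w_meas [measurable]: "w \<in> borel_measurable lebesgue"
    and w_AE: "AE x in lebesgue. 0 < w x \<and> w x < \<infinity>"
    using w by (auto simp: Muckenhoupt_def weight_def)
  have AE_eq: "AE x in lebesgue. w x = ennreal (w' x)"
    using w_AE by eventually_elim (auto simp: w'_def)
  have w'_meas [measurable]: "w' \<in> borel_measurable lebesgue"
    unfolding w'_def by measurable
  have w'_pos: "0 < w' x" for x
    by (auto simp: w'_def enn2real_positive_iff)
  let ?\<sigma> = "\<lambda>x. ennreal (enn2real (w x) powr (- 1 / (q - 1)))"
  obtain S where S: "0 \<le> S" "(SUP Q\<in>cubes. mean_value Q w *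
        ennreal_powr (mean_value Q ?\<sigma>) (q - 1)) = ennreal S"
    using w unfolding Muckenhoupt_def by (auto simp: less_top_ennreal)
  define v where "v = unit_ball_vol (real CARD('n))"
  define A where "A = S * (2 ^ CARD('n) / v) powr q"
  have v: "0 < v" by (simp add: v_def)
  have "muckenhoupt_weight q A w'"
  proof
    show "0 \<le> A" using S by (simp add: A_def)
    fix a :: "real ^ 'n" and r :: real assume r: "0 < r"
    let ?a = "\<chi> i. a $ i - r"
    let ?Q = "cbox ?a (\<chi> i. ?a $ i + 2 * r)"
    define c where "c = (2 * r) ^ CARD('n)"
    have c: "0 < c" using r by (simp add: c_def)
    have Q: "?Q \<in> cubes" using r unfolding cubes_def by (intro CollectI exI[of _ ?a] exI[of _ "2 * r"]) simp
    have eQ: "emeasure lebesgue ?Q = ennreal c"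
      using emeasure_cube[of "2 * r" ?a] r by (simp add: c_def)
    have sub: "ball a r \<subseteq> ?Q"
    proof
      fix x assume "x \<in> ball a r"
      hence "\<bar>x $ i - a $ i\<bar> \<le> r" for i
        using component_le_norm_cart[of "x - a" i] by (simp add: dist_norm norm_minus_commute)
      thus "x \<in> ?Q" by (auto simp: mem_box_cart abs_le_iff) (smt (verit))+
    qed
    have le1: "(\<integral>\<^sup>+x\<in>ball a r. ennreal (w' x) \<partial>lebesgue) \<le> mean_value ?Q w * ennreal c"
    proof -
      have "(\<integral>\<^sup>+x\<in>ball a r. ennreal (w' x) \<partial>lebesgue) \<le> (\<integral>\<^sup>+x\<in>?Q. w x \<partial>lebesgue)"
        by (rule nn_integral_mono_AE) (use AE_eq in eventually_elim, use sub in \<open>auto simp: indicator_def\<close>)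
      also have "\<dots> = mean_value ?Q w * ennreal c"
        unfolding mean_value_def eQ using c by (simp add: ennreal_divide_times)
      finally show ?thesis .
    qed
    have le2: "(\<integral>\<^sup>+x\<in>ball a r. ennreal (w' x powr (- 1 / (q - 1))) \<partial>lebesgue) \<le> mean_value ?Q ?\<sigma> * ennreal c"
    proof -
      have "(\<integral>\<^sup>+x\<in>ball a r. ennreal (w' x powr (- 1 / (q - 1))) \<partial>lebesgue) \<le> (\<integral>\<^sup>+x\<in>?Q. ?\<sigma> x \<partial>lebesgue)"
        by (rule nn_integral_mono_AE) (use w_AE in eventually_elim, use sub in \<open>auto simp: indicator_def w'_def\<close>)
      also have "\<dots> = mean_value ?Q ?\<sigma> * ennreal c"
        unfolding mean_value_def eQ using c by (simp add: ennreal_divide_times)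
      finally show ?thesis .
    qed
    have "(\<integral>\<^sup>+x\<in>ball a r. ennreal (w' x) \<partial>lebesgue) *
        ennreal_powr (\<integral>\<^sup>+x\<in>ball a r. ennreal (w' x powr (- 1 / (q - 1))) \<partial>lebesgue) (q - 1)
      \<le> (mean_value ?Q w * ennreal c) * ennreal_powr (mean_value ?Q ?\<sigma> * ennreal c) (q - 1)"
      using q by (intro mult_mono le1 ennreal_powr_mono le2) auto
    also have "\<dots> = (mean_value ?Q w * ennreal_powr (mean_value ?Q ?\<sigma>) (q - 1)) * (ennreal c * ennreal (c powr (q - 1)))"
      using q c by (simp add: ennreal_powr_mult ennreal_powr_ennreal ac_simps)
    also have "ennreal c * ennreal (c powr (q - 1)) = ennreal (c powr q)"
      using c powr_mult_base[of c "q - 1"] by (simp flip: ennreal_mult)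
    also have "mean_value ?Q w * ennreal_powr (mean_value ?Q ?\<sigma>) (q - 1) \<le> ennreal S"
      unfolding S(2)[symmetric] by (rule SUP_upper[OF Q])
    also have "ennreal S * ennreal (c powr q) = ennreal A * ennreal_powr (emeasure lebesgue (ball a r)) q"
    proof -
      have "c = 2 ^ CARD('n) / v * (v * r ^ CARD('n))" using v by (simp add: c_def power_mult_distrib)
      hence "c powr q = (2 ^ CARD('n) / v) powr q * (v * r ^ CARD('n)) powr q"
        using v r by (metis powr_mult)
      hence "S * c powr q = A * (v * r ^ CARD('n)) powr q" by (simp add: A_def)
      moreover have "emeasure lebesgue (ball a r) = ennreal (v * r ^ CARD('n))"
        using r by (simp add: emeasure_ball v_def)
      ultimately show ?thesis
        using S v r \<open>0 \<le> A\<close> by (simp add: ennreal_powr_ennreal flip: ennreal_mult)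
    qed
    finally show "(\<integral>\<^sup>+x\<in>ball a r. ennreal (w' x) \<partial>lebesgue) *
        ennreal_powr (\<integral>\<^sup>+x\<in>ball a r. ennreal (w' x powr (- 1 / (q - 1))) \<partial>lebesgue) (q - 1)
      \<le> ennreal A * ennreal_powr (emeasure lebesgue (ball a r)) q"
      by (simp add: mult_right_mono)
  qed (use q w'_pos w'_meas in auto)
  with AE_eq show thesis using that by blast
qed

section \<open>Smooth functions\<close>

lemma frechet_derivative_eqI:
  "(f has_derivative f') (at x) \<Longrightarrow> frechet_derivative f (at x) = f'"
  by (rule frechet_derivative_at[symmetric])

lemma C_diff_SucI:
  assumes "\<And>x. (f has_derivative f' x) (at x)" "\<And>i. C_diff k (\<lambda>x. f' x (axis i 1))"
  shows "C_diff (Suc k) f"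
  using assms by (auto simp: differentiable_def frechet_derivative_eqI[OF assms(1)])

lemma C_diff_SucE:
  assumes "C_diff (Suc k) f"
  obtains f' where "\<And>x. (f has_derivative f' x) (at x)" "\<And>i. C_diff k (\<lambda>x. f' x (axis i 1))"
  using assms that[of "\<lambda>x. frechet_derivative f (at x)"] by (auto simp: frechet_derivative_works)

lemma C_diff_continuous:
  assumes "C_diff k f"
  shows "continuous_on UNIV f"
proof (cases k)
  case (Suc l)
  hence "\<forall>x. f differentiable (at x)" using assms by simp
  thus ?thesis
    by (intro continuous_at_imp_continuous_on) (blast intro: differentiable_imp_continuous_within)
qed (use assms in simp)

lemma C_diff_Suc_imp: "C_diff (Suc k) f \<Longrightarrow> C_diff k f"
proof (induction k arbitrary: f)
  case 0
  thus ?case using C_diff_continuous[of "Suc 0" f] by simp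
next
  case (Suc k)
  show ?case
    using Suc.prems Suc.IH unfolding C_diff.simps(2)[of "Suc k" f] C_diff.simps(2)[of k f] by blast
qed

lemma C_diff_const: "C_diff k (\<lambda>x. c)"
proof (induction k arbitrary: c)
  case (Suc k)
  show ?case by (rule C_diff_SucI[of _ "\<lambda>x h. 0"]) (auto intro: Suc.IH)
qed simp

lemma C_diff_component: "C_diff k (\<lambda>x. x $ j)"
proof (cases k)
  case (Suc l)
  show ?thesis unfolding Suc
    by (rule C_diff_SucI[of _ "\<lambda>x h. h $ j"])
       (auto intro: C_diff_const bounded_linear_imp_has_derivative bounded_linear_vec_nth)
qed (auto intro: continuous_intros)

lemma C_diff_add: "C_diff k f \<Longrightarrow> C_diff k g \<Longrightarrow> C_diff k (\<lambda>x. f x + g x)"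
proof (induction k arbitrary: f g)
  case 0
  thus ?case by (auto intro: continuous_intros)
next
  case (Suc k)
  obtain f' where f': "\<And>x. (f has_derivative f' x) (at x)" "\<And>i. C_diff k (\<lambda>x. f' x (axis i 1))"
    using Suc.prems(1) by (rule C_diff_SucE) blast
  obtain g' where g': "\<And>x. (g has_derivative g' x) (at x)" "\<And>i. C_diff k (\<lambda>x. g' x (axis i 1))"
    using Suc.prems(2) by (rule C_diff_SucE) blast
  show ?case
    by (rule C_diff_SucI[where f'="\<lambda>x h. f' x h + g' x h"])
       (auto intro: Suc.IH f' g' has_derivative_add)
qed

lemma C_diff_mult: "C_diff k f \<Longrightarrow> C_diff k g \<Longrightarrow> C_diff k (\<lambda>x. f x * g x)"
proof (induction k arbitrary: f g)
  case 0
  thus ?case by (auto intro: continuous_intros)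
next
  case (Suc k)
  obtain f' where f': "\<And>x. (f has_derivative f' x) (at x)" "\<And>i. C_diff k (\<lambda>x. f' x (axis i 1))"
    using Suc.prems(1) by (rule C_diff_SucE) blast
  obtain g' where g': "\<And>x. (g has_derivative g' x) (at x)" "\<And>i. C_diff k (\<lambda>x. g' x (axis i 1))"
    using Suc.prems(2) by (rule C_diff_SucE) blast
  show ?case
  proof (rule C_diff_SucI)
    show "((\<lambda>x. f x * g x) has_derivative (\<lambda>h. f x * g' x h + f' x h * g x)) (at x)" for x
      by (rule has_derivative_mult f' g')+
    show "C_diff k (\<lambda>x. f x * g' x (axis i 1) + f' x (axis i 1) * g x)" for i
      by (intro C_diff_add Suc.IH f'(2) g'(2) C_diff_Suc_imp[OF Suc.prems(1)] C_diff_Suc_imp[OF Suc.prems(2)])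
  qed
qed

lemma C_diff_sum: "(\<And>j. j \<in> J \<Longrightarrow> C_diff k (f j)) \<Longrightarrow> C_diff k (\<lambda>x. \<Sum>j\<in>J. f j x)"
  by (induction J rule: infinite_finite_induct) (auto intro: C_diff_const C_diff_add)

lemma C_diff_affine: "C_diff k f \<Longrightarrow> C_diff k (\<lambda>x. f (c *\<^sub>R x + d))"
proof (induction k arbitrary: f)
  case 0
  thus ?case by (auto intro!: continuous_on_compose2[of UNIV f] continuous_intros)
next
  case (Suc k)
  obtain f' where f': "\<And>x. (f has_derivative f' x) (at x)" "\<And>i. C_diff k (\<lambda>x. f' x (axis i 1))"
    using Suc.prems by (rule C_diff_SucE) blast
  show ?case
  proof (rule C_diff_SucI)
    show "((\<lambda>x. f (c *\<^sub>R x + d)) has_derivative (\<lambda>h. c * f' (c *\<^sub>R x + d) h)) (at x)" for x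
    proof -
      have "((\<lambda>x. f (c *\<^sub>R x + d)) has_derivative (\<lambda>h. f' (c *\<^sub>R x + d) (c *\<^sub>R h))) (at x)"
        by (rule has_derivative_compose[OF _ f'(1)]) (auto intro!: derivative_eq_intros)
      moreover have "f' (c *\<^sub>R x + d) (c *\<^sub>R h) = c * f' (c *\<^sub>R x + d) h" for h
        using linear_cmul[OF has_derivative_linear[OF f'(1)]] by simp
      ultimately show ?thesis by simp
    qed
    show "C_diff k (\<lambda>x. c * f' (c *\<^sub>R x + d) (axis i 1))" for i
      by (intro C_diff_mult C_diff_const Suc.IH f')
  qed
qed

lemma test_function_mult:
  assumes "test_function f" "\<And>k. C_diff k g"
  shows "test_function (\<lambda>x. f x * g x)"
proof -
  have "bounded {x. f x \<noteq> 0}"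
    using assms(1) by (simp add: test_function_def compact_closure)
  hence "compact (closure {x. f x * g x \<noteq> 0})"
    unfolding compact_closure by (rule bounded_subset) auto
  thus ?thesis using assms by (auto simp: test_function_def intro: C_diff_mult)
qed

lemma compact_closure_support: "{x. f x \<noteq> 0} \<subseteq> ball a r \<Longrightarrow> compact (closure {x. f x \<noteq> (0::real)})"
  for a :: "'a::euclidean_space"
  using bounded_subset[OF bounded_ball] by (simp add: compact_closure)

lemma test_function_support:
  assumes "test_function f"
  obtains \<rho> where "0 < \<rho>" "\<And>x. f x \<noteq> 0 \<Longrightarrow> norm x < \<rho>"
proof -
  have "bounded {x. f x \<noteq> 0}"
    using assms unfolding test_function_def by (simp add: compact_closure)
  then obtain B where B: "0 < B" "\<forall>x\<in>{x. f x \<noteq> 0}. norm x \<le> B" unfolding bounded_pos by auto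
  show thesis by (rule that[of "B + 1"]) (use B in force)+
qed

lemma test_function_affine:
  assumes f: "test_function f" and c: "c \<noteq> 0"
  shows "test_function (\<lambda>x. f (c *\<^sub>R x + d))"
proof -
  obtain \<rho> where \<rho>: "0 < \<rho>" "\<And>x. f x \<noteq> 0 \<Longrightarrow> norm x < \<rho>" using test_function_support[OF f] by metis
  have "{x. f (c *\<^sub>R x + d) \<noteq> 0} \<subseteq> ball (- (d /\<^sub>R c)) (\<rho> / \<bar>c\<bar>)"
  proof
    fix x assume "x \<in> {x. f (c *\<^sub>R x + d) \<noteq> 0}"
    hence "norm (c *\<^sub>R x + d) < \<rho>" using \<rho> by simp
    moreover have "c *\<^sub>R x + d = c *\<^sub>R (x + d /\<^sub>R c)" using c by (simp add: scaleR_add_right)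
    ultimately have "\<bar>c\<bar> * norm (x + d /\<^sub>R c) < \<rho>" by simp
    thus "x \<in> ball (- (d /\<^sub>R c)) (\<rho> / \<bar>c\<bar>)"
      using c by (simp add: dist_norm norm_minus_commute pos_less_divide_eq mult.commute add.commute)
  qed
  thus ?thesis using f compact_closure_support[of "\<lambda>x. f (c *\<^sub>R x + d)"]
    unfolding test_function_def by (auto intro: C_diff_affine)
qed

text \<open>
  The functions \<open>exp (- 1 / t) / t ^ m\<close>, extended by zero.  Their span is closed under
  differentiation, so all derivatives of the smooth function \<open>exp (- 1 / t)\<close> are treated at once.
\<close>
definition flat_exp :: "nat \<Rightarrow> real \<Rightarrow> real" where
  "flat_exp m t = (if 0 < t then exp (- 1 / t) / t ^ m else 0)"

lemma flat_exp_has_derivative: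
  "(flat_exp m has_real_derivative (flat_exp (m + 2) t - real m * flat_exp (m + 1) t)) (at t)"
proof -
  consider "0 < t" | "t < 0" | "t = 0" by linarith
  thus ?thesis
  proof cases
    case 1
    have "((\<lambda>t. exp (- 1 / t) / t ^ m) has_real_derivative
        (flat_exp (m + 2) t - real m * flat_exp (m + 1) t)) (at t)"
    proof (cases m)
      case 0
      thus ?thesis using 1 by (auto intro!: derivative_eq_intros simp: flat_exp_def field_simps power2_eq_square)
    next
      case (Suc l)
      have "((\<lambda>t. exp (- 1 / t) / t ^ Suc l) has_real_derivative
         (exp (- 1 / t) * (1 / t\<^sup>2) * t ^ Suc l - exp (- 1 / t) * (real (Suc l) * t ^ l)) / (t ^ Suc l * t ^ Suc l)) (at t)"
      proof -
        have "((\<lambda>t. exp (- 1 / t)) has_real_derivative exp (- 1 / t) * (1 / t\<^sup>2)) (at t)"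
          using 1 by (auto intro!: derivative_eq_intros simp: power2_eq_square)
        from DERIV_divide[OF this DERIV_pow[of "Suc l" t]] 1 show ?thesis by simp
      qed
      moreover have "(exp (- 1 / t) * (1 / t\<^sup>2) * t ^ Suc l - exp (- 1 / t) * (real (Suc l) * t ^ l)) / (t ^ Suc l * t ^ Suc l)
         = flat_exp (Suc l + 2) t - real (Suc l) * flat_exp (Suc l + 1) t"
        using 1 by (simp add: flat_exp_def divide_simps) (simp add: algebra_simps power2_eq_square)
      ultimately show ?thesis unfolding Suc by simp
    qed
    moreover have "eventually (\<lambda>t. flat_exp m t = exp (- 1 / t) / t ^ m) (nhds t)"
      using eventually_nhds_in_open[of "{0<..}" t] 1 by (auto elim!: eventually_mono simp: flat_exp_def)
    ultimately show ?thesis by (subst DERIV_cong_ev[OF refl _ refl])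
  next
    case 2
    have "((\<lambda>t. 0::real) has_real_derivative
        (flat_exp (m + 2) t - real m * flat_exp (m + 1) t)) (at t)"
      using 2 by (simp add: flat_exp_def)
    moreover have "eventually (\<lambda>t. flat_exp m t = 0) (nhds t)"
      using eventually_nhds_in_open[of "{..<0}" t] 2 by (auto elim!: eventually_mono simp: flat_exp_def)
    ultimately show ?thesis by (subst DERIV_cong_ev[OF refl _ refl])
  next
    case 3
    have "((\<lambda>h. flat_exp (m + 1) h) \<longlongrightarrow> 0) (at 0)"
    proof (rule filterlim_split_at)
      show "(flat_exp (m + 1) \<longlongrightarrow> 0) (at_left 0)"
        by (rule tendsto_eventually) (auto simp: eventually_at_left_field flat_exp_def intro!: exI[of _ "-1"])
      have "((\<lambda>h::real. exp (- 1 / h) / h ^ (m + 1)) \<longlongrightarrow> 0) (at_right 0)"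
        by real_asymp
      thus "(flat_exp (m + 1) \<longlongrightarrow> 0) (at_right 0)"
        by (rule Lim_transform_eventually) (auto simp: eventually_at_right_field flat_exp_def intro!: exI[of _ 1])
    qed
    hence "((\<lambda>h. (flat_exp m (0 + h) - flat_exp m 0) / h) \<longlongrightarrow> 0) (at 0)"
      by (rule Lim_transform_eventually) (auto simp: eventually_at_filter flat_exp_def)
    thus ?thesis using 3 by (simp add: DERIV_def flat_exp_def)
  qed
qed

lemma C_diff_flat_exp:
  assumes p: "\<And>k. C_diff k p"
  shows "C_diff k (\<lambda>x. flat_exp m (p x))"
proof (induction k arbitrary: m)
  case 0
  have "continuous_on UNIV (flat_exp m)"
    by (intro continuous_at_imp_continuous_on ballI DERIV_isCont[OF flat_exp_has_derivative])
  thus ?case using C_diff_continuous[OF p[of 0]] by (auto intro: continuous_on_compose2)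
next
  case (Suc k)
  obtain p' where p': "\<And>x. (p has_derivative p' x) (at x)" "\<And>i. C_diff k (\<lambda>x. p' x (axis i 1))"
    using p[of "Suc k"] by (rule C_diff_SucE) blast
  show ?case
  proof (rule C_diff_SucI)
    show "((\<lambda>x. flat_exp m (p x)) has_derivative
        (\<lambda>h. (flat_exp (m + 2) (p x) + (- real m) * flat_exp (m + 1) (p x)) * p' x h)) (at x)" for x
      using has_derivative_compose[OF p'(1) flat_exp_has_derivative[unfolded has_field_derivative_def]]
      by (simp add: mult.commute)
    show "C_diff k (\<lambda>x. (flat_exp (m + 2) (p x) + (- real m) * flat_exp (m + 1) (p x)) * p' x (axis i 1))" for i
      by (intro C_diff_mult C_diff_add C_diff_const Suc.IH p')
  qed
qed

text \<open>
  The support is the ball of radius \<open>1 / 4\<close> about the centre of the unit cube, so that a translate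
  by a vector of length at most \<open>1 / 4\<close> is still supported in the unit cube.
\<close>
definition bump :: "real ^ 'n \<Rightarrow> real" where
  "bump u = flat_exp 0 (1 / 16 - (norm (u - (\<chi> i. 1 / 2)))\<^sup>2)"

lemma bump_nonneg: "0 \<le> bump u"
  by (simp add: bump_def flat_exp_def)

lemma bump_nonzero_iff: "bump u \<noteq> 0 \<longleftrightarrow> norm (u - (\<chi> i. 1 / 2)) < 1 / 4"
proof -
  have "(norm (u - (\<chi> i. 1 / 2)))\<^sup>2 < (1 / 4)\<^sup>2 \<longleftrightarrow> norm (u - (\<chi> i. 1 / 2)) < 1 / 4"
    using power2_less_imp_less[of "norm (u - (\<chi> i. 1 / 2))" "1 / 4"]
      power_strict_mono[of "norm (u - (\<chi> i. 1 / 2))" "1 / 4" 2] by auto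
  thus ?thesis by (simp add: bump_def flat_exp_def power2_eq_square)
qed

lemma test_function_bump: "test_function (bump :: real ^ 'n \<Rightarrow> real)"
  unfolding test_function_def
proof
  have eq: "bump = (\<lambda>u :: real ^ 'n. flat_exp 0 (1 / 16 + (- 1) * (\<Sum>j\<in>UNIV. (u $ j + (- 1 / 2)) * (u $ j + (- 1 / 2)))))"
    by (rule ext) (simp add: bump_def power2_norm_eq_inner inner_vec_def)
  show "\<forall>k. C_diff k (bump :: real ^ 'n \<Rightarrow> real)"
    unfolding eq
    by (intro allI C_diff_flat_exp C_diff_add C_diff_mult C_diff_sum C_diff_const C_diff_component)
  show "compact (closure {x :: real ^ 'n. bump x \<noteq> 0})"
    by (rule compact_closure_support[of _ "\<chi> i. 1 / 2" "1 / 4"])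
       (auto simp: bump_nonzero_iff dist_norm norm_minus_commute)
qed

lemma test_function_continuous: "test_function f \<Longrightarrow> continuous_on UNIV f"
  unfolding test_function_def using C_diff_continuous by blast

lemma test_function_has_derivative:
  "test_function f \<Longrightarrow> (f has_derivative frechet_derivative f (at x)) (at x)"
  unfolding test_function_def by (metis C_diff.simps(2) frechet_derivative_works)

lemma test_function_derivative:
  assumes "test_function f"
  shows "test_function (\<lambda>x. frechet_derivative f (at x) (axis i 1))"
proof -
  obtain \<rho> where \<rho>: "0 < \<rho>" "\<And>x. f x \<noteq> 0 \<Longrightarrow> norm x < \<rho>" using test_function_support[OF assms] by metis
  have "frechet_derivative f (at x) (axis i 1) = 0" if "\<rho> + 1 \<le> norm x" for x
  proof -
    have "f y = 0" if "y \<in> - cball 0 \<rho>" for y using that \<rho>(2)[of y] by auto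
    hence "(f has_derivative (\<lambda>_. 0)) (at x)"
      using that \<rho>(1)
      by (intro has_derivative_transform_within_open[OF has_derivative_const[of 0], of "- cball 0 \<rho>"])
         (auto simp: open_Compl)
    thus ?thesis by (simp add: frechet_derivative_eqI)
  qed
  hence "{x. frechet_derivative f (at x) (axis i 1) \<noteq> 0} \<subseteq> ball 0 (\<rho> + 1)"
    by (auto simp: not_le[symmetric])
  thus ?thesis using assms compact_closure_support unfolding test_function_def
    by (metis C_diff.simps(2))
qed

lemma test_function_bounded:
  assumes "test_function f"
  obtains K where "0 \<le> K" "\<And>x. \<bar>f x\<bar> \<le> K"
proof -
  let ?S = "closure {x. f x \<noteq> 0}"
  have "compact (f ` ?S)"
    using assms test_function_continuous[OF assms] continuous_on_subset
    by (intro compact_continuous_image) (auto simp: test_function_def)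
  hence "bounded (f ` ?S)" by (rule compact_imp_bounded)
  then obtain B where B: "\<forall>y\<in>f ` ?S. norm y \<le> B" unfolding bounded_iff by auto
  have "\<bar>f x\<bar> \<le> \<bar>B\<bar>" for x
  proof (cases "f x = 0")
    case False
    hence "x \<in> ?S" using closure_subset[of "{x. f x \<noteq> 0}"] by auto
    hence "norm (f x) \<le> B" using B by (metis imageI)
    thus ?thesis by simp
  qed simp
  thus thesis using that[of "\<bar>B\<bar>"] by simp
qed

section \<open>Lebesgue points\<close>

text \<open>
  The differentiation theorem for cubes with corner \<open>x\<close> is applied to \<open>\<bar>f - c\<bar>\<close> for all rational
  \<open>c\<close>; a rational number close to \<open>f x\<close> then stands in for the value \<open>f x\<close> itself.
\<close>
lemma lebesgue_points:
  fixes f :: "'a::euclidean_space \<Rightarrow> real"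
  assumes f: "\<And>a b. f absolutely_integrable_on cbox a b"
  obtains N where "N \<in> null_sets lebesgue"
    "\<And>x. x \<notin> N \<Longrightarrow> ((\<lambda>h. integral (cbox x (x + h *\<^sub>R One)) (\<lambda>y. \<bar>f y - f x\<bar>) / h ^ DIM('a)) \<longlongrightarrow> 0) (at_right 0)"
proof -
  have abs_int: "(\<lambda>y. \<bar>f y - c\<bar>) integrable_on cbox a b" for a b c
  proof -
    have "(\<lambda>y. f y - c) absolutely_integrable_on cbox a b"
      by (intro set_integral_diff f absolutely_integrable_continuous continuous_intros)
    thus ?thesis by (simp add: absolutely_integrable_on_def)
  qed
  have "\<exists>N. negligible N \<and> (\<forall>x e. x \<notin> N \<longrightarrow> 0 < e \<longrightarrow> (\<exists>d>0. \<forall>h. 0 < h \<and> h < d \<longrightarrow>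
      norm (integral (cbox x (x + h *\<^sub>R One)) (\<lambda>y. \<bar>f y - c\<bar>) /\<^sub>R h ^ DIM('a) - \<bar>f x - c\<bar>) < e))" for c
    by (rule integrable_ccontinuous_explicit[of "\<lambda>y. \<bar>f y - c\<bar>"]) (use abs_int in auto)
  then obtain N where N: "\<And>c. negligible (N c)"
    "\<And>c x e. x \<notin> N c \<Longrightarrow> 0 < e \<Longrightarrow> (\<exists>d>0. \<forall>h. 0 < h \<and> h < d \<longrightarrow>
      norm (integral (cbox x (x + h *\<^sub>R One)) (\<lambda>y. \<bar>f y - c\<bar>) /\<^sub>R h ^ DIM('a) - \<bar>f x - c\<bar>) < e)"
    by metis
  show thesis
  proof (rule that)
    have "negligible (\<Union>c\<in>\<rat>. N c)"
      using N(1) countable_rat by (intro negligible_countable_Union) auto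
    thus "(\<Union>c\<in>\<rat>. N c) \<in> null_sets lebesgue" by (simp add: negligible_iff_null_sets)
    fix x assume x: "x \<notin> (\<Union>c\<in>\<rat>. N c)"
    show "((\<lambda>h. integral (cbox x (x + h *\<^sub>R One)) (\<lambda>y. \<bar>f y - f x\<bar>) / h ^ DIM('a)) \<longlongrightarrow> 0) (at_right 0)"
    proof (rule tendstoI)
      fix e :: real assume e: "0 < e"
      obtain c where c: "c \<in> \<rat>" "f x - e / 3 < c" "c < f x + e / 3"
        using Rats_dense_in_real[of "f x - e / 3" "f x + e / 3"] e by auto
      have xc: "\<bar>f x - c\<bar> < e / 3" using c by linarith
      obtain d where d: "0 < d" "\<And>h. 0 < h \<Longrightarrow> h < d \<Longrightarrow>
         norm (integral (cbox x (x + h *\<^sub>R One)) (\<lambda>y. \<bar>f y - c\<bar>) /\<^sub>R h ^ DIM('a) - \<bar>f x - c\<bar>) < e / 3"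
        using N(2)[of x c "e / 3"] x c e by auto
      have "dist (integral (cbox x (x + h *\<^sub>R One)) (\<lambda>y. \<bar>f y - f x\<bar>) / h ^ DIM('a)) 0 < e"
        if h: "0 < h" "h < d" for h
      proof -
        let ?Q = "cbox x (x + h *\<^sub>R One)"
        let ?m = "h ^ DIM('a)"
        have m: "0 < ?m" using h by simp
        have cont: "measure lborel ?Q = ?m" using h by (subst content_cbox) (auto simp: inner_simps)
        have "integral ?Q (\<lambda>y. \<bar>f y - f x\<bar>) \<le> integral ?Q (\<lambda>y. \<bar>f y - c\<bar> + \<bar>f x - c\<bar>)"
          by (intro integral_le abs_int integrable_add) auto
        also have "\<dots> = integral ?Q (\<lambda>y. \<bar>f y - c\<bar>) + \<bar>f x - c\<bar> * ?m"
          by (subst integral_add) (auto simp: abs_int cont)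
        finally have "integral ?Q (\<lambda>y. \<bar>f y - f x\<bar>) / ?m \<le> integral ?Q (\<lambda>y. \<bar>f y - c\<bar>) / ?m + \<bar>f x - c\<bar>"
          using m by (simp add: field_simps)
        moreover have "0 \<le> integral ?Q (\<lambda>y. \<bar>f y - f x\<bar>)" by (intro integral_nonneg abs_int) auto
        moreover have "integral ?Q (\<lambda>y. \<bar>f y - c\<bar>) / ?m < \<bar>f x - c\<bar> + e / 3"
        proof -
          have "\<bar>integral ?Q (\<lambda>y. \<bar>f y - c\<bar>) / ?m - \<bar>f x - c\<bar>\<bar> < e / 3"
            using d(2)[OF h] by (simp only: real_norm_def real_scaleR_def divide_inverse_commute)
          thus ?thesis by linarith
        qed
        ultimately show ?thesis using xc m
          unfolding dist_real_def by (simp add: abs_of_nonneg divide_nonneg_pos)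
      qed
      thus "eventually (\<lambda>h. dist (integral (cbox x (x + h *\<^sub>R One)) (\<lambda>y. \<bar>f y - f x\<bar>) / h ^ DIM('a)) 0 < e) (at_right 0)"
        using d(1) by (auto simp: eventually_at_right_field)
    qed
  qed
qed

section \<open>Sobolev functions satisfy the pointwise inequality\<close>

lemma has_derivative_under_integral:
  fixes h h' :: "real \<Rightarrow> 'a \<Rightarrow> real"
  assumes \<delta>: "0 < \<delta>"
    and int: "\<And>t. \<bar>t - s\<bar> < \<delta> \<Longrightarrow> integrable M (h t)"
    and der: "\<And>t y. \<bar>t - s\<bar> < \<delta> \<Longrightarrow> ((\<lambda>t. h t y) has_real_derivative h' t y) (at t)"
    and bound: "\<And>t y. \<bar>t - s\<bar> < \<delta> \<Longrightarrow> \<bar>h' t y\<bar> \<le> B y"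
    and B: "integrable M B" and meas: "h' s \<in> borel_measurable M"
  shows "((\<lambda>t. \<integral>y. h t y \<partial>M) has_real_derivative (\<integral>y. h' s y \<partial>M)) (at s)"
  unfolding has_field_derivative_iff tendsto_at_iff_sequentially
proof (intro allI impI)
  fix X :: "nat \<Rightarrow> real" assume X: "\<forall>i. X i \<in> UNIV - {s}" "X \<longlonglongrightarrow> s"
  obtain N where N: "\<And>i. i \<ge> N \<Longrightarrow> \<bar>X i - s\<bar> < \<delta>"
    using X(2) \<delta> unfolding LIMSEQ_iff by auto
  let ?X = "\<lambda>i. X (i + N)"
  have X': "\<bar>?X i - s\<bar> < \<delta>" "?X i \<noteq> s" for i using N[of "i + N"] X(1) by auto
  have lip: "\<bar>h t y - h s y\<bar> \<le> B y * \<bar>t - s\<bar>" if t: "\<bar>t - s\<bar> < \<delta>" for t y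
  proof -
    have "norm (h t y - h s y) \<le> B y * norm (t - s)"
    proof (rule field_differentiable_bound[where S="{s - \<delta><..<s + \<delta>}" and f'="\<lambda>t. h' t y"])
      fix z assume "z \<in> {s - \<delta><..<s + \<delta>}"
      hence "\<bar>z - s\<bar> < \<delta>" by auto
      thus "((\<lambda>t. h t y) has_field_derivative h' z y) (at z within {s - \<delta><..<s + \<delta>})"
        "norm (h' z y) \<le> B y"
        using der bound by (auto intro: has_field_derivative_at_within)
    qed (use t \<delta> in \<open>auto simp: abs_less_iff\<close>)
    thus ?thesis by simp
  qed
  have "(\<lambda>i. \<integral>y. (h (?X i) y - h s y) / (?X i - s) \<partial>M) \<longlonglongrightarrow> (\<integral>y. h' s y \<partial>M)"
  proof (rule integral_dominated_convergence[where w=B])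
    show "AE y in M. (\<lambda>i. (h (?X i) y - h s y) / (?X i - s)) \<longlonglongrightarrow> h' s y"
    proof (rule AE_I2)
      fix y
      have "((\<lambda>t. (h t y - h s y) / (t - s)) \<longlongrightarrow> h' s y) (at s)"
        using der[of s y] \<delta> by (simp add: has_field_derivative_iff)
      moreover have "filterlim ?X (at s) sequentially"
        using X' LIMSEQ_ignore_initial_segment[OF X(2), of N] by (simp add: filterlim_at)
      ultimately show "(\<lambda>i. (h (?X i) y - h s y) / (?X i - s)) \<longlonglongrightarrow> h' s y"
        by (rule filterlim_compose)
    qed
    show "AE y in M. norm ((h (?X i) y - h s y) / (?X i - s)) \<le> B y" for i
      using lip[OF X'(1)[of i]] X'(2)[of i] by (intro AE_I2) (simp add: pos_divide_le_eq)
    show "(\<lambda>y. (h (?X i) y - h s y) / (?X i - s)) \<in> borel_measurable M" for i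
      using int[OF X'(1)[of i]] int[of s] \<delta>
      by (intro borel_measurable_divide borel_measurable_diff borel_measurable_const borel_measurable_integrable) auto
  qed (use B meas in auto)
  moreover have "(\<integral>y. (h (?X i) y - h s y) / (?X i - s) \<partial>M)
      = ((\<integral>y. h (?X i) y \<partial>M) - (\<integral>y. h s y \<partial>M)) / (?X i - s)" for i
    using int[OF X'(1)[of i]] int[of s] \<delta> by (subst integral_divide_zero) simp
  ultimately have "(\<lambda>i. ((\<integral>y. h (?X i) y \<partial>M) - (\<integral>y. h s y \<partial>M)) / (?X i - s)) \<longlonglongrightarrow> (\<integral>y. h' s y \<partial>M)"
    by (simp only:)
  thus "((\<lambda>t. ((\<integral>y. h t y \<partial>M) - (\<integral>y. h s y \<partial>M)) / (t - s)) \<circ> X) \<longlonglongrightarrow> (\<integral>y. h' s y \<partial>M)"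
    unfolding o_def by (rule LIMSEQ_offset)
qed

lemma continuous_lebesgue_measurable:
  fixes g :: "'a::euclidean_space \<Rightarrow> real"
  shows "continuous_on UNIV g \<Longrightarrow> g \<in> borel_measurable lebesgue"
  by (intro measurable_completion) (simp add: borel_measurable_continuous_onI)

lemma locally_integrable_measurable:
  fixes f :: "real ^ 'n \<Rightarrow> 'b::euclidean_space"
  assumes "locally_integrable f"
  shows "f \<in> borel_measurable lebesgue"
proof -
  have m: "(\<lambda>x. indicat_real (cball 0 (real k)) x *\<^sub>R f x) \<in> borel_measurable lebesgue" for k
    using assms unfolding locally_integrable_def set_integrable_def by (metis borel_measurable_integrable compact_cball)
  have "(\<lambda>k. indicat_real (cball 0 (real k)) x *\<^sub>R f x) \<longlonglongrightarrow> f x" for x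
  proof (rule tendsto_eventually)
    obtain N where N: "norm x \<le> real N" using real_arch_simple by blast
    show "eventually (\<lambda>k. indicat_real (cball 0 (real k)) x *\<^sub>R f x = f x) sequentially"
      using eventually_ge_at_top[of N] by eventually_elim (use N in \<open>simp add: indicator_def\<close>)
  qed
  thus ?thesis by (intro borel_measurable_LIMSEQ_metric[OF m])
qed

lemma integrable_times_bounded_support:
  fixes f g :: "real ^ 'n \<Rightarrow> real"
  assumes f: "locally_integrable f" and g: "g \<in> borel_measurable lebesgue"
    and gb: "\<And>x. \<bar>g x\<bar> \<le> K" and gs: "\<And>x. g x \<noteq> 0 \<Longrightarrow> x \<in> cball a r"
  shows "integrable lebesgue (\<lambda>x. f x * g x)"
proof (rule Bochner_Integration.integrable_bound[where f="\<lambda>x. K * (indicat_real (cball a r) x *\<^sub>R f x)"])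
  show "integrable lebesgue (\<lambda>x. K * (indicat_real (cball a r) x *\<^sub>R f x))"
    using f unfolding locally_integrable_def set_integrable_def by (intro integrable_mult_right) auto
  show "(\<lambda>x. f x * g x) \<in> borel_measurable lebesgue"
    using g locally_integrable_measurable[OF f] by simp
  show "AE x in lebesgue. norm (f x * g x) \<le> norm (K * (indicat_real (cball a r) x *\<^sub>R f x))"
  proof (rule AE_I2)
    fix x
    have "\<bar>g x\<bar> \<le> \<bar>K\<bar>" using gb[of x] by simp
    hence "\<bar>f x\<bar> * \<bar>g x\<bar> \<le> \<bar>f x\<bar> * \<bar>K\<bar>" by (rule mult_left_mono) simp
    thus "norm (f x * g x) \<le> norm (K * (indicat_real (cball a r) x *\<^sub>R f x))"
      using gs[of x] by (cases "g x = 0") (auto simp: abs_mult mult.commute)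
  qed
qed

lemma locally_integrable_1: "locally_integrable (\<lambda>x. 1 :: real)"
  unfolding locally_integrable_def set_integrable_def
  using lmeasurable_compact by (auto simp: lmeasurable_iff_integrable)

lemma integrable_times_test_function:
  fixes f g :: "real ^ 'n \<Rightarrow> real"
  assumes f: "locally_integrable f" and g: "test_function g"
  shows "integrable lebesgue (\<lambda>x. f x * g x)"
proof -
  obtain K where K: "0 \<le> K" "\<And>x. \<bar>g x\<bar> \<le> K" using test_function_bounded[OF g] by metis
  obtain \<rho> where \<rho>: "0 < \<rho>" "\<And>x. g x \<noteq> 0 \<Longrightarrow> norm x < \<rho>" using test_function_support[OF g] by metis
  show ?thesis
    by (rule integrable_times_bounded_support[OF f _ K(2), where a=0 and r=\<rho>])
       (use \<rho>(2) in \<open>force intro: continuous_lebesgue_measurable test_function_continuous g\<close>)+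
qed

lemma locally_integrable_component:
  fixes G :: "real ^ 'n \<Rightarrow> real ^ 'm"
  assumes "locally_integrable G"
  shows "locally_integrable (\<lambda>x. G x $ i)"
  unfolding locally_integrable_def
proof (intro allI impI)
  fix K :: "(real ^ 'n) set" assume "compact K"
  hence "integrable lebesgue (\<lambda>x. (indicat_real K x *\<^sub>R G x) \<bullet> axis i 1)"
    using assms unfolding locally_integrable_def set_integrable_def by (intro integrable_inner_left) auto
  thus "set_integrable lebesgue K (\<lambda>x. G x $ i)"
    unfolding set_integrable_def by (simp add: inner_axis)
qed

definition dilated_kernel :: "(real ^ 'n \<Rightarrow> real) \<Rightarrow> real ^ 'n \<Rightarrow> real \<Rightarrow> real ^ 'n \<Rightarrow> real" where
  "dilated_kernel \<kappa> x s y = \<kappa> ((1 / s) *\<^sub>R (y - x)) / s ^ CARD('n)"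

text \<open>
  The derivative in \<open>s\<close> of the dilated kernel, grouped by coordinates so that its form as a divergence is visible.
\<close>
definition dilation_derivative :: "(real ^ 'n \<Rightarrow> real) \<Rightarrow> real ^ 'n \<Rightarrow> real \<Rightarrow> real ^ 'n \<Rightarrow> real" where
  "dilation_derivative \<kappa> x s y = - (\<Sum>i\<in>UNIV.
     \<kappa> ((1 / s) *\<^sub>R (y - x)) + frechet_derivative \<kappa> (at ((1 / s) *\<^sub>R (y - x))) (axis i 1) * ((1 / s) *\<^sub>R (y - x)) $ i)
     / s ^ (CARD('n) + 1)"

lemma linear_sum_components:
  fixes L :: "real ^ 'n \<Rightarrow> real"
  assumes "linear L"
  shows "L v = (\<Sum>i\<in>UNIV. L (axis i 1) * v $ i)"
proof -
  have "L v = L (\<Sum>i\<in>UNIV. v $ i *\<^sub>R axis i 1)" by (simp add: basis_expansion flip: scalar_mult_eq_scaleR)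
  also have "\<dots> = (\<Sum>i\<in>UNIV. L (axis i 1) * v $ i)"
    using assms by (simp add: linear_sum linear_cmul mult.commute)
  finally show ?thesis .
qed

lemma dilated_kernel_has_derivative:
  fixes \<kappa> :: "real ^ 'n \<Rightarrow> real"
  assumes \<kappa>: "test_function \<kappa>" and s: "0 < s"
  shows "((\<lambda>s. dilated_kernel \<kappa> x s y) has_real_derivative dilation_derivative \<kappa> x s y) (at s)"
proof -
  let ?v = "\<lambda>s. (1 / s) *\<^sub>R (y - x)"
  let ?D = "frechet_derivative \<kappa> (at (?v s))"
  let ?n = "CARD('n)"
  have D: "(\<kappa> has_derivative ?D) (at (?v s))" by (rule test_function_has_derivative[OF \<kappa>])
  have "((\<lambda>s. ?v s) has_derivative (\<lambda>h. (- h / s\<^sup>2) *\<^sub>R (y - x))) (at s)"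
    using s by (auto intro!: derivative_eq_intros simp: power2_eq_square)
  from has_derivative_compose[OF this D]
  have "((\<lambda>s. \<kappa> (?v s)) has_derivative (\<lambda>h. ?D ((- h / s\<^sup>2) *\<^sub>R (y - x)))) (at s)" .
  moreover have "?D ((- h / s\<^sup>2) *\<^sub>R (y - x)) = (- ?D (?v s) / s) * h" for h
  proof -
    have "(- h / s\<^sup>2) *\<^sub>R (y - x) = (- h / s) *\<^sub>R ?v s" using s by (simp add: power2_eq_square)
    thus ?thesis using linear_cmul[OF has_derivative_linear[OF D], of "- h / s" "?v s"]
      by (simp del: scaleR_scaleR)
  qed
  ultimately have k: "((\<lambda>s. \<kappa> (?v s)) has_real_derivative (- ?D (?v s) / s)) (at s)"
    unfolding has_field_derivative_def by (simp only:)
  have "((\<lambda>s. \<kappa> (?v s) / s ^ ?n) has_real_derivative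
     ((- ?D (?v s) / s) * s ^ ?n - \<kappa> (?v s) * (real ?n * s ^ (?n - Suc 0))) / (s ^ ?n * s ^ ?n)) (at s)"
    using s by (intro DERIV_divide k DERIV_pow) auto
  moreover have "((- ?D (?v s) / s) * s ^ ?n - \<kappa> (?v s) * (real ?n * s ^ (?n - Suc 0))) / (s ^ ?n * s ^ ?n)
     = dilation_derivative \<kappa> x s y"
  proof -
    have n: "s ^ ?n = s * s ^ (?n - Suc 0)"
      using zero_less_card_finite[where 'a='n] by (metis Suc_pred power_Suc)
    have "dilation_derivative \<kappa> x s y = - (real ?n * \<kappa> (?v s) + ?D (?v s)) / (s * s ^ ?n)"
      unfolding dilation_derivative_def sum.distrib
      by (subst linear_sum_components[OF has_derivative_linear[OF D], symmetric]) simp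
    also have "\<dots> = ((- ?D (?v s) / s) * s ^ ?n - \<kappa> (?v s) * (real ?n * s ^ (?n - Suc 0))) / (s ^ ?n * s ^ ?n)"
      using s unfolding n by (simp add: divide_simps) (simp add: algebra_simps)
    finally show ?thesis by simp
  qed
  ultimately show ?thesis unfolding dilated_kernel_def by simp
qed

text \<open>
  The components of the vector field whose divergence in \<open>y\<close> is minus the \<open>s\<close>-derivative of the dilated kernel.
\<close>
definition moment_kernel :: "(real ^ 'n \<Rightarrow> real) \<Rightarrow> real ^ 'n \<Rightarrow> real \<Rightarrow> 'n \<Rightarrow> real ^ 'n \<Rightarrow> real" where
  "moment_kernel \<kappa> x s i y = dilated_kernel \<kappa> x s y * (((1 / s) *\<^sub>R (y - x)) $ i)"

lemma test_function_dilated_kernel: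
  assumes "test_function \<kappa>" "0 < s"
  shows "test_function (dilated_kernel \<kappa> x s)"
proof -
  have "test_function (\<lambda>y. \<kappa> ((1 / s) *\<^sub>R y + (- (1 / s) *\<^sub>R x)) * (1 / s ^ CARD('a)))"
    using assms by (intro test_function_mult test_function_affine C_diff_const) auto
  thus ?thesis unfolding dilated_kernel_def[abs_def] by (simp add: scaleR_diff_right)
qed

lemma C_diff_scaled_component: "C_diff k (\<lambda>y. ((c::real) *\<^sub>R (y - x)) $ i)"
  using C_diff_mult[OF C_diff_const[of k c] C_diff_add[OF C_diff_component[of k i] C_diff_const[of k "- x $ i"]]]
  by simp

lemma test_function_moment_kernel:
  "test_function \<kappa> \<Longrightarrow> 0 < s \<Longrightarrow> test_function (moment_kernel \<kappa> x s i)"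
  unfolding moment_kernel_def[abs_def]
  by (intro test_function_mult test_function_dilated_kernel C_diff_scaled_component)

text \<open>
  This identity turns a change of scale into a weak gradient: dilation is transport along the radial field
  \<open>(y - x) / s\<close>.
\<close>
lemma sum_frechet_derivative_moment_kernel:
  fixes \<kappa> :: "real ^ 'n \<Rightarrow> real"
  assumes \<kappa>: "test_function \<kappa>" and s: "0 < s"
  shows "(\<Sum>i\<in>UNIV. frechet_derivative (moment_kernel \<kappa> x s i) (at y) (axis i 1)) = - dilation_derivative \<kappa> x s y"
proof -
  let ?v = "\<lambda>y. (1 / s) *\<^sub>R (y - x)"
  let ?D = "frechet_derivative \<kappa> (at (?v y))"
  let ?n = "CARD('n)"
  have D: "(\<kappa> has_derivative ?D) (at (?v y))" by (rule test_function_has_derivative[OF \<kappa>])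
  have "frechet_derivative (moment_kernel \<kappa> x s i) (at y) (axis i 1)
      = (\<kappa> (?v y) + ?D (axis i 1) * ?v y $ i) / s ^ (?n + 1)" for i
  proof -
    have v: "(?v has_derivative (\<lambda>h. (1 / s) *\<^sub>R h)) (at y)"
      by (auto intro!: derivative_eq_intros)
    have 1: "((\<lambda>y. \<kappa> (?v y)) has_derivative (\<lambda>h. ?D ((1 / s) *\<^sub>R h))) (at y)"
      by (rule has_derivative_compose[OF v D])
    have 2: "((\<lambda>y. ?v y $ i) has_derivative (\<lambda>h. ((1 / s) *\<^sub>R h) $ i)) (at y)"
      by (rule has_derivative_compose[OF v bounded_linear_imp_has_derivative[OF bounded_linear_vec_nth]])
    have "((\<lambda>y. \<kappa> (?v y) * (?v y $ i) * (1 / s ^ ?n)) has_derivative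
        (\<lambda>h. (\<kappa> (?v y) * ((1 / s) *\<^sub>R h) $ i + ?D ((1 / s) *\<^sub>R h) * ?v y $ i) * (1 / s ^ ?n))) (at y)"
      by (intro has_derivative_mult_left has_derivative_mult 1 2)
    hence "frechet_derivative (\<lambda>y. \<kappa> (?v y) * (?v y $ i) * (1 / s ^ ?n)) (at y) =
       (\<lambda>h. (\<kappa> (?v y) * ((1 / s) *\<^sub>R h) $ i + ?D ((1 / s) *\<^sub>R h) * ?v y $ i) * (1 / s ^ ?n))"
      by (rule frechet_derivative_eqI)
    moreover have "moment_kernel \<kappa> x s i = (\<lambda>y. \<kappa> (?v y) * (?v y $ i) * (1 / s ^ ?n))"
      by (rule ext) (simp add: moment_kernel_def dilated_kernel_def)
    moreover have "?D ((1 / s) *\<^sub>R axis i 1) = ?D (axis i 1) / s"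
      using linear_cmul[OF has_derivative_linear[OF D], of "1 / s" "axis i 1"] by simp
    ultimately show ?thesis by (simp only: ) (use s in \<open>simp add: axis_def field_simps\<close>)
  qed
  thus ?thesis by (simp add: dilation_derivative_def sum_divide_distrib)
qed


lemma test_function_bounded_support:
  assumes "test_function f"
  obtains K \<rho> where "0 \<le> K" "0 < \<rho>" "\<And>x. \<bar>f x\<bar> \<le> K" "\<And>x. f x \<noteq> 0 \<Longrightarrow> norm x < \<rho>"
  using test_function_bounded[OF assms] test_function_support[OF assms] by metis

text \<open>
  Bounds that are uniform for \<open>s\<close> in a compact part of the half-line, as required for
  differentiating under the integral sign.
\<close>
lemma dilation_derivative_bound:
  fixes \<kappa> :: "real ^ 'n \<Rightarrow> real"
  assumes \<kappa>: "test_function \<kappa>"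
  obtains L \<rho> where "0 \<le> L" "0 < \<rho>" "\<And>x s y. 0 < s \<Longrightarrow> \<bar>dilation_derivative \<kappa> x s y\<bar> \<le> L / s ^ (CARD('n) + 1)"
    "\<And>x s y. 0 < s \<Longrightarrow> dilation_derivative \<kappa> x s y \<noteq> 0 \<Longrightarrow> norm (y - x) < \<rho> * s"
proof -
  define g where "g v = (\<Sum>i\<in>UNIV. \<kappa> v + frechet_derivative \<kappa> (at v) (axis i 1) * v $ i)" for v :: "real ^ 'n"
  obtain \<rho>0 where \<rho>0: "0 < \<rho>0" "\<And>x. \<kappa> x \<noteq> 0 \<Longrightarrow> norm x < \<rho>0" using test_function_support[OF \<kappa>] by metis
  have "\<exists>K \<rho>. 0 \<le> K \<and> 0 < \<rho> \<and> (\<forall>x. \<bar>\<kappa> x + frechet_derivative \<kappa> (at x) (axis i 1) * x $ i\<bar> \<le> K) \<and>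
       (\<forall>x. \<kappa> x + frechet_derivative \<kappa> (at x) (axis i 1) * x $ i \<noteq> 0 \<longrightarrow> norm x < \<rho>)" for i :: 'n
  proof -
    obtain K1 \<rho>1 where 1: "0 \<le> K1" "0 < \<rho>1" "\<And>x. \<bar>\<kappa> x\<bar> \<le> K1" "\<And>x. \<kappa> x \<noteq> 0 \<Longrightarrow> norm x < \<rho>1"
      using test_function_bounded_support[OF \<kappa>] by metis
    have t: "test_function (\<lambda>x. frechet_derivative \<kappa> (at x) (axis i 1) * x $ i)"
      by (intro test_function_mult test_function_derivative \<kappa> C_diff_component)
    obtain K2 \<rho>2 where 2: "0 \<le> K2" "0 < \<rho>2" "\<And>x. \<bar>frechet_derivative \<kappa> (at x) (axis i 1) * x $ i\<bar> \<le> K2"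
       "\<And>x. frechet_derivative \<kappa> (at x) (axis i 1) * x $ i \<noteq> 0 \<Longrightarrow> norm x < \<rho>2"
      using test_function_bounded_support[OF t] by metis
    show ?thesis
    proof (rule exI[of _ "K1 + K2"], rule exI[of _ "\<rho>1 + \<rho>2"], intro conjI allI impI)
      show "\<bar>\<kappa> x + frechet_derivative \<kappa> (at x) (axis i 1) * x $ i\<bar> \<le> K1 + K2" for x
        using 1(3)[of x] 2(3)[of x] by linarith
      show "norm x < \<rho>1 + \<rho>2" if "\<kappa> x + frechet_derivative \<kappa> (at x) (axis i 1) * x $ i \<noteq> 0" for x
        using 1(2) 2(2) 1(4)[of x] 2(4)[of x] that by force
    qed (use 1 2 in auto)
  qed
  then obtain K \<rho> where K: "\<And>i. 0 \<le> K i" "\<And>i. 0 < \<rho> i"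
    "\<And>i x. \<bar>\<kappa> x + frechet_derivative \<kappa> (at x) (axis i 1) * x $ i\<bar> \<le> K i"
    "\<And>i x. \<kappa> x + frechet_derivative \<kappa> (at x) (axis i 1) * x $ i \<noteq> 0 \<Longrightarrow> norm x < \<rho> i"
    by metis
  have gK: "\<bar>g v\<bar> \<le> (\<Sum>i\<in>UNIV. K i)" for v
    unfolding g_def using K(3) by (intro order_trans[OF sum_abs] sum_mono) auto
  have g\<rho>: "norm v < (\<Sum>i\<in>UNIV. \<rho> i)" if nz: "g v \<noteq> 0" for v
  proof -
    obtain i where "\<kappa> v + frechet_derivative \<kappa> (at v) (axis i 1) * v $ i \<noteq> 0"
      using nz unfolding g_def by (metis (no_types, lifting) sum.not_neutral_contains_not_neutral)
    hence "norm v < \<rho> i" by (rule K(4))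
    also have "\<rho> i \<le> (\<Sum>i\<in>UNIV. \<rho> i)" using K(2) by (intro member_le_sum) (auto simp: less_imp_le)
    finally show ?thesis .
  qed
  have eq: "dilation_derivative \<kappa> x s y = - g ((1 / s) *\<^sub>R (y - x)) / s ^ (CARD('n) + 1)" for x s y
    by (simp add: dilation_derivative_def g_def)
  show thesis
  proof (rule that)
    show "0 \<le> (\<Sum>i\<in>UNIV. K i)" using K(1) by (intro sum_nonneg) auto
    show "0 < (\<Sum>i\<in>UNIV. \<rho> i)" using K(2) by (intro sum_pos) auto
    show "\<bar>dilation_derivative \<kappa> x s y\<bar> \<le> (\<Sum>i\<in>UNIV. K i) / s ^ (CARD('n) + 1)" if "0 < s" for x s y
      unfolding eq using gK[of "(1 / s) *\<^sub>R (y - x)"] that by (simp add: abs_div divide_right_mono)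
    show "norm (y - x) < (\<Sum>i\<in>UNIV. \<rho> i) * s" if "0 < s" "dilation_derivative \<kappa> x s y \<noteq> 0" for x s y
    proof -
      have "norm ((1 / s) *\<^sub>R (y - x)) < (\<Sum>i\<in>UNIV. \<rho> i)"
        using that unfolding eq by (intro g\<rho>) auto
      thus ?thesis using that by (simp add: pos_divide_less_eq)
    qed
  qed
qed

abbreviation dilated_average :: "(real ^ 'n \<Rightarrow> real) \<Rightarrow> (real ^ 'n \<Rightarrow> real) \<Rightarrow> real ^ 'n \<Rightarrow> real \<Rightarrow> real" where
  "dilated_average f \<kappa> x s \<equiv> \<integral>y. f y * dilated_kernel \<kappa> x s y \<partial>lebesgue"

lemma dilated_average_has_derivative:
  fixes f :: "real ^ 'n \<Rightarrow> real"
  assumes \<kappa>: "test_function \<kappa>" and f: "locally_integrable f" and s: "0 < s"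
  shows "((\<lambda>s. dilated_average f \<kappa> x s) has_real_derivative
     (\<integral>y. f y * dilation_derivative \<kappa> x s y \<partial>lebesgue)) (at s)"
proof -
  let ?n = "CARD('n) + 1"
  obtain L \<rho> where L: "0 \<le> L" "0 < \<rho>" "\<And>x s y. 0 < s \<Longrightarrow> \<bar>dilation_derivative \<kappa> x s y\<bar> \<le> L / s ^ ?n"
    "\<And>x s y. 0 < s \<Longrightarrow> dilation_derivative \<kappa> x s y \<noteq> 0 \<Longrightarrow> norm (y - x) < \<rho> * s"
    using dilation_derivative_bound[OF \<kappa>] by metis
  let ?B = "\<lambda>y. \<bar>f y * (L / (s / 2) ^ ?n * indicator (cball x (\<rho> * (2 * s))) y)\<bar>"
  show ?thesis
  proof (rule has_derivative_under_integral[where \<delta>="s / 2" and B="?B"])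
    fix t assume t: "\<bar>t - s\<bar> < s / 2"
    hence t': "s / 2 < t" "t < 2 * s" using s unfolding abs_less_iff by linarith+
    hence t0: "0 < t" using s by simp
    show "integrable lebesgue (\<lambda>y. f y * dilated_kernel \<kappa> x t y)"
      by (intro integrable_times_test_function f test_function_dilated_kernel \<kappa> t0)
    fix y
    show "((\<lambda>t. f y * dilated_kernel \<kappa> x t y) has_real_derivative f y * dilation_derivative \<kappa> x t y) (at t)"
      by (intro DERIV_cmult dilated_kernel_has_derivative \<kappa> t0)
    have "\<bar>dilation_derivative \<kappa> x t y\<bar> \<le> L / (s / 2) ^ ?n * indicator (cball x (\<rho> * (2 * s))) y"
    proof (cases "dilation_derivative \<kappa> x t y = 0")
      case True
      thus ?thesis using L s by simp
    next
      case False
      have "norm (y - x) < \<rho> * t" by (rule L(4)[OF t0 False])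
      also have "\<dots> \<le> \<rho> * (2 * s)" using t' L by (intro mult_left_mono) auto
      finally have "y \<in> cball x (\<rho> * (2 * s))" by (simp add: dist_norm norm_minus_commute)
      moreover have "L / t ^ ?n \<le> L / (s / 2) ^ ?n"
        using t' s L by (intro divide_left_mono power_mono mult_pos_pos zero_less_power) auto
      ultimately show ?thesis using L(3)[OF t0, of x y] by simp
    qed
    hence "\<bar>f y\<bar> * \<bar>dilation_derivative \<kappa> x t y\<bar> \<le> \<bar>f y\<bar> * (L / (s / 2) ^ ?n * indicator (cball x (\<rho> * (2 * s))) y)"
      by (rule mult_left_mono) simp
    also have "\<dots> \<le> ?B y" unfolding abs_mult[of "f y"] by (intro mult_left_mono abs_ge_self) simp
    finally show "\<bar>f y * dilation_derivative \<kappa> x t y\<bar> \<le> ?B y" by (simp add: abs_mult)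
  next
    show "integrable lebesgue ?B"
    proof (rule integrable_abs, rule integrable_times_bounded_support[OF f])
      show "(\<lambda>y. L / (s / 2) ^ ?n * indicator (cball x (\<rho> * (2 * s))) y) \<in> borel_measurable lebesgue"
        by (intro borel_measurable_times borel_measurable_const borel_measurable_indicator) simp
      show "\<bar>L / (s / 2) ^ ?n * indicator (cball x (\<rho> * (2 * s))) y\<bar> \<le> L / (s / 2) ^ ?n" for y
        using L s by (auto simp: indicator_def)
      show "y \<in> cball x (\<rho> * (2 * s))"
        if "L / (s / 2) ^ ?n * indicator (cball x (\<rho> * (2 * s))) y \<noteq> 0" for y
        using that by (auto simp: indicator_def split: if_splits)
    qed
    have "dilation_derivative \<kappa> x s = (\<lambda>y. - (\<Sum>i\<in>UNIV. frechet_derivative (moment_kernel \<kappa> x s i) (at y) (axis i 1)))"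
      using sum_frechet_derivative_moment_kernel[OF \<kappa> s] by simp
    moreover have "(\<lambda>y. frechet_derivative (moment_kernel \<kappa> x s i) (at y) (axis i 1)) \<in> borel_measurable lebesgue" for i
      by (intro continuous_lebesgue_measurable test_function_continuous test_function_derivative
          test_function_moment_kernel \<kappa> s)
    ultimately show "(\<lambda>y. f y * dilation_derivative \<kappa> x s y) \<in> borel_measurable lebesgue"
      using locally_integrable_measurable[OF f]
      by (simp only:) (intro borel_measurable_times borel_measurable_uminus borel_measurable_sum)
  qed (use s in auto)
qed

lemma dilated_average_derivative_eq:
  fixes f :: "real ^ 'n \<Rightarrow> real"
  assumes \<kappa>: "test_function \<kappa>" and G: "weak_gradient f G" and s: "0 < s"
  shows "(\<integral>y. f y * dilation_derivative \<kappa> x s y \<partial>lebesgue)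
    = (\<Sum>i\<in>UNIV. \<integral>y. G y $ i * moment_kernel \<kappa> x s i y \<partial>lebesgue)"
proof -
  have f: "locally_integrable f" using G by (simp add: weak_gradient_def)
  note t = test_function_moment_kernel[OF \<kappa> s]
  have "(\<integral>y. f y * dilation_derivative \<kappa> x s y \<partial>lebesgue)
    = (\<integral>y. (\<Sum>i\<in>UNIV. - (f y * frechet_derivative (moment_kernel \<kappa> x s i) (at y) (axis i 1))) \<partial>lebesgue)"
    using sum_frechet_derivative_moment_kernel[OF \<kappa> s, of x]
    by (simp add: sum_negf flip: sum_distrib_left)
  also have "\<dots> = (\<Sum>i\<in>UNIV. \<integral>y. - (f y * frechet_derivative (moment_kernel \<kappa> x s i) (at y) (axis i 1)) \<partial>lebesgue)"
    by (intro Bochner_Integration.integral_sum integrable_minus integrable_times_test_function f test_function_derivative t)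
  also have "\<dots> = (\<Sum>i\<in>UNIV. \<integral>y. G y $ i * moment_kernel \<kappa> x s i y \<partial>lebesgue)"
    using G t unfolding weak_gradient_def by (intro sum.cong refl) simp
  finally show ?thesis .
qed

lemma ennreal_divide_mult_cancel: "0 < m \<Longrightarrow> x / ennreal m * ennreal m = x"
  by (simp add: ennreal_divide_times divide_ennreal)

lemma ennreal_mult3: "0 \<le> a \<Longrightarrow> 0 \<le> b \<Longrightarrow> ennreal a * (ennreal b * ennreal c) = ennreal (a * (b * c))"
  by (simp add: ennreal_mult')

abbreviation gradient_maximal :: "(real ^ 'n \<Rightarrow> real ^ 'n) \<Rightarrow> real ^ 'n \<Rightarrow> ennreal" where
  "gradient_maximal G \<equiv> maximal_function lebesgue (\<lambda>y. ennreal (norm (G y)))"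

text \<open>
  The moment kernels have size \<open>\<rho> / s ^ n\<close> and live on a ball of radius \<open>\<rho> s\<close>, so the powers of \<open>s\<close> cancel and an average
  of \<open>\<bar>G\<bar>\<close> over that ball remains.
\<close>
lemma dilated_average_derivative_bound:
  fixes f :: "real ^ 'n \<Rightarrow> real"
  assumes \<kappa>: "test_function \<kappa>" and G: "weak_gradient f G" and s: "0 < s" and \<rho>: "0 < \<rho>"
    and \<kappa>1: "\<And>u. \<bar>\<kappa> u\<bar> \<le> 1" and \<kappa>\<rho>: "\<And>u. \<kappa> u \<noteq> 0 \<Longrightarrow> norm u < \<rho>"
    and M: "gradient_maximal G x < \<infinity>"
  shows "\<bar>\<integral>y. f y * dilation_derivative \<kappa> x s y \<partial>lebesgue\<bar>
    \<le> real CARD('n) * \<rho> * (unit_ball_vol (real CARD('n)) * \<rho> ^ CARD('n)) *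
       enn2real (gradient_maximal G x)"
proof -
  let ?M = "gradient_maximal G x"
  let ?n = "CARD('n)" and ?v = "unit_ball_vol (real CARD('n))"
  let ?B = "ball x (\<rho> * s)"
  have Gl: "locally_integrable G" using G by (simp add: weak_gradient_def)
  note [measurable] = locally_integrable_measurable[OF Gl]
  have mom: "\<bar>moment_kernel \<kappa> x s i y\<bar> \<le> \<rho> / s ^ ?n * indicator ?B y" for i y
  proof (cases "\<kappa> ((1 / s) *\<^sub>R (y - x)) = 0")
    case True
    thus ?thesis using \<rho> s by (simp add: moment_kernel_def dilated_kernel_def)
  next
    case False
    let ?u = "(1 / s) *\<^sub>R (y - x)"
    have u: "norm ?u < \<rho>" by (rule \<kappa>\<rho>[OF False])
    hence y: "y \<in> ?B" using s by (simp add: dist_norm norm_minus_commute pos_divide_less_eq)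
    have "\<bar>\<kappa> ?u\<bar> * \<bar>?u $ i\<bar> \<le> 1 * \<rho>"
      using \<kappa>1[of ?u] component_le_norm_cart[of ?u i] u by (intro mult_mono) auto
    hence "\<bar>\<kappa> ?u\<bar> * \<bar>?u $ i\<bar> / s ^ ?n \<le> \<rho> / s ^ ?n" using s by (intro divide_right_mono) auto
    thus ?thesis using y s unfolding moment_kernel_def dilated_kernel_def by (simp add: abs_mult mult.commute)
  qed
  have "\<bar>\<integral>y. G y $ i * moment_kernel \<kappa> x s i y \<partial>lebesgue\<bar> \<le> \<rho> * (?v * \<rho> ^ ?n) * enn2real ?M" for i
  proof -
    have "integrable lebesgue (\<lambda>y. G y $ i * moment_kernel \<kappa> x s i y)"
      by (intro integrable_times_test_function locally_integrable_component Gl test_function_moment_kernel \<kappa> s)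
    hence "ennreal (norm (\<integral>y. G y $ i * moment_kernel \<kappa> x s i y \<partial>lebesgue))
       \<le> (\<integral>\<^sup>+y. norm (G y $ i * moment_kernel \<kappa> x s i y) \<partial>lebesgue)"
      by (rule integral_norm_bound_ennreal)
    also have "\<dots> \<le> (\<integral>\<^sup>+y. ennreal (\<rho> / s ^ ?n) * (ennreal (norm (G y)) * indicator ?B y) \<partial>lebesgue)"
    proof (rule nn_integral_mono)
      fix y
      have "\<bar>G y $ i\<bar> * \<bar>moment_kernel \<kappa> x s i y\<bar> \<le> norm (G y) * (\<rho> / s ^ ?n * indicator ?B y)"
        by (intro mult_mono mom component_le_norm_cart) auto
      hence "ennreal (norm (G y $ i * moment_kernel \<kappa> x s i y)) \<le> ennreal (norm (G y) * (\<rho> / s ^ ?n * indicator ?B y))"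
        by (intro ennreal_leI) (simp add: abs_mult)
      also have "\<dots> = ennreal (\<rho> / s ^ ?n) * (ennreal (norm (G y)) * indicator ?B y)"
        using \<rho> s by (simp add: indicator_def mult.commute flip: ennreal_mult)
      finally show "ennreal (norm (G y $ i * moment_kernel \<kappa> x s i y))
         \<le> ennreal (\<rho> / s ^ ?n) * (ennreal (norm (G y)) * indicator ?B y)" .
    qed
    also have "\<dots> = ennreal (\<rho> / s ^ ?n) * (\<integral>\<^sup>+y\<in>?B. ennreal (norm (G y)) \<partial>lebesgue)"
      by (rule nn_integral_cmult) measurable
    also have "(\<integral>\<^sup>+y\<in>?B. ennreal (norm (G y)) \<partial>lebesgue) \<le> ennreal (?v * (\<rho> * s) ^ ?n) * ?M"
    proof -
      have e: "emeasure lebesgue ?B = ennreal (?v * (\<rho> * s) ^ ?n)"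
        using \<rho> s by (simp add: emeasure_ball)
      have p: "0 < ?v * (\<rho> * s) ^ ?n" using \<rho> s by simp
      have "(\<integral>\<^sup>+y\<in>?B. ennreal (norm (G y)) \<partial>lebesgue) / ennreal (?v * (\<rho> * s) ^ ?n) \<le> ?M"
        using average_le_maximal_function[where x=x and a=x and r="\<rho> * s" and f="\<lambda>y. ennreal (norm (G y))" and \<mu>=lebesgue] \<rho> s e by simp
      hence "(\<integral>\<^sup>+y\<in>?B. ennreal (norm (G y)) \<partial>lebesgue) / ennreal (?v * (\<rho> * s) ^ ?n) * ennreal (?v * (\<rho> * s) ^ ?n)
        \<le> ?M * ennreal (?v * (\<rho> * s) ^ ?n)" by (rule mult_right_mono) simp
      moreover have "(\<integral>\<^sup>+y\<in>?B. ennreal (norm (G y)) \<partial>lebesgue) / ennreal (?v * (\<rho> * s) ^ ?n) * ennreal (?v * (\<rho> * s) ^ ?n)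
         = (\<integral>\<^sup>+y\<in>?B. ennreal (norm (G y)) \<partial>lebesgue)"
        by (rule ennreal_divide_mult_cancel[OF p])
      ultimately show ?thesis by (simp add: mult.commute)
    qed
    finally have "ennreal \<bar>\<integral>y. G y $ i * moment_kernel \<kappa> x s i y \<partial>lebesgue\<bar>
       \<le> ennreal (\<rho> / s ^ ?n) * (ennreal (?v * (\<rho> * s) ^ ?n) * ennreal (enn2real ?M))"
      using M by (simp add: mult_left_mono)
    also have "\<dots> = ennreal (\<rho> / s ^ ?n * (?v * (\<rho> * s) ^ ?n * enn2real ?M))"
      using \<rho> s by (intro ennreal_mult3) auto
    also have "\<rho> / s ^ ?n * (?v * (\<rho> * s) ^ ?n * enn2real ?M) = \<rho> * (?v * \<rho> ^ ?n) * enn2real ?M"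
      using s by (simp add: power_mult_distrib)
    finally show ?thesis using \<rho> by (subst (asm) ennreal_le_iff) auto
  qed
  hence "(\<Sum>i\<in>UNIV. \<bar>\<integral>y. G y $ i * moment_kernel \<kappa> x s i y \<partial>lebesgue\<bar>) \<le> (\<Sum>i\<in>(UNIV::'n set). \<rho> * (?v * \<rho> ^ ?n) * enn2real ?M)"
    by (intro sum_mono)
  also have "\<dots> = real CARD('n) * \<rho> * (?v * \<rho> ^ ?n) * enn2real ?M" by simp
  finally show ?thesis
    unfolding dilated_average_derivative_eq[OF \<kappa> G s] by (rule order_trans[OF sum_abs])
qed


lemma dilated_average_lipschitz:
  fixes f :: "real ^ 'n \<Rightarrow> real"
  assumes \<kappa>: "test_function \<kappa>" and G: "weak_gradient f G" and \<epsilon>: "0 < \<epsilon>" "\<epsilon> \<le> R" and \<rho>: "0 < \<rho>"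
    and \<kappa>1: "\<And>u. \<bar>\<kappa> u\<bar> \<le> 1" and \<kappa>\<rho>: "\<And>u. \<kappa> u \<noteq> 0 \<Longrightarrow> norm u < \<rho>"
    and M: "gradient_maximal G x < \<infinity>"
  shows "\<bar>dilated_average f \<kappa> x R - (dilated_average f \<kappa> x \<epsilon>)\<bar>
    \<le> real CARD('n) * \<rho> * (unit_ball_vol (real CARD('n)) * \<rho> ^ CARD('n)) *
       enn2real (gradient_maximal G x) * R"
proof -
  let ?C = "real CARD('n) * \<rho> * (unit_ball_vol (real CARD('n)) * \<rho> ^ CARD('n)) *
       enn2real (gradient_maximal G x)"
  have f: "locally_integrable f" using G by (simp add: weak_gradient_def)
  have "norm (dilated_average f \<kappa> x R - (dilated_average f \<kappa> x \<epsilon>))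
     \<le> ?C * norm (R - \<epsilon>)"
  proof (rule field_differentiable_bound[where S="{0<..}"])
    fix s :: real assume "s \<in> {0<..}"
    thus "((\<lambda>s. dilated_average f \<kappa> x s) has_field_derivative
         (\<integral>y. f y * dilation_derivative \<kappa> x s y \<partial>lebesgue)) (at s within {0<..})"
      by (intro has_field_derivative_at_within[OF dilated_average_has_derivative[OF \<kappa> f]]) simp
    show "norm (\<integral>y. f y * dilation_derivative \<kappa> x s y \<partial>lebesgue) \<le> ?C"
      using dilated_average_derivative_bound[OF \<kappa> G _ \<rho> \<kappa>1 \<kappa>\<rho> M] \<open>s \<in> {0<..}\<close> by simp
  qed (use \<epsilon> in auto)
  also have "\<dots> \<le> ?C * R" using \<epsilon> \<rho> by (intro mult_left_mono) auto
  finally show ?thesis by simp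
qed

lemma integral_dilated_kernel:
  fixes \<kappa> :: "real ^ 'n \<Rightarrow> real"
  assumes \<kappa>: "continuous_on UNIV \<kappa>" and s: "0 < s"
  shows "(\<integral>y. dilated_kernel \<kappa> x s y \<partial>lebesgue) = (\<integral>y. \<kappa> y \<partial>lebesgue)"
proof -
  have m[measurable]: "\<kappa> \<in> borel_measurable borel" using \<kappa> by (rule borel_measurable_continuous_onI)
  have k[measurable]: "dilated_kernel \<kappa> x s \<in> borel_measurable borel"
    unfolding dilated_kernel_def[abs_def] by measurable
  have "(\<integral>y. dilated_kernel \<kappa> x s y \<partial>lebesgue) = (\<integral>y. dilated_kernel \<kappa> x s y \<partial>lborel)"
    by (rule integral_completion) simp
  also have "\<dots> = (\<integral>y. dilated_kernel \<kappa> x s y \<partial>density (distr lborel borel (\<lambda>u. x + s *\<^sub>R u)) (\<lambda>_. \<bar>s\<bar> ^ CARD('n)))"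
    using lborel_affine[of s x] s by simp
  also have "\<dots> = (\<integral>u. \<bar>s\<bar> ^ CARD('n) *\<^sub>R dilated_kernel \<kappa> x s (x + s *\<^sub>R u) \<partial>lborel)"
    using s by (subst integral_density) (auto simp: integral_distr)
  also have "\<dots> = (\<integral>u. \<kappa> u \<partial>lborel)"
    using s by (simp add: dilated_kernel_def)
  also have "\<dots> = (\<integral>u. \<kappa> u \<partial>lebesgue)" by (rule integral_completion[symmetric]) simp
  finally show ?thesis .
qed

lemma locally_integrable_absolutely_integrable:
  fixes f :: "real ^ 'n \<Rightarrow> real"
  shows "locally_integrable f \<Longrightarrow> f absolutely_integrable_on cbox a b"
  by (auto simp: locally_integrable_def)

text \<open>
  At a Lebesgue point the averages against a bounded kernel supported in the unit cube are controlled by the cubes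
  with corner \<open>x\<close>.
\<close>
lemma dilated_average_tendsto:
  fixes f :: "real ^ 'n \<Rightarrow> real"
  assumes \<kappa>: "test_function \<kappa>" and f: "locally_integrable f"
    and \<kappa>1: "\<And>u. \<bar>\<kappa> u\<bar> \<le> 1" and \<kappa>Q: "\<And>u. \<kappa> u \<noteq> 0 \<Longrightarrow> u \<in> cbox 0 One"
    and x: "((\<lambda>h. integral (cbox x (x + h *\<^sub>R One)) (\<lambda>y. \<bar>f y - f x\<bar>) / h ^ CARD('n)) \<longlongrightarrow> 0) (at_right 0)"
  shows "((\<lambda>s. dilated_average f \<kappa> x s) \<longlongrightarrow> f x * (\<integral>y. \<kappa> y \<partial>lebesgue)) (at_right 0)"
proof -
  have "((\<lambda>s. dilated_average f \<kappa> x s - f x * (\<integral>y. \<kappa> y \<partial>lebesgue)) \<longlongrightarrow> 0) (at_right 0)"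
  proof (rule Lim_null_comparison[OF _ x])
    have "norm (dilated_average f \<kappa> x s - f x * (\<integral>y. \<kappa> y \<partial>lebesgue))
       \<le> integral (cbox x (x + s *\<^sub>R One)) (\<lambda>y. \<bar>f y - f x\<bar>) / s ^ CARD('n)" if s: "0 < s" for s
    proof -
      let ?k = "dilated_kernel \<kappa> x s"
      let ?Q = "cbox x (x + s *\<^sub>R One)"
      have tk: "test_function ?k" by (rule test_function_dilated_kernel[OF \<kappa> s])
      have i1: "integrable lebesgue (\<lambda>y. f y * ?k y)" by (rule integrable_times_test_function[OF f tk])
      have i2: "integrable lebesgue ?k" using integrable_times_test_function[OF locally_integrable_1 tk] by simp
      have ab: "(\<lambda>y. f y - f x) absolutely_integrable_on ?Q"
        by (intro set_integral_diff locally_integrable_absolutely_integrable f absolutely_integrable_continuous continuous_intros)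
      have ab': "integrable lebesgue (\<lambda>y. indicat_real ?Q y * \<bar>f y - f x\<bar>)"
        using set_integrable_abs[OF ab] unfolding set_integrable_def by simp
      have "(\<integral>y. f y * ?k y \<partial>lebesgue) - f x * (\<integral>y. \<kappa> y \<partial>lebesgue)
          = (\<integral>y. f y * ?k y \<partial>lebesgue) - (\<integral>y. f x * ?k y \<partial>lebesgue)"
        using integral_dilated_kernel[OF test_function_continuous[OF \<kappa>] s, of x] by simp
      also have "\<dots> = (\<integral>y. f y * ?k y - f x * ?k y \<partial>lebesgue)"
        by (rule Bochner_Integration.integral_diff[symmetric]) (use i1 i2 in auto)
      finally have "norm ((\<integral>y. f y * ?k y \<partial>lebesgue) - f x * (\<integral>y. \<kappa> y \<partial>lebesgue))
          \<le> (\<integral>y. norm (f y * ?k y - f x * ?k y) \<partial>lebesgue)"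
        by (simp only: integral_norm_bound)
      also have "\<dots> \<le> (\<integral>y. indicat_real ?Q y * \<bar>f y - f x\<bar> / s ^ CARD('n) \<partial>lebesgue)"
      proof (rule integral_mono)
        show "integrable lebesgue (\<lambda>y. norm (f y * ?k y - f x * ?k y))"
          by (intro integrable_norm Bochner_Integration.integrable_diff i1 integrable_mult_right i2)
        show "integrable lebesgue (\<lambda>y. indicat_real ?Q y * \<bar>f y - f x\<bar> / s ^ CARD('n))"
          by (intro integrable_divide ab')
        fix y
        let ?u = "(1 / s) *\<^sub>R (y - x)"
        show "norm (f y * ?k y - f x * ?k y) \<le> indicat_real ?Q y * \<bar>f y - f x\<bar> / s ^ CARD('n)"
        proof (cases "\<kappa> ?u = 0")
          case True
          thus ?thesis using s by (simp add: dilated_kernel_def)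
        next
          case False
          hence u: "?u \<in> cbox 0 One" by (rule \<kappa>Q)
          have "y \<in> ?Q"
            unfolding mem_box
          proof safe
            fix b :: "real ^ 'n" assume b: "b \<in> Basis"
            have "0 \<le> ?u \<bullet> b" "?u \<bullet> b \<le> 1" using u b by (auto simp: mem_box)
            thus "x \<bullet> b \<le> y \<bullet> b" "y \<bullet> b \<le> (x + s *\<^sub>R One) \<bullet> b"
              using s b by (auto simp: inner_simps field_simps)
          qed
          moreover have "\<bar>f y - f x\<bar> * \<bar>\<kappa> ?u\<bar> \<le> \<bar>f y - f x\<bar> * 1" by (intro mult_left_mono \<kappa>1) simp
          hence "\<bar>f y - f x\<bar> * \<bar>\<kappa> ?u\<bar> / s ^ CARD('n) \<le> \<bar>f y - f x\<bar> / s ^ CARD('n)"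
            using s by (intro divide_right_mono) auto
          moreover have "norm (f y * ?k y - f x * ?k y) = \<bar>f y - f x\<bar> * \<bar>\<kappa> ?u\<bar> / s ^ CARD('n)"
            using s unfolding dilated_kernel_def by (simp add: abs_mult abs_div flip: left_diff_distrib diff_divide_distrib)
          ultimately show ?thesis by simp
        qed
      qed
      also have "\<dots> = (\<integral>y. indicat_real ?Q y * \<bar>f y - f x\<bar> \<partial>lebesgue) / s ^ CARD('n)" by simp
      also have "(\<integral>y. indicat_real ?Q y * \<bar>f y - f x\<bar> \<partial>lebesgue) = integral ?Q (\<lambda>y. \<bar>f y - f x\<bar>)"
        using set_lebesgue_integral_eq_integral(2)[OF set_integrable_abs[OF ab]]
        unfolding set_lebesgue_integral_def by simp
      finally show ?thesis .
    qed
    thus "eventually (\<lambda>s. norm (dilated_average f \<kappa> x s - f x * (\<integral>y. \<kappa> y \<partial>lebesgue))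
       \<le> integral (cbox x (x + s *\<^sub>R One)) (\<lambda>y. \<bar>f y - f x\<bar>) / s ^ CARD('n)) (at_right 0)"
      by (auto simp: eventually_at_right_field intro!: exI[of _ 1])
  qed
  thus ?thesis by (simp add: LIM_zero_iff)
qed

lemma bump_le_1: "bump u \<le> 1"
  by (simp add: bump_def flat_exp_def)

lemma bump_integral_pos: "0 < (\<integral>u. bump (u :: real ^ 'n) \<partial>lebesgue)"
proof -
  let ?c = "\<chi> i. 1 / 2 :: real ^ 'n"
  have i: "integrable lebesgue (bump :: real ^ 'n \<Rightarrow> real)"
    using integrable_times_test_function[OF locally_integrable_1 test_function_bump] by simp
  have "(\<integral>u. bump (u :: real ^ 'n) \<partial>lebesgue) \<noteq> 0"
  proof
    assume "(\<integral>u. bump (u :: real ^ 'n) \<partial>lebesgue) = 0"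
    hence "AE u in lebesgue. bump (u :: real ^ 'n) = 0"
      using integral_nonneg_eq_0_iff_AE[OF i] bump_nonneg by auto
    hence "AE u in lebesgue. u \<notin> ball ?c (1 / 4)"
      by eventually_elim (use bump_nonzero_iff in \<open>auto simp: dist_norm norm_minus_commute\<close>)
    hence "emeasure lebesgue (ball ?c (1 / 4)) = 0"
      by (subst (asm) AE_iff_measurable[where N="ball ?c (1 / 4)"]) auto
    thus False using unit_ball_vol_pos[of "real CARD('n)"] by (simp add: emeasure_ball)
  qed
  moreover have "0 \<le> (\<integral>u. bump (u :: real ^ 'n) \<partial>lebesgue)"
    by (intro integral_nonneg_AE AE_I2 bump_nonneg)
  ultimately show ?thesis by simp
qed

lemma shifted_bump_support:
  fixes v :: "real ^ 'n"
  assumes "bump (u - v) \<noteq> 0" "norm v \<le> 1 / 4"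
  shows "u \<in> cbox 0 One" "norm u < real CARD('n) + 1"
proof -
  have "0 \<le> u $ i \<and> u $ i \<le> 1" for i
  proof -
    have "\<bar>(u - v - (\<chi> i. 1 / 2)) $ i\<bar> < 1 / 4"
      using assms(1) component_le_norm_cart[of "u - v - (\<chi> i. 1 / 2)" i] unfolding bump_nonzero_iff by linarith
    moreover have "\<bar>v $ i\<bar> \<le> 1 / 4" using assms(2) component_le_norm_cart[of v i] by linarith
    ultimately have "- (u $ i - v $ i - 1 / 2) < 1 / 4" "u $ i - v $ i - 1 / 2 < 1 / 4"
      "v $ i \<le> 1 / 4" "- (v $ i) \<le> 1 / 4" unfolding abs_less_iff abs_le_iff by auto
    thus ?thesis by (intro conjI; linarith)
  qed
  note comp = this
  show "u \<in> cbox 0 One"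
    unfolding mem_box
  proof (intro ballI)
    fix b :: "real ^ 'n" assume b: "b \<in> Basis"
    then obtain i where "b = axis i 1" by (auto simp: Basis_vec_def)
    hence "u \<bullet> b = u $ i" by (simp add: inner_axis)
    thus "0 \<bullet> b \<le> u \<bullet> b \<and> u \<bullet> b \<le> One \<bullet> b" using comp[of i] b by simp
  qed
  have "norm u \<le> (\<Sum>i\<in>UNIV. \<bar>u $ i\<bar>)" by (rule norm_le_l1_cart)
  also have "\<dots> \<le> (\<Sum>i\<in>(UNIV :: 'n set). 1)"
    using comp by (intro sum_mono) auto
  finally show "norm u < real CARD('n) + 1" by simp
qed

text \<open>
  The scale \<open>R\<close> is four times the distance of the points.  Then the shift \<open>v\<close> that makes the average about \<open>x\<close>
  equal to the one about \<open>z\<close> has length \<open>1 / 4\<close>, which the bump tolerates.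
\<close>
theorem weak_gradient_imp_pointwise_inequality:
  fixes f :: "real ^ 'n \<Rightarrow> real"
  assumes G: "weak_gradient f G"
  obtains C N where "0 \<le> C" "N \<in> null_sets lebesgue"
    "\<And>x z. x \<notin> N \<Longrightarrow> z \<notin> N \<Longrightarrow> gradient_maximal G x < \<infinity> \<Longrightarrow>
       gradient_maximal G z < \<infinity> \<Longrightarrow>
       \<bar>f x - f z\<bar> \<le> C * norm (x - z) * (enn2real (gradient_maximal G x) +
         enn2real (gradient_maximal G z))"
proof -
  let ?M = "gradient_maximal G"
  have f: "locally_integrable f" using G by (simp add: weak_gradient_def)
  obtain N where N: "N \<in> null_sets lebesgue"
    "\<And>x. x \<notin> N \<Longrightarrow> ((\<lambda>h. integral (cbox x (x + h *\<^sub>R One)) (\<lambda>y. \<bar>f y - f x\<bar>) / h ^ DIM(real ^ 'n)) \<longlongrightarrow> 0) (at_right 0)"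
    by (rule lebesgue_points[OF locally_integrable_absolutely_integrable[OF f]]) blast
  define c0 where "c0 = (\<integral>u. bump (u :: real ^ 'n) \<partial>lebesgue)"
  have c0: "0 < c0" unfolding c0_def by (rule bump_integral_pos)
  define \<rho> where "\<rho> = real CARD('n) + 1"
  have \<rho>: "0 < \<rho>" by (simp add: \<rho>_def)
  define K where "K = real CARD('n) * \<rho> * (unit_ball_vol (real CARD('n)) * \<rho> ^ CARD('n))"
  have K: "0 \<le> K" using \<rho> by (simp add: K_def)
  have key: "\<bar>dilated_average f (\<lambda>u. bump (u - v)) x R - f x * c0\<bar> \<le> K * enn2real (?M x) * R"
    if x: "x \<notin> N" and M: "?M x < \<infinity>" and v: "norm v \<le> 1 / 4" and R: "0 < R" for x v R
  proof -
    let ?k = "\<lambda>u. bump (u - v)"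
    have tk: "test_function ?k"
      using test_function_affine[OF test_function_bump, of 1 "- v"] by simp
    have k1: "\<bar>?k u\<bar> \<le> 1" for u using bump_nonneg[of "u - v"] bump_le_1[of "u - v"] by simp
    have "dilated_kernel bump v 1 = ?k" by (rule ext) (simp add: dilated_kernel_def)
    hence int: "(\<integral>u. ?k u \<partial>lebesgue) = c0"
      using integral_dilated_kernel[OF test_function_continuous[OF test_function_bump], of 1 v]
      by (simp add: c0_def)
    have lim: "((\<lambda>s. dilated_average f ?k x s) \<longlongrightarrow> f x * c0) (at_right 0)"
      unfolding int[symmetric]
      by (rule dilated_average_tendsto[OF tk f k1]) (use shifted_bump_support(1) v N(2)[OF x] in auto)
    have "((\<lambda>s. \<bar>dilated_average f ?k x R - (dilated_average f ?k x s)\<bar>)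
       \<longlongrightarrow> \<bar>dilated_average f ?k x R - f x * c0\<bar>) (at_right 0)"
      by (intro tendsto_intros lim)
    moreover have "eventually (\<lambda>s. \<bar>dilated_average f ?k x R - (dilated_average f ?k x s)\<bar>
       \<le> K * enn2real (?M x) * R) (at_right 0)"
    proof -
      have "\<bar>dilated_average f ?k x R - (dilated_average f ?k x s)\<bar>
       \<le> K * enn2real (?M x) * R" if "0 < s" "s < R" for s
        unfolding K_def
        by (rule dilated_average_lipschitz[OF tk G _ _ \<rho> k1 _ M])
           (use that shifted_bump_support(2) v in \<open>auto simp: \<rho>_def\<close>)
      thus ?thesis using R by (auto simp: eventually_at_right_field)
    qed
    ultimately show ?thesis
      by (rule tendsto_upperbound) simp
  qed
  show thesis
  proof (rule that[OF _ N(1)])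
    show "0 \<le> 4 * K / c0" using K c0 by simp
    fix x z assume xz: "x \<notin> N" "z \<notin> N" and M: "?M x < \<infinity>" "?M z < \<infinity>"
    show "\<bar>f x - f z\<bar> \<le> 4 * K / c0 * norm (x - z) * (enn2real (?M x) + enn2real (?M z))"
    proof (cases "x = z")
      case False
      define R where "R = 4 * norm (x - z)"
      have R: "0 < R" using False by (simp add: R_def)
      define v where "v = (1 / R) *\<^sub>R (z - x)"
      have v: "norm v \<le> 1 / 4" using False by (simp add: v_def R_def norm_minus_commute)
      \<comment> \<open>Both points see the same kernel at scale \<open>R\<close>.\<close>
      have eq: "dilated_kernel (\<lambda>u. bump (u - v)) x R = dilated_kernel (\<lambda>u. bump (u - 0)) z R"
        by (rule ext) (simp add: dilated_kernel_def v_def flip: scaleR_diff_right)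
      have "\<bar>f x * c0 - f z * c0\<bar> \<le> K * enn2real (?M x) * R + K * enn2real (?M z) * R"
        using key[OF xz(1) M(1) v R] key[OF xz(2) M(2) _ R, of 0] unfolding eq by simp
      also have "\<bar>f x * c0 - f z * c0\<bar> = \<bar>f x - f z\<bar> * c0"
        using c0 by (simp add: abs_mult flip: left_diff_distrib)
      finally show ?thesis using c0 by (simp add: R_def field_simps)
    qed simp
  qed
qed

section \<open>Convergent averages of bounded sequences\<close>

text \<open>
  Midpoints suffice in the Hilbert-space argument below, and induction over their formation transports every
  property that is stable under convex combinations.
\<close>
inductive_set midpoint_closure :: "('a \<Rightarrow> real) set \<Rightarrow> ('a \<Rightarrow> real) set" for D where
  base: "d \<in> D \<Longrightarrow> d \<in> midpoint_closure D"
| midpoint: "u \<in> midpoint_closure D \<Longrightarrow> v \<in> midpoint_closure D \<Longrightarrow> (\<lambda>x. (u x + v x) / 2) \<in> midpoint_closure D"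

lemma midpoint_closure_mono: "D \<subseteq> E \<Longrightarrow> midpoint_closure D \<subseteq> midpoint_closure E"
proof
  fix u assume "D \<subseteq> E" "u \<in> midpoint_closure D"
  from this(2) show "u \<in> midpoint_closure E"
    by induction (use \<open>D \<subseteq> E\<close> in \<open>auto intro: midpoint_closure.intros\<close>)
qed

lemma midpoint_closure_bounded:
  assumes "u \<in> midpoint_closure D" "\<And>d. d \<in> D \<Longrightarrow> d \<in> borel_measurable M"
    "\<And>d x. d \<in> D \<Longrightarrow> \<bar>d x\<bar> \<le> 1"
  shows "u \<in> borel_measurable M \<and> (\<forall>x. \<bar>u x\<bar> \<le> 1)"
  using assms(1)
proof induction
  case (midpoint u v)
  have "\<bar>(u x + v x) / 2\<bar> \<le> 1" for x
  proof -
    have "\<bar>u x\<bar> \<le> 1" "\<bar>v x\<bar> \<le> 1" using midpoint by auto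
    hence "\<bar>u x + v x\<bar> \<le> 2" by linarith
    thus ?thesis by simp
  qed
  thus ?case using midpoint by auto
qed (use assms in auto)

text \<open>
  The infimum \<open>I m\<close> of the squared \<open>L\<^sup>2\<close> norm over the \<open>m\<close>-th tail increases with \<open>m\<close> and is bounded, hence converges.  By the
  parallelogram identity near-minimizers form a Cauchy sequence, since the midpoint of two of them belongs to the
  larger tail and cannot have much smaller norm.  A subsequence then converges almost everywhere.
\<close>
lemma (in finite_measure) convergent_midpoint_sequence:
  fixes d :: "nat \<Rightarrow> 'a \<Rightarrow> real"
  assumes d: "\<And>k. d k \<in> borel_measurable M" "\<And>k x. \<bar>d k x\<bar> \<le> 1"
  obtains v where "\<And>m. v m \<in> midpoint_closure (d ` {m..})" "AE x in M. convergent (\<lambda>m. v m x)"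
proof -
  define K where "K m = midpoint_closure (d ` {m..})" for m
  define J where "J u = (\<integral>x. (u x)\<^sup>2 \<partial>M)" for u :: "'a \<Rightarrow> real"
  define I where "I m = Inf (J ` K m)" for m
  have K_meas: "u \<in> borel_measurable M" and K_le: "\<bar>u x\<bar> \<le> 1" if "u \<in> K m" for u m x
    using midpoint_closure_bounded[of u "d ` {m..}" M] d that by (auto simp: K_def)
  have K_mono: "K l \<subseteq> K m" if "m \<le> l" for m l
    unfolding K_def using that by (intro midpoint_closure_mono) auto
  have d_K: "d m \<in> K m" for m
    unfolding K_def by (intro midpoint_closure.base) auto
  have K_mid: "(\<lambda>x. (u x + v x) / 2) \<in> K m" if "u \<in> K m" "v \<in> K m" for u v m
    using that unfolding K_def by (rule midpoint_closure.midpoint)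
  have int_bounded: "integrable M f" if "f \<in> borel_measurable M" "\<And>x. \<bar>f x\<bar> \<le> B" for f :: "'a \<Rightarrow> real" and B
    using that by (intro integrable_const_bound[where B=B]) auto
  have sq_int: "integrable M (\<lambda>x. (a * u x + b * v x)\<^sup>2)" if "u \<in> K m" "v \<in> K l" for u v m l and a b :: real
  proof (rule int_bounded)
    show "(\<lambda>x. (a * u x + b * v x)\<^sup>2) \<in> borel_measurable M"
      using K_meas[OF that(1)] K_meas[OF that(2)] by measurable
    show "\<bar>(a * u x + b * v x)\<^sup>2\<bar> \<le> (\<bar>a\<bar> + \<bar>b\<bar>)\<^sup>2" for x
    proof -
      have "\<bar>a * u x\<bar> \<le> \<bar>a\<bar>" "\<bar>b * v x\<bar> \<le> \<bar>b\<bar>"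
        using K_le[OF that(1), of x] K_le[OF that(2), of x] by (auto simp: abs_mult mult_left_le)
      hence "\<bar>a * u x + b * v x\<bar> \<le> \<bar>a\<bar> + \<bar>b\<bar>" by linarith
      thus ?thesis by (simp add: abs_le_square_iff[symmetric])
    qed
  qed
  have J_nonneg: "0 \<le> J u" for u unfolding J_def by (intro integral_nonneg_AE) auto
  have bdd: "bdd_below (J ` A)" for A by (intro bdd_belowI[of _ 0]) (auto simp: J_nonneg)
  have I_le: "I m \<le> J u" if "u \<in> K m" for u m
    unfolding I_def using that by (intro cInf_lower bdd) auto
  have I_mono: "I m \<le> I l" if "m \<le> l" for m l
    unfolding I_def using K_mono[OF that] d_K[of l] by (intro cInf_superset_mono bdd image_mono) auto
  have I_bound: "I m \<le> measure M (space M)" for m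
  proof -
    have "J (d m) \<le> (\<integral>x. 1 \<partial>M)" unfolding J_def
    proof (rule integral_mono)
      show "integrable M (\<lambda>x. (d m x)\<^sup>2)" using sq_int[OF d_K d_K, of 1 m 0 m] by simp
      show "(d m x)\<^sup>2 \<le> 1" for x using d(2)[of m x] by (simp add: abs_square_le_1)
    qed simp
    thus ?thesis using I_le[OF d_K[of m]] by simp
  qed
  have "\<exists>u\<in>K m. J u < I m + 1 / (real m + 1)" for m
  proof -
    have "\<exists>y\<in>J ` K m. y < I m + 1 / (real m + 1)"
      unfolding I_def using d_K[of m] by (intro cInf_lessD) auto
    thus ?thesis by auto
  qed
  then obtain v where v: "\<And>m. v m \<in> K m" "\<And>m. J (v m) < I m + 1 / (real m + 1)" by metis
  have v_int: "integrable M (v m)" for m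
    using K_meas[OF v(1)] K_le[OF v(1)] by (rule int_bounded)
  have diff: "(\<integral>x. (v m x - v l x)\<^sup>2 \<partial>M) \<le> 2 * (I l - I m) + 2 / (real m + 1) + 2 / (real l + 1)"
    if "m \<le> l" for m l
  proof -
    have vl: "v l \<in> K m" using v(1)[of l] K_mono[OF that] by auto
    have "I m \<le> J (\<lambda>x. (v m x + v l x) / 2)" by (intro I_le K_mid v vl)
    moreover have "(\<integral>x. (v m x - v l x)\<^sup>2 \<partial>M) = 2 * J (v m) + 2 * J (v l) - 4 * J (\<lambda>x. (v m x + v l x) / 2)"
    proof -
      have i1: "integrable M (\<lambda>x. (v m x)\<^sup>2)" using sq_int[OF v(1)[of m] v(1)[of m], of 1 0] by simp
      have i2: "integrable M (\<lambda>x. (v l x)\<^sup>2)" using sq_int[OF v(1)[of l] v(1)[of l], of 1 0] by simp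
      have i3: "integrable M (\<lambda>x. ((v m x + v l x) / 2)\<^sup>2)"
        using sq_int[OF v(1)[of m] v(1)[of l], of "1/2" "1/2"] by (simp add: add_divide_distrib)
      have "2 * J (v m) + 2 * J (v l) - 4 * J (\<lambda>x. (v m x + v l x) / 2)
         = (\<integral>x. 2 * (v m x)\<^sup>2 + 2 * (v l x)\<^sup>2 - 4 * ((v m x + v l x) / 2)\<^sup>2 \<partial>M)"
        unfolding J_def using i1 i2 i3 by simp
      also have "\<dots> = (\<integral>x. (v m x - v l x)\<^sup>2 \<partial>M)"
        by (intro Bochner_Integration.integral_cong refl) (simp add: power2_eq_square field_simps)
      finally show ?thesis by simp
    qed
    moreover have "2 / (real m + 1) = 2 * (1 / (real m + 1))" "2 / (real l + 1) = 2 * (1 / (real l + 1))" by auto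
    ultimately show ?thesis using v(2)[of m] v(2)[of l] by argo
  qed
  obtain L where L: "I \<longlonglongrightarrow> L" "\<And>m. I m \<le> L"
    using incseq_convergent[of I "measure M (space M)"] I_mono I_bound by (auto simp: incseq_def)
  define \<mu> where "\<mu> = measure M (space M)"
  have \<mu>: "0 \<le> \<mu>" by (simp add: \<mu>_def)
  have cauchy: "\<exists>N. \<forall>i\<ge>N. \<forall>j\<ge>N. (\<integral>x. norm (v i x - v j x) \<partial>M) < e" if e: "0 < e" for e
  proof -
    \<comment> \<open>The \<open>L\<^sup>1\<close> distance is controlled through \<open>\<bar>a\<bar> \<le> (\<delta> + a\<^sup>2 / \<delta>) / 2\<close>.\<close>
    define \<delta> where "\<delta> = e / (\<mu> + 1)"
    have \<delta>: "0 < \<delta>" using e \<mu> by (simp add: \<delta>_def)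
    define \<eta> where "\<eta> = e * \<delta>"
    have \<eta>: "0 < \<eta>" using e \<delta> by (simp add: \<eta>_def)
    have "eventually (\<lambda>m. L - \<eta> / 4 < I m) sequentially"
      using L(1) \<eta> by (intro order_tendstoD) auto
    moreover have "eventually (\<lambda>m. 1 / (real m + 1) < \<eta> / 8) sequentially"
    proof -
      have "(\<lambda>m. 1 / (real m + 1)) \<longlonglongrightarrow> 0" by real_asymp
      thus ?thesis using \<eta> by (intro order_tendstoD) auto
    qed
    ultimately have "eventually (\<lambda>m. L - \<eta> / 4 < I m \<and> 1 / (real m + 1) < \<eta> / 8) sequentially"
      by eventually_elim auto
    then obtain N where N: "\<And>m. m \<ge> N \<Longrightarrow> L - \<eta> / 4 < I m \<and> 1 / (real m + 1) < \<eta> / 8"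
      unfolding eventually_sequentially by auto
    have le: "(\<integral>x. norm (v i x - v j x) \<partial>M) < e" if ij: "N \<le> i" "i \<le> j" for i j
    proof -
      have i_sq: "integrable M (\<lambda>x. (v i x - v j x)\<^sup>2)"
        using sq_int[OF v(1)[of i] v(1)[of j], of 1 "-1"] by simp
      have "(\<integral>x. (v i x - v j x)\<^sup>2 \<partial>M) < \<eta>"
        using diff[OF ij(2)] N[of i] N[of j] L(2)[of j] ij by simp
      hence s: "(\<integral>x. (v i x - v j x)\<^sup>2 \<partial>M) / \<delta> < e"
        using \<delta> by (simp add: \<eta>_def pos_divide_less_eq)
      have "(\<integral>x. norm (v i x - v j x) \<partial>M) \<le> (\<integral>x. (\<delta> + (v i x - v j x)\<^sup>2 / \<delta>) / 2 \<partial>M)"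
      proof (rule integral_mono)
        show "norm (v i x - v j x) \<le> (\<delta> + (v i x - v j x)\<^sup>2 / \<delta>) / 2" for x
        proof -
          have "0 \<le> (\<bar>v i x - v j x\<bar> - \<delta>)\<^sup>2" by simp
          hence "2 * \<delta> * \<bar>v i x - v j x\<bar> \<le> \<delta>\<^sup>2 + (v i x - v j x)\<^sup>2"
            by (simp add: power2_diff algebra_simps)
          thus ?thesis using \<delta> by (simp add: field_simps power2_eq_square)
        qed
      qed (use i_sq v_int in auto)
      also have "\<dots> = (\<delta> * \<mu> + (\<integral>x. (v i x - v j x)\<^sup>2 \<partial>M) / \<delta>) / 2"
        using i_sq by (simp add: \<mu>_def mult.commute)
      also have "\<dots> < e"
      proof -
        have "\<delta> * \<mu> \<le> e" using \<mu> e by (simp add: \<delta>_def field_simps)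
        thus ?thesis using s by simp
      qed
      finally show ?thesis .
    qed
    have "(\<integral>x. norm (v i x - v j x) \<partial>M) < e" if "i \<ge> N" "j \<ge> N" for i j
    proof (cases "i \<le> j")
      case False
      have "norm (v i x - v j x) = norm (v j x - v i x)" for x by (rule norm_minus_commute)
      thus ?thesis using le[of j i] that False by simp
    qed (use le that in auto)
    thus ?thesis by auto
  qed
  obtain r where r: "strict_mono r" "AE x in M. Cauchy (\<lambda>i. v (r i) x)"
    using cauchy_L1_AE_cauchy_subseq[OF v_int cauchy] by auto
  show thesis
  proof (rule that[of "\<lambda>m. v (r m)"])
    show "v (r m) \<in> midpoint_closure (d ` {m..})" for m
      using v(1)[of "r m"] K_mono[OF seq_suble[OF r(1), of m]] by (auto simp: K_def)
    show "AE x in M. convergent (\<lambda>m. v (r m) x)"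
      using r(2) by eventually_elim (simp add: Cauchy_convergent_iff)
  qed
qed

text \<open>
  A positive integrable density makes the measure finite without changing the null sets.
\<close>
lemma (in sigma_finite_measure) convergent_midpoint_sequence_sigma_finite:
  fixes d :: "nat \<Rightarrow> 'a \<Rightarrow> real"
  assumes d: "\<And>k. d k \<in> borel_measurable M" "\<And>k x. \<bar>d k x\<bar> \<le> 1"
  obtains v where "\<And>m. v m \<in> midpoint_closure (d ` {m..})" "AE x in M. convergent (\<lambda>m. v m x)"
proof -
  obtain h where h: "h \<in> borel_measurable M" "integral\<^sup>N M h \<noteq> \<infinity>" "\<And>x. x \<in> space M \<Longrightarrow> 0 < h x"
    using Ex_finite_integrable_function by auto
  have hd: "emeasure (density M h) (space (density M h)) = integral\<^sup>N M h"
    using h(1) by (simp add: emeasure_density cong: nn_integral_cong_simp)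
  interpret D: finite_measure "density M h"
    by (rule finite_measureI) (use h(2) hd in simp)
  obtain v where v: "\<And>m. v m \<in> midpoint_closure (d ` {m..})" "AE x in density M h. convergent (\<lambda>m. v m x)"
    by (rule D.convergent_midpoint_sequence[of d]) (use d in auto)
  have "AE x in M. convergent (\<lambda>m. v m x)"
    using v(2) h(1,3) by (auto simp: AE_density elim!: AE_mp)
  thus thesis using that v(1) by blast
qed

section \<open>The pointwise inequality gives a weak gradient\<close>

lemma doubling_lebesgue: "doubling_measure (lebesgue :: 'a::euclidean_space measure) (6 ^ DIM('a))"
proof
  fix a :: 'a and r :: real
  show "emeasure lebesgue (ball a r) < \<infinity>"
    using emeasure_lborel_ball_finite[of a r] by simp
  assume r: "0 < r"
  show "0 < emeasure lebesgue (ball a r)" using r by (simp add: emeasure_ball)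
  show "emeasure lebesgue (ball a (6 * r)) \<le> ennreal (6 ^ DIM('a)) * emeasure lebesgue (ball a r)"
    using r by (simp add: emeasure_ball power_mult_distrib mult.commute mult.left_commute flip: ennreal_mult)
qed simp

lemma sigma_finite_lebesgue: "sigma_finite_measure lebesgue"
  using doubling_measure.sigma_finite[OF doubling_lebesgue] .

lemma locally_integrable_AE_eq:
  fixes f f' :: "real ^ 'n \<Rightarrow> real"
  assumes f: "locally_integrable f" and f': "f' \<in> borel_measurable lebesgue" "AE x in lebesgue. f x = f' x"
  shows "locally_integrable f'"
  unfolding locally_integrable_def set_integrable_def
proof (intro allI impI)
  fix K :: "(real ^ 'n) set" assume K: "compact K"
  have KS: "K \<in> sets lebesgue" using K compact_imp_closed by (metis borel_closed sets_completionI_sets sets_lborel)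
  have i: "integrable lebesgue (\<lambda>x. indicat_real K x *\<^sub>R f x)"
    using f K by (auto simp: locally_integrable_def set_integrable_def)
  show "integrable lebesgue (\<lambda>x. indicat_real K x *\<^sub>R f' x)"
  proof (rule Bochner_Integration.integrable_cong_AE_imp[OF i])
    show "(\<lambda>x. indicat_real K x *\<^sub>R f' x) \<in> borel_measurable lebesgue"
      using f'(1) KS by (intro borel_measurable_scaleR borel_measurable_indicator)
    show "AE x in lebesgue. indicat_real K x *\<^sub>R f x = indicat_real K x *\<^sub>R f' x"
      using f'(2) by eventually_elim simp
  qed
qed

lemma nn_integral_translate:
  fixes u :: "'a::euclidean_space \<Rightarrow> ennreal"
  assumes [measurable]: "u \<in> borel_measurable borel"
  shows "(\<integral>\<^sup>+x. u (c + x) \<partial>lborel) = (\<integral>\<^sup>+x. u x \<partial>lborel)"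
proof -
  have "(\<integral>\<^sup>+x. u x \<partial>lborel) = (\<integral>\<^sup>+x. u x \<partial>distr lborel borel ((+) c))" by (simp add: lborel_distr_plus)
  also have "\<dots> = (\<integral>\<^sup>+x. u (c + x) \<partial>lborel)" by (subst nn_integral_distr) auto
  finally show ?thesis by simp
qed

lemma integral_translate:
  fixes u :: "'a::euclidean_space \<Rightarrow> real"
  assumes [measurable]: "u \<in> borel_measurable borel"
  shows "(\<integral>x. u (c + x) \<partial>lborel) = (\<integral>x. u x \<partial>lborel)"
proof -
  have "(\<integral>x. u x \<partial>lborel) = (\<integral>x. u x \<partial>distr lborel borel ((+) c))" by (simp add: lborel_distr_plus)
  also have "\<dots> = (\<integral>x. u (c + x) \<partial>lborel)" by (subst integral_distr) auto
  finally show ?thesis by simp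
qed

lemma AE_translate:
  assumes "N \<in> null_sets (lborel :: 'a::euclidean_space measure)"
  shows "AE x in lborel. c + x \<notin> N"
proof -
  have [measurable]: "N \<in> sets borel" using assms by auto
  have "AE x in distr lborel borel ((+) c). x \<notin> N"
    unfolding lborel_distr_plus using assms by (rule AE_not_in)
  thus ?thesis by (subst (asm) AE_distr_iff) auto
qed

lemma nn_integral_bounded_finite:
  fixes f :: "real ^ 'n \<Rightarrow> real"
  assumes f: "locally_integrable f" "f \<in> borel_measurable borel"
  shows "(\<integral>\<^sup>+y\<in>ball a r. ennreal \<bar>f y\<bar> \<partial>lborel) < \<infinity>"
proof -
  have "integrable lebesgue (\<lambda>y. indicat_real (cball a r) y *\<^sub>R f y)"
    using f by (auto simp: locally_integrable_def set_integrable_def)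
  hence "(\<integral>\<^sup>+y. ennreal (norm (indicat_real (cball a r) y *\<^sub>R f y)) \<partial>lebesgue) < \<infinity>"
    unfolding integrable_iff_bounded by simp
  hence *: "(\<integral>\<^sup>+y. ennreal (norm (indicat_real (cball a r) y *\<^sub>R f y)) \<partial>lborel) < \<infinity>"
    using f(2) by (subst (asm) nn_integral_completion)
  have "(\<integral>\<^sup>+y\<in>ball a r. ennreal \<bar>f y\<bar> \<partial>lborel) \<le> (\<integral>\<^sup>+y. ennreal (norm (indicat_real (cball a r) y *\<^sub>R f y)) \<partial>lborel)"
    by (intro nn_integral_mono) (auto simp: indicator_def)
  with * show ?thesis by simp
qed

(* Below, balls have to be measurable as Borel sets: Fubini's theorem and translations are used for lborel. *)
declare ball_sets_lebesgue [measurable del]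

lemma ball_sets_borel [measurable]: "ball a r \<in> sets borel"
  by simp

text \<open>
  The convolution form of the integral of \<open>f\<close> over \<open>ball x h\<close>: the domain of integration does not move with \<open>x\<close>,
  as Fubini's theorem and the measurability in \<open>x\<close> require.
\<close>
definition ball_integral :: "real \<Rightarrow> ('a::euclidean_space \<Rightarrow> real) \<Rightarrow> 'a \<Rightarrow> real" where
  "ball_integral h f x = (\<integral>u. indicat_real (ball 0 h) u * f (x + u) \<partial>lborel)"

lemma nn_integral_ball_shift:
  fixes u :: "'a::euclidean_space \<Rightarrow> ennreal"
  assumes [measurable]: "u \<in> borel_measurable borel"
  shows "(\<integral>\<^sup>+y. indicator (ball 0 h) y * u (x + y) \<partial>lborel) = (\<integral>\<^sup>+y\<in>ball x h. u y \<partial>lborel)"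
proof -
  have "(\<integral>\<^sup>+y\<in>ball x h. u y \<partial>lborel) = (\<integral>\<^sup>+y. u (x + y) * indicator (ball x h) (x + y) \<partial>lborel)"
    by (rule nn_integral_translate[symmetric]) measurable
  also have "\<dots> = (\<integral>\<^sup>+y. indicator (ball 0 h) y * u (x + y) \<partial>lborel)"
    by (intro nn_integral_cong) (simp add: indicator_def dist_norm mult.commute)
  finally show ?thesis by simp
qed

lemma integrable_ball_integrand:
  fixes f :: "real ^ 'n \<Rightarrow> real"
  assumes f: "locally_integrable f" and [measurable]: "f \<in> borel_measurable borel"
  shows "integrable lborel (\<lambda>u. indicat_real (ball 0 h) u * f (x + u))"
proof (rule integrableI_bounded)
  have "(\<integral>\<^sup>+u. ennreal (norm (indicat_real (ball 0 h) u * f (x + u))) \<partial>lborel)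
     = (\<integral>\<^sup>+u. indicator (ball 0 h) u * ennreal \<bar>f (x + u)\<bar> \<partial>lborel)"
    by (intro nn_integral_cong) (auto simp: indicator_def)
  also have "\<dots> = (\<integral>\<^sup>+y\<in>ball x h. ennreal \<bar>f y\<bar> \<partial>lborel)" by (rule nn_integral_ball_shift) measurable
  also have "\<dots> < \<infinity>" by (rule nn_integral_bounded_finite[OF f]) simp
  finally show "(\<integral>\<^sup>+u. ennreal (norm (indicat_real (ball 0 h) u * f (x + u))) \<partial>lborel) < \<infinity>" .
qed measurable

lemma borel_measurable_ball_integral [measurable]:
  assumes [measurable]: "f \<in> borel_measurable borel"
  shows "ball_integral h f \<in> borel_measurable borel"
  unfolding ball_integral_def[abs_def]
  by (rule lborel.borel_measurable_lebesgue_integral) measurable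


text \<open>
  Averaging over the radius \<open>h\<close> of the step is what makes the bound uniform: both terms \<open>g (x + z + u)\<close> and
  \<open>g (x + u)\<close> are integrated over parts of the ball of radius \<open>2 h\<close> about \<open>x\<close>, and so the maximal function at the
  single point \<open>x\<close> controls them.  The factor \<open>2 ^ (n + 1)\<close> is \<open>2\<close> for the two terms times \<open>2 ^ n\<close> for the volume ratio.
\<close>
lemma ball_integral_difference_bound:
  fixes f g :: "real ^ 'n \<Rightarrow> real"
  assumes f: "locally_integrable f" and [measurable]: "f \<in> borel_measurable borel" "g \<in> borel_measurable borel"
    and g: "\<And>x. 0 \<le> g x" and N: "N \<in> null_sets lborel"
    and ineq: "\<And>x y. x \<notin> N \<Longrightarrow> y \<notin> N \<Longrightarrow> \<bar>f x - f y\<bar> \<le> norm (x - y) * (g x + g y)"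
    and h: "0 < h" "norm z = h"
  shows "ennreal \<bar>ball_integral h f (x + z) - ball_integral h f x\<bar> \<le>
    ennreal (2 ^ (CARD('n) + 1) * (h * measure lborel (ball (0 :: real ^ 'n) h))) * maximal_function lebesgue (\<lambda>y. ennreal (g y)) x"
proof -
  let ?n = "CARD('n)" and ?V = "unit_ball_vol (real CARD('n))"
  let ?M = "maximal_function lebesgue (\<lambda>y. ennreal (g y)) x"
  let ?I = "\<lambda>a r. \<integral>\<^sup>+y\<in>ball a r. ennreal (g y) \<partial>lborel"
  have m: "measure lborel (ball (0 :: real ^ 'n) h) = ?V * h ^ ?n" using h by (simp add: content_ball)
  note i1 = integrable_ball_integrand[OF f, of h "x + z"] and i2 = integrable_ball_integrand[OF f, of h x]
  have "ball_integral h f (x + z) - ball_integral h f x =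
     (\<integral>u. indicat_real (ball 0 h) u * f (x + z + u) - indicat_real (ball 0 h) u * f (x + u) \<partial>lborel)"
    unfolding ball_integral_def by (rule Bochner_Integration.integral_diff[symmetric]) (rule i1 i2; simp)+
  also have "ennreal (norm \<dots>) \<le> (\<integral>\<^sup>+u. norm (indicat_real (ball 0 h) u * f (x + z + u) - indicat_real (ball 0 h) u * f (x + u)) \<partial>lborel)"
    by (intro integral_norm_bound_ennreal Bochner_Integration.integrable_diff i1 i2) auto
  also have "\<dots> \<le> (\<integral>\<^sup>+u. ennreal h * (indicator (ball 0 h) u * ennreal (g (x + z + u)) + indicator (ball 0 h) u * ennreal (g (x + u))) \<partial>lborel)"
  proof (rule nn_integral_mono_AE)
    show "AE u in lborel. ennreal (norm (indicat_real (ball 0 h) u * f (x + z + u) - indicat_real (ball 0 h) u * f (x + u)))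
       \<le> ennreal h * (indicator (ball 0 h) u * ennreal (g (x + z + u)) + indicator (ball 0 h) u * ennreal (g (x + u)))"
      using AE_translate[OF N, of "x + z"] AE_translate[OF N, of x]
    proof eventually_elim
      case (elim u)
      have "\<bar>f (x + z + u) - f (x + u)\<bar> \<le> h * (g (x + z + u) + g (x + u))"
        using ineq[OF elim] h by simp
      hence "ennreal \<bar>f (x + z + u) - f (x + u)\<bar> \<le> ennreal (h * (g (x + z + u) + g (x + u)))"
        by (rule ennreal_leI)
      also have "\<dots> = ennreal h * (ennreal (g (x + z + u)) + ennreal (g (x + u)))"
        using h g by (simp add: ennreal_mult)
      finally show ?case by (auto simp: indicator_def)
    qed
  qed
  also have "\<dots> = ennreal h * (?I (x + z) h + ?I x h)"
  proof -
    have "(\<integral>\<^sup>+u. ennreal h * (indicator (ball 0 h) u * ennreal (g (x + z + u)) + indicator (ball 0 h) u * ennreal (g (x + u))) \<partial>lborel)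
      = ennreal h * ((\<integral>\<^sup>+u. indicator (ball 0 h) u * ennreal (g (x + z + u)) \<partial>lborel) + (\<integral>\<^sup>+u. indicator (ball 0 h) u * ennreal (g (x + u)) \<partial>lborel))"
      by (subst nn_integral_cmult, measurable, subst nn_integral_add, measurable)
    thus ?thesis
      using nn_integral_ball_shift[of "\<lambda>y. ennreal (g y)" h "x + z"] nn_integral_ball_shift[of "\<lambda>y. ennreal (g y)" h x] by simp
  qed
  also have "\<dots> \<le> ennreal h * (?I x (2 * h) + ?I x (2 * h))"
  proof (intro mult_left_mono add_mono)
    have "dist x y < 2 * h" if "dist (x + z) y < h" for y
      using that h(2) dist_triangle[of x y "x + z"] by (simp add: dist_norm)
    thus "?I (x + z) h \<le> ?I x (2 * h)" by (intro nn_integral_mono) (auto simp: indicator_def)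
    show "?I x h \<le> ?I x (2 * h)" using h by (intro nn_integral_mono) (auto simp: indicator_def)
  qed simp
  also have "\<dots> = ennreal (2 * h) * ?I x (2 * h)"
  proof -
    have "ennreal (2 * h) = ennreal h + ennreal h" using h by (simp flip: ennreal_plus)
    thus ?thesis by (simp only: distrib_left distrib_right)
  qed
  also have "?I x (2 * h) \<le> ennreal (?V * (2 * h) ^ ?n) * ?M"
  proof -
    have e: "emeasure lebesgue (ball x (2 * h)) = ennreal (?V * (2 * h) ^ ?n)"
      using h by (simp add: emeasure_ball)
    have p: "0 < ?V * (2 * h) ^ ?n" using h by simp
    have "?I x (2 * h) = (\<integral>\<^sup>+y\<in>ball x (2 * h). ennreal (g y) \<partial>lebesgue)"
      by (rule nn_integral_completion[symmetric])
    moreover have "(\<integral>\<^sup>+y\<in>ball x (2 * h). ennreal (g y) \<partial>lebesgue) / ennreal (?V * (2 * h) ^ ?n) \<le> ?M"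
      using average_le_maximal_function[where x=x and a=x and r="2 * h" and f="\<lambda>y. ennreal (g y)" and \<mu>=lebesgue] h e by simp
    ultimately have "?I x (2 * h) / ennreal (?V * (2 * h) ^ ?n) * ennreal (?V * (2 * h) ^ ?n) \<le> ?M * ennreal (?V * (2 * h) ^ ?n)"
      by (intro mult_right_mono) auto
    thus ?thesis unfolding ennreal_divide_mult_cancel[OF p] by (simp add: mult.commute)
  qed
  hence "ennreal (2 * h) * ?I x (2 * h) \<le> ennreal (2 * h) * (ennreal (?V * (2 * h) ^ ?n) * ?M)"
    by (rule mult_left_mono) simp
  also have "\<dots> = ennreal (2 * h * (?V * (2 * h) ^ ?n)) * ?M"
    using h by (subst ennreal_mult') (auto simp: mult.assoc)
  also have "2 * h * (?V * (2 * h) ^ ?n) = 2 ^ (?n + 1) * (h * measure lborel (ball (0 :: real ^ 'n) h))"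
    unfolding m by (simp add: power_mult_distrib)
  finally show ?thesis by simp
qed

lemma ball_integral_Fubini:
  fixes f \<theta> :: "real ^ 'n \<Rightarrow> real"
  assumes f: "locally_integrable f" and [measurable]: "f \<in> borel_measurable borel" "\<theta> \<in> borel_measurable borel"
    and \<theta>K: "\<And>x. \<bar>\<theta> x\<bar> \<le> K" and \<theta>\<rho>: "\<And>x. \<theta> x \<noteq> 0 \<Longrightarrow> norm x < \<rho>" and h: "0 < h"
  shows "(\<integral>x. ball_integral h f x * \<theta> x \<partial>lborel) = (\<integral>u. indicat_real (ball 0 h) u * (\<integral>y. f y * \<theta> (y - u) \<partial>lborel) \<partial>lborel)"
    and "integrable lborel (\<lambda>x. ball_integral h f x * \<theta> x)"
    and "integrable lborel (\<lambda>u. indicat_real (ball 0 h) u * (\<integral>y. f y * \<theta> (y - u) \<partial>lborel))"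
proof -
  let ?F = "\<lambda>x u. indicat_real (ball 0 h) u * f (x + u) * \<theta> x"
  have K: "0 \<le> K" using \<theta>K[of 0] by linarith
  have meas[measurable]: "case_prod ?F \<in> borel_measurable (lborel \<Otimes>\<^sub>M lborel)" by measurable
  have int: "integrable (lborel \<Otimes>\<^sub>M lborel) (case_prod ?F)"
  proof (rule integrableI_bounded[OF meas])
    have "(\<integral>\<^sup>+p. ennreal (norm (case_prod ?F p)) \<partial>(lborel \<Otimes>\<^sub>M lborel))
       = (\<integral>\<^sup>+u. \<integral>\<^sup>+x. ennreal (norm (?F x u)) \<partial>lborel \<partial>lborel)"
      by (subst lborel_pair.nn_integral_snd[symmetric]) auto
    also have "\<dots> \<le> (\<integral>\<^sup>+u. (ennreal K * (\<integral>\<^sup>+y\<in>ball 0 (\<rho> + h). ennreal \<bar>f y\<bar> \<partial>lborel)) * indicator (ball (0 :: real ^ 'n) h) u \<partial>lborel)"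
    proof (rule nn_integral_mono)
      fix u :: "real ^ 'n"
      have "(\<integral>\<^sup>+x. ennreal (norm (?F x u)) \<partial>lborel) \<le>
        (\<integral>\<^sup>+x. ennreal K * indicator (ball 0 h) u * (ennreal \<bar>f (u + x)\<bar> * indicator (ball 0 (\<rho> + h)) (u + x)) \<partial>lborel)"
      proof (rule nn_integral_mono)
        fix x
        show "ennreal (norm (?F x u)) \<le> ennreal K * indicator (ball 0 h) u * (ennreal \<bar>f (u + x)\<bar> * indicator (ball 0 (\<rho> + h)) (u + x))"
        proof (cases "u \<in> ball 0 h \<and> \<theta> x \<noteq> 0")
          case True
          hence "norm (u + x) < \<rho> + h" using \<theta>\<rho>[of x] norm_triangle_ineq[of u x] by simp
          moreover have "\<bar>f (x + u)\<bar> * \<bar>\<theta> x\<bar> \<le> \<bar>f (x + u)\<bar> * K" by (intro mult_left_mono \<theta>K) simp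
          hence "ennreal (\<bar>f (x + u)\<bar> * \<bar>\<theta> x\<bar>) \<le> ennreal K * ennreal \<bar>f (u + x)\<bar>"
            using K by (simp add: add.commute mult.commute ennreal_leI flip: ennreal_mult)
          ultimately show ?thesis using True by (simp add: abs_mult)
        qed (auto simp: indicator_def)
      qed
      also have "\<dots> = ennreal K * indicator (ball 0 h) u * (\<integral>\<^sup>+x. ennreal \<bar>f (u + x)\<bar> * indicator (ball 0 (\<rho> + h)) (u + x) \<partial>lborel)"
        by (rule nn_integral_cmult) measurable
      also have "(\<integral>\<^sup>+x. ennreal \<bar>f (u + x)\<bar> * indicator (ball 0 (\<rho> + h)) (u + x) \<partial>lborel) = (\<integral>\<^sup>+y\<in>ball 0 (\<rho> + h). ennreal \<bar>f y\<bar> \<partial>lborel)"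
        by (rule nn_integral_translate) measurable
      finally show "(\<integral>\<^sup>+x. ennreal (norm (?F x u)) \<partial>lborel) \<le> (ennreal K * (\<integral>\<^sup>+y\<in>ball 0 (\<rho> + h). ennreal \<bar>f y\<bar> \<partial>lborel)) * indicator (ball 0 h) u"
        by (simp add: ac_simps)
    qed
    also have "\<dots> = (ennreal K * (\<integral>\<^sup>+y\<in>ball 0 (\<rho> + h). ennreal \<bar>f y\<bar> \<partial>lborel)) * emeasure lborel (ball (0 :: real ^ 'n) h)"
      by (rule nn_integral_cmult_indicator) simp
    also have "\<dots> < \<infinity>"
      using nn_integral_bounded_finite[OF f, of 0 "\<rho> + h"] emeasure_lborel_ball_finite[of "0 :: real ^ 'n" h]
      by (simp add: ennreal_mult_less_top)
    finally show "(\<integral>\<^sup>+p. ennreal (norm (case_prod ?F p)) \<partial>(lborel \<Otimes>\<^sub>M lborel)) < \<infinity>" .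
  qed
  have in_x: "(\<integral>u. ?F x u \<partial>lborel) = ball_integral h f x * \<theta> x" for x
    unfolding ball_integral_def by simp
  have in_u: "(\<integral>x. ?F x u \<partial>lborel) = indicat_real (ball 0 h) u * (\<integral>y. f y * \<theta> (y - u) \<partial>lborel)" for u
  proof -
    have "(\<integral>x. ?F x u \<partial>lborel) = indicat_real (ball 0 h) u * (\<integral>x. f (u + x) * \<theta> ((u + x) - u) \<partial>lborel)"
      by (simp add: mult.assoc add.commute)
    also have "(\<integral>x. f (u + x) * \<theta> ((u + x) - u) \<partial>lborel) = (\<integral>y. f y * \<theta> (y - u) \<partial>lborel)"
      by (rule integral_translate) measurable
    finally show ?thesis .
  qed
  have "(\<integral>u. (\<integral>x. ?F x u \<partial>lborel) \<partial>lborel) = (\<integral>x. (\<integral>u. ?F x u \<partial>lborel) \<partial>lborel)"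
    by (rule lborel_pair.Fubini_integral[OF int])
  thus "(\<integral>x. ball_integral h f x * \<theta> x \<partial>lborel) = (\<integral>u. indicat_real (ball 0 h) u * (\<integral>y. f y * \<theta> (y - u) \<partial>lborel) \<partial>lborel)"
    unfolding in_x in_u by simp
  show "integrable lborel (\<lambda>x. ball_integral h f x * \<theta> x)"
    using lborel_pair.integrable_fst[OF int] unfolding in_x .
  show "integrable lborel (\<lambda>u. indicat_real (ball 0 h) u * (\<integral>y. f y * \<theta> (y - u) \<partial>lborel))"
    using lborel_pair.integrable_snd[OF int] unfolding in_u .
qed

text \<open>
  By the mean value theorem the quotient is a value of the partial derivative at distance less than \<open>2 h\<close> from
  \<open>y\<close>; uniform continuity then bounds the error also with the extra shift \<open>w\<close> that the averaging over a ball introduces.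
\<close>
lemma difference_quotient_error_bound:
  fixes \<phi> :: "real ^ 'n \<Rightarrow> real"
  assumes \<phi>: "test_function \<phi>"
  obtains \<rho> where "\<And>e. 0 < e \<Longrightarrow> \<exists>\<delta>>0. \<forall>h w y. 0 < h \<longrightarrow> h < \<delta> \<longrightarrow> norm w < h \<longrightarrow>
     \<bar>(\<phi> (y - w - h *\<^sub>R axis i 1) - \<phi> (y - w)) / h + frechet_derivative \<phi> (at y) (axis i 1)\<bar> \<le> e * indicator (ball 0 \<rho>) y"
proof -
  let ?\<psi> = "\<lambda>y. frechet_derivative \<phi> (at y) (axis i 1)"
  have \<psi>: "test_function ?\<psi>" by (rule test_function_derivative[OF \<phi>])
  obtain \<rho>1 where \<rho>1: "0 < \<rho>1" "\<And>x. ?\<psi> x \<noteq> 0 \<Longrightarrow> norm x < \<rho>1" by (rule test_function_support[OF \<psi>]) blast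
  have unif: "uniformly_continuous_on (cball 0 (\<rho>1 + 3)) ?\<psi>"
    using test_function_continuous[OF \<psi>] by (intro compact_uniformly_continuous) (auto intro: continuous_on_subset)
  have "\<exists>\<delta>>0. \<forall>h w y. 0 < h \<longrightarrow> h < \<delta> \<longrightarrow> norm w < h \<longrightarrow>
     \<bar>(\<phi> (y - w - h *\<^sub>R axis i 1) - \<phi> (y - w)) / h + ?\<psi> y\<bar> \<le> e * indicator (ball 0 (\<rho>1 + 2)) y" if e: "0 < e" for e
  proof -
    obtain \<delta> where \<delta>: "0 < \<delta>" "\<And>a b. a \<in> cball 0 (\<rho>1 + 3) \<Longrightarrow> b \<in> cball 0 (\<rho>1 + 3) \<Longrightarrow> dist a b < \<delta> \<Longrightarrow> dist (?\<psi> a) (?\<psi> b) < e"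
      using unif e unfolding uniformly_continuous_on_def by metis
    show ?thesis
    proof (rule exI[of _ "min (1 / 2) (\<delta> / 2)"], intro conjI allI impI)
      show "0 < min (1 / 2) (\<delta> / 2)" using \<delta> by simp
      fix h :: real and w y :: "real ^ 'n"
      assume h: "0 < h" "h < min (1 / 2) (\<delta> / 2)" and w: "norm w < h"
      let ?e = "axis i 1 :: real ^ 'n"
      have "DERIV (\<lambda>t. \<phi> (y - w - t *\<^sub>R ?e)) t :> - ?\<psi> (y - w - t *\<^sub>R ?e)" for t
      proof -
        let ?D = "frechet_derivative \<phi> (at (y - w - t *\<^sub>R ?e))"
        have D: "(\<phi> has_derivative ?D) (at (y - w - t *\<^sub>R ?e))" by (rule test_function_has_derivative[OF \<phi>])
        have "((\<lambda>t. y - w - t *\<^sub>R ?e) has_derivative (\<lambda>s. - s *\<^sub>R ?e)) (at t)"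
          by (auto intro!: derivative_eq_intros)
        from has_derivative_compose[OF this D]
        have "((\<lambda>t. \<phi> (y - w - t *\<^sub>R ?e)) has_derivative (\<lambda>s. ?D (- s *\<^sub>R ?e))) (at t)" .
        moreover have "?D (- s *\<^sub>R ?e) = - ?D ?e * s" for s
          using linear_cmul[OF has_derivative_linear[OF D], of "- s" ?e] by (simp add: mult.commute)
        ultimately show ?thesis unfolding has_field_derivative_def by (simp only:)
      qed
      then obtain t where t: "0 < t" "t < h" "\<phi> (y - w - h *\<^sub>R ?e) - \<phi> (y - w - 0 *\<^sub>R ?e) = (h - 0) * - ?\<psi> (y - w - t *\<^sub>R ?e)"
        using MVT2[of 0 h "\<lambda>t. \<phi> (y - w - t *\<^sub>R ?e)" "\<lambda>t. - ?\<psi> (y - w - t *\<^sub>R ?e)"] h(1) by blast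
      let ?z = "y - w - t *\<^sub>R ?e"
      have q: "(\<phi> (y - w - h *\<^sub>R ?e) - \<phi> (y - w)) / h = - ?\<psi> ?z"
        using t(3) h(1) by (simp add: field_simps)
      have "norm (w + t *\<^sub>R ?e) \<le> norm w + t"
        using norm_triangle_ineq[of w "t *\<^sub>R ?e"] t by simp
      moreover have "dist ?z y = norm (w + t *\<^sub>R ?e)"
        using norm_minus_cancel[of "w + t *\<^sub>R ?e"] by (simp add: dist_norm)
      ultimately have d: "dist ?z y < 2 * h" using w t by linarith
      show "\<bar>(\<phi> (y - w - h *\<^sub>R ?e) - \<phi> (y - w)) / h + ?\<psi> y\<bar> \<le> e * indicator (ball 0 (\<rho>1 + 2)) y"
      proof (cases "norm y < \<rho>1 + 2")
        case True
        have "norm ?z \<le> norm y + dist ?z y" using norm_triangle_sub[of ?z y] by (simp add: dist_norm)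
        hence "dist (?\<psi> ?z) (?\<psi> y) < e"
          using True d h by (intro \<delta>(2)) auto
        thus ?thesis using True unfolding q by (simp add: dist_real_def abs_minus_commute)
      next
        case False
        have "norm y \<le> norm ?z + dist ?z y" using norm_triangle_sub[of y ?z] by (simp only: dist_norm norm_minus_commute[of ?z y])
        hence "\<not> norm ?z < \<rho>1" "\<not> norm y < \<rho>1" using False d h by auto
        hence "?\<psi> ?z = 0" "?\<psi> y = 0" using \<rho>1(2) by blast+
        thus ?thesis using False unfolding q by simp
      qed
    qed
  qed
  thus thesis using that by blast
qed

lemma integrable_translate:
  fixes u :: "'a::euclidean_space \<Rightarrow> real"
  assumes "integrable lborel u"
  shows "integrable lborel (\<lambda>x. u (c + x))"
proof -
  have "integrable (distr lborel borel ((+) c)) u" using assms by (simp add: lborel_distr_plus)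
  thus ?thesis by (subst (asm) integrable_distr_eq) (use assms in auto)
qed

lemma integrable_lborel_times_test_function:
  fixes f g :: "real ^ 'n \<Rightarrow> real"
  assumes f: "locally_integrable f" "f \<in> borel_measurable borel" and g: "test_function g"
  shows "integrable lborel (\<lambda>x. f x * g x)"
proof -
  have [measurable]: "g \<in> borel_measurable borel"
    using test_function_continuous[OF g] by (rule borel_measurable_continuous_onI)
  have "(\<lambda>x. f x * g x) \<in> borel_measurable lborel" using f(2) by simp
  thus ?thesis using integrable_times_test_function[OF f(1) g] by (simp add: integrable_completion)
qed

text \<open>
  Fubini's theorem and translation invariance move both the averaging and the difference quotient from \<open>f\<close> to the test
  function, where they converge uniformly with supports in a fixed ball.
\<close>
lemma difference_quotients_converge_weakly:
  fixes f \<phi> :: "real ^ 'n \<Rightarrow> real" and h :: "nat \<Rightarrow> real"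
  assumes f: "locally_integrable f" and fb[measurable]: "f \<in> borel_measurable borel" and \<phi>: "test_function \<phi>"
    and h: "\<And>k. 0 < h k" "h \<longlonglongrightarrow> 0"
  shows "(\<lambda>k. \<integral>x. (ball_integral (h k) f (x + h k *\<^sub>R axis i 1) - ball_integral (h k) f x) /
       (h k * measure lborel (ball (0 :: real ^ 'n) (h k))) * \<phi> x \<partial>lborel)
    \<longlonglongrightarrow> - (\<integral>x. f x * frechet_derivative \<phi> (at x) (axis i 1) \<partial>lborel)"
proof (rule LIMSEQ_I)
  let ?\<psi> = "\<lambda>y. frechet_derivative \<phi> (at y) (axis i 1)"
  let ?e = "axis i 1 :: real ^ 'n"
  define T where "T = (\<integral>y. f y * ?\<psi> y \<partial>lborel)"
  fix \<epsilon> :: real assume \<epsilon>: "0 < \<epsilon>"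
  obtain \<rho> where \<rho>: "\<And>e. 0 < e \<Longrightarrow> \<exists>\<delta>>0. \<forall>h w y. 0 < h \<longrightarrow> h < \<delta> \<longrightarrow> norm w < h \<longrightarrow>
     \<bar>(\<phi> (y - w - h *\<^sub>R ?e) - \<phi> (y - w)) / h + ?\<psi> y\<bar> \<le> e * indicator (ball 0 \<rho>) y"
    by (rule difference_quotient_error_bound[OF \<phi>, of i]) blast
  have int_f: "integrable lborel (\<lambda>y. indicat_real (ball 0 \<rho>) y * f y)"
    using integrable_ball_integrand[OF f fb, of \<rho> 0] by simp
  have int_af: "integrable lborel (\<lambda>y. indicat_real (ball 0 \<rho>) y * \<bar>f y\<bar>)"
    using integrable_abs[OF int_f] by (simp add: abs_mult)
  define L where "L = (\<integral>y. indicat_real (ball 0 \<rho>) y * \<bar>f y\<bar> \<partial>lborel)"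
  have L: "0 \<le> L" unfolding L_def by (intro integral_nonneg_AE) auto
  define e0 where "e0 = \<epsilon> / (L + 1)"
  have e0: "0 < e0" "e0 * L < \<epsilon>"
    using \<epsilon> L by (auto simp: e0_def field_simps)
  obtain \<delta> where \<delta>: "0 < \<delta>" "\<And>h w y. 0 < h \<Longrightarrow> h < \<delta> \<Longrightarrow> norm w < h \<Longrightarrow>
     \<bar>(\<phi> (y - w - h *\<^sub>R ?e) - \<phi> (y - w)) / h + ?\<psi> y\<bar> \<le> e0 * indicator (ball 0 \<rho>) y"
    using \<rho>[OF e0(1)] by blast
  obtain K \<rho>' where K: "0 \<le> K" "0 < \<rho>'" "\<And>x. \<bar>\<phi> x\<bar> \<le> K" "\<And>x. \<phi> x \<noteq> 0 \<Longrightarrow> norm x < \<rho>'"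
    by (rule test_function_bounded_support[OF \<phi>]) blast
  have [measurable]: "\<phi> \<in> borel_measurable borel"
    using test_function_continuous[OF \<phi>] by (rule borel_measurable_continuous_onI)
  have key: "\<bar>(\<integral>x. (ball_integral h f (x + h *\<^sub>R ?e) - ball_integral h f x) /
       (h * measure lborel (ball (0 :: real ^ 'n) h)) * \<phi> x \<partial>lborel) + T\<bar> < \<epsilon>"
    if h: "0 < h" "h < \<delta>" for h
  proof -
    let ?P = "ball_integral h f"
    let ?\<chi> = "indicat_real (ball (0 :: real ^ 'n) h)"
    define c where "c = measure lborel (ball (0 :: real ^ 'n) h)"
    have c: "0 < c" using h by (simp add: c_def content_ball)
    let ?\<phi>1 = "\<lambda>y. \<phi> (y - h *\<^sub>R ?e)"
    let ?\<theta> = "\<lambda>y. ?\<phi>1 y - \<phi> y"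
    have \<phi>1_supp: "norm x < \<rho>' + h" if "?\<phi>1 x \<noteq> 0" for x
      using K(4)[OF that] norm_triangle_sub[of x "h *\<^sub>R ?e"] h by simp
    have \<theta>_supp: "norm x < \<rho>' + h" if "?\<theta> x \<noteq> 0" for x
    proof (cases "\<phi> x = 0")
      case False
      thus ?thesis using K(4)[of x] h by simp
    qed (use that \<phi>1_supp in auto)
    have \<theta>_bound: "\<bar>?\<theta> x\<bar> \<le> 2 * K" for x using K(3)[of x] K(3)[of "x - h *\<^sub>R ?e"] by linarith
    have i1: "integrable lborel (\<lambda>x. ?P x * ?\<phi>1 x)"
      by (rule ball_integral_Fubini(2)[OF f fb _ K(3) \<phi>1_supp h(1)]) measurable
    have i2: "integrable lborel (\<lambda>x. ?P x * \<phi> x)"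
      by (rule ball_integral_Fubini(2)[OF f fb _ K(3) K(4) h(1)]) measurable
    have i3: "integrable lborel (\<lambda>x. ?P (x + h *\<^sub>R ?e) * \<phi> x)"
      using integrable_translate[OF i1, of "h *\<^sub>R ?e"] by (simp add: add.commute)
    define r where "r u = (\<integral>y. f y * ?\<theta> (y - u) \<partial>lborel)" for u
    have "(\<integral>x. (?P (x + h *\<^sub>R ?e) - ?P x) / (h * c) * \<phi> x \<partial>lborel)
       = (\<integral>x. (1 / (h * c)) * (?P (x + h *\<^sub>R ?e) * \<phi> x - ?P x * \<phi> x) \<partial>lborel)"
      by (intro Bochner_Integration.integral_cong refl) (simp add: diff_divide_distrib left_diff_distrib)
    also have "\<dots> = (1 / (h * c)) * ((\<integral>x. ?P (x + h *\<^sub>R ?e) * \<phi> x \<partial>lborel) - (\<integral>x. ?P x * \<phi> x \<partial>lborel))"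
      using i2 i3 by simp
    also have "(\<integral>x. ?P (x + h *\<^sub>R ?e) * \<phi> x \<partial>lborel) = (\<integral>x. ?P x * ?\<phi>1 x \<partial>lborel)"
      using integral_translate[of "\<lambda>x. ?P x * ?\<phi>1 x" "h *\<^sub>R ?e"] by (simp add: add.commute)
    also have "(\<integral>x. ?P x * ?\<phi>1 x \<partial>lborel) - (\<integral>x. ?P x * \<phi> x \<partial>lborel) = (\<integral>x. ?P x * ?\<theta> x \<partial>lborel)"
      using i1 i2 by (simp add: right_diff_distrib)
    also have "\<dots> = (\<integral>u. ?\<chi> u * r u \<partial>lborel)"
      unfolding r_def by (rule ball_integral_Fubini(1)[OF f fb _ \<theta>_bound \<theta>_supp h(1)]) measurable
    finally have D: "(\<integral>x. (?P (x + h *\<^sub>R ?e) - ?P x) / (h * c) * \<phi> x \<partial>lborel)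
       = (1 / (h * c)) * (\<integral>u. ?\<chi> u * r u \<partial>lborel)" .
    have ir: "integrable lborel (\<lambda>u. ?\<chi> u * r u)"
      unfolding r_def by (rule ball_integral_Fubini(3)[OF f fb _ \<theta>_bound \<theta>_supp h(1)]) measurable
    have ii: "integrable lborel ?\<chi>"
      using emeasure_lborel_ball_finite[of "0 :: real ^ 'n" h] by (simp add: integrable_indicator_iff)
    have ri: "\<bar>r u / h + T\<bar> \<le> e0 * L" if u: "u \<in> ball 0 h" for u
    proof -
      have t1: "integrable lborel (\<lambda>y. f y * \<phi> (y - u - h *\<^sub>R ?e))"
        using integrable_lborel_times_test_function[OF f fb test_function_affine[OF \<phi>, of 1 "- u - h *\<^sub>R ?e"]]
        by (simp add: algebra_simps)
      have t2: "integrable lborel (\<lambda>y. f y * \<phi> (y - u))"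
        using integrable_lborel_times_test_function[OF f fb test_function_affine[OF \<phi>, of 1 "- u"]] by simp
      have t3: "integrable lborel (\<lambda>y. f y * ?\<psi> y)"
        by (intro integrable_lborel_times_test_function f fb test_function_derivative \<phi>)
      let ?q = "\<lambda>y. (\<phi> (y - u - h *\<^sub>R ?e) - \<phi> (y - u)) / h + ?\<psi> y"
      have eq: "f y * ?q y = (f y * \<phi> (y - u - h *\<^sub>R ?e) - f y * \<phi> (y - u)) / h + f y * ?\<psi> y" for y
        by (simp add: field_simps)
      have iq: "integrable lborel (\<lambda>y. f y * ?q y)" unfolding eq using t1 t2 t3 by simp
      have "r u / h + T = (\<integral>y. f y * ?q y \<partial>lborel)"
        unfolding eq r_def T_def using t1 t2 t3 by (simp add: right_diff_distrib)
      also have "\<bar>\<dots>\<bar> \<le> (\<integral>y. \<bar>f y * ?q y\<bar> \<partial>lborel)"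
        using integral_norm_bound[of lborel "\<lambda>y. f y * ?q y"] by simp
      also have "\<dots> \<le> (\<integral>y. e0 * (indicat_real (ball 0 \<rho>) y * \<bar>f y\<bar>) \<partial>lborel)"
      proof (rule integral_mono)
        show "\<bar>f y * ?q y\<bar> \<le> e0 * (indicat_real (ball 0 \<rho>) y * \<bar>f y\<bar>)" for y
        proof -
          have "norm u < h" using u by simp
          hence "\<bar>f y\<bar> * \<bar>?q y\<bar> \<le> \<bar>f y\<bar> * (e0 * indicator (ball 0 \<rho>) y)"
            using h by (intro mult_left_mono \<delta>(2)) auto
          thus ?thesis by (simp add: abs_mult ac_simps)
        qed
      qed (use iq int_af in auto)
      also have "\<dots> = e0 * L" by (simp add: L_def)
      finally show ?thesis .
    qed
    have "(1 / (h * c)) * (\<integral>u. ?\<chi> u * r u \<partial>lborel) + T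
        = (1 / c) * (\<integral>u. ?\<chi> u * (r u / h + T) \<partial>lborel)"
    proof -
      have "(\<integral>u. ?\<chi> u * (r u / h + T) \<partial>lborel)
          = (\<integral>u. ?\<chi> u * r u / h + T * ?\<chi> u \<partial>lborel)"
        by (intro Bochner_Integration.integral_cong refl) (simp add: algebra_simps)
      also have "\<dots> = (\<integral>u. ?\<chi> u * r u \<partial>lborel) / h + T * c"
        using ir ii by (simp add: c_def)
      finally show ?thesis using c h by (simp add: field_simps)
    qed
    also have "\<bar>(1 / c) * (\<integral>u. ?\<chi> u * (r u / h + T) \<partial>lborel)\<bar> \<le> e0 * L"
    proof -
      have eq: "?\<chi> u * (r u / h + T) = ?\<chi> u * r u / h + T * ?\<chi> u" for u
        by (simp add: algebra_simps)
      have iT: "integrable lborel (\<lambda>u. ?\<chi> u * (r u / h + T))"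
        unfolding eq using ir ii by simp
      have "\<bar>\<integral>u. ?\<chi> u * (r u / h + T) \<partial>lborel\<bar> \<le> (\<integral>u. \<bar>?\<chi> u * (r u / h + T)\<bar> \<partial>lborel)"
        using integral_norm_bound[of lborel "\<lambda>u. ?\<chi> u * (r u / h + T)"] by simp
      also have "\<dots> \<le> (\<integral>u. e0 * L * ?\<chi> u \<partial>lborel)"
      proof (rule integral_mono)
        show "integrable lborel (\<lambda>u. \<bar>?\<chi> u * (r u / h + T)\<bar>)" by (rule integrable_abs[OF iT])
        show "integrable lborel (\<lambda>u. e0 * L * ?\<chi> u)" by (rule integrable_mult_right[OF ii])
        show "\<bar>?\<chi> u * (r u / h + T)\<bar> \<le> e0 * L * ?\<chi> u" for u
          using ri[of u] by (simp add: indicator_def)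
      qed
      also have "\<dots> = e0 * L * c" by (simp add: c_def)
      finally show ?thesis using c by (simp add: abs_mult field_simps)
    qed
    finally show ?thesis using D e0(2) unfolding c_def by linarith
  qed
  obtain k0 where k0: "\<And>k. k \<ge> k0 \<Longrightarrow> h k < \<delta>"
    using order_tendstoD(2)[OF h(2) \<delta>(1)] unfolding eventually_sequentially by blast
  show "\<exists>no. \<forall>k\<ge>no. norm ((\<integral>x. (ball_integral (h k) f (x + h k *\<^sub>R ?e) - ball_integral (h k) f x) /
       (h k * measure lborel (ball (0 :: real ^ 'n) (h k))) * \<phi> x \<partial>lborel) - - (\<integral>x. f x * ?\<psi> x \<partial>lborel)) < \<epsilon>"
    using key[OF h(1) k0] unfolding T_def by (intro exI[of _ k0]) simp
qed

text \<open>
  The averaged difference quotients \<open>D k\<close> are dominated by \<open>C * F\<close>.  After division by this bound, averages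
  \<open>v m\<close> of tails converge almost everywhere to some \<open>l\<close>, and \<open>C * F * l\<close> is the weak derivative: passing to
  averages of tails does not change the limit of integrals against a test function.
\<close>
lemma weak_partial_derivative:
  fixes f g F :: "real ^ 'n \<Rightarrow> real"
  assumes f: "locally_integrable f" and fb[measurable]: "f \<in> borel_measurable borel"
    and gb[measurable]: "g \<in> borel_measurable borel"
    and g: "\<And>x. 0 \<le> g x" and N: "N \<in> null_sets lborel"
    and ineq: "\<And>x y. x \<notin> N \<Longrightarrow> y \<notin> N \<Longrightarrow> \<bar>f x - f y\<bar> \<le> norm (x - y) * (g x + g y)"
    and F: "locally_integrable F" "\<And>x. 0 \<le> F x"
    and M: "AE x in lebesgue. maximal_function lebesgue (\<lambda>y. ennreal (g y)) x \<le> ennreal (F x)"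
  obtains G where "G \<in> borel_measurable lebesgue" "\<And>x. \<bar>G x\<bar> \<le> 2 ^ (CARD('n) + 1) * F x"
    "\<And>\<phi>. test_function \<phi> \<Longrightarrow>
      (\<integral>x. f x * frechet_derivative \<phi> (at x) (axis i 1) \<partial>lebesgue) = - (\<integral>x. G x * \<phi> x \<partial>lebesgue)"
proof -
  let ?e = "axis i 1 :: real ^ 'n"
  define C :: real where "C = 2 ^ (CARD('n) + 1)"
  have C: "0 < C" by (simp add: C_def)
  define h where "h k = 1 / (real k + 1)" for k
  have h: "0 < h k" for k by (simp add: h_def)
  have h0: "h \<longlonglongrightarrow> 0" unfolding h_def by real_asymp
  define c where "c k = measure lborel (ball (0 :: real ^ 'n) (h k))" for k
  have c: "0 < c k" for k using h[of k] by (simp add: c_def content_ball)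
  define D where "D k x = (ball_integral (h k) f (x + h k *\<^sub>R ?e) - ball_integral (h k) f x) / (h k * c k)" for k x
  have Db[measurable]: "D k \<in> borel_measurable borel" for k unfolding D_def by measurable
  have Dl[measurable]: "D k \<in> borel_measurable lebesgue" for k
    by (intro measurable_completion) simp
  have Fl[measurable]: "F \<in> borel_measurable lebesgue" by (rule locally_integrable_measurable[OF F(1)])
  have D_le: "AE x in lebesgue. \<bar>D k x\<bar> \<le> C * F x" for k
    using M
  proof eventually_elim
    case (elim x)
    have "ennreal \<bar>ball_integral (h k) f (x + h k *\<^sub>R ?e) - ball_integral (h k) f x\<bar> \<le>
      ennreal (C * (h k * c k)) * maximal_function lebesgue (\<lambda>y. ennreal (g y)) x"
      unfolding C_def c_def using h[of k] by (intro ball_integral_difference_bound[OF f fb gb g N ineq]) auto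
    also have "\<dots> \<le> ennreal (C * (h k * c k)) * ennreal (F x)" by (intro mult_left_mono elim) simp
    also have "\<dots> = ennreal (C * (h k * c k) * F x)" using F(2) C h c by (simp add: ennreal_mult less_imp_le)
    finally have "\<bar>ball_integral (h k) f (x + h k *\<^sub>R ?e) - ball_integral (h k) f x\<bar> \<le> C * (h k * c k) * F x"
      using F(2)[of x] C h[of k] c[of k] by (subst (asm) ennreal_le_iff) auto
    moreover have "0 < h k * c k" using h c by simp
    ultimately show ?case unfolding D_def by (simp add: abs_div pos_divide_le_eq ac_simps)
  qed
  define d where "d k x = (if \<bar>D k x\<bar> \<le> C * F x then D k x / (C * F x) else 0)" for k x
  have d_meas[measurable]: "d k \<in> borel_measurable lebesgue" for k unfolding d_def by measurable
  have d_le: "\<bar>d k x\<bar> \<le> 1" for k x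
  proof (cases "C * F x = 0")
    case False
    hence "0 < C * F x" using C F(2)[of x] by (simp add: less_le)
    thus ?thesis by (simp add: d_def abs_div pos_divide_le_eq)
  next
    case True
    thus ?thesis unfolding d_def by (simp only: div_by_0 if_cancel abs_zero zero_le_one)
  qed
  have D_eq: "AE x in lebesgue. D k x = C * F x * d k x" for k
    using D_le[of k] by eventually_elim (auto simp: d_def)
  interpret L: sigma_finite_measure "lebesgue :: (real ^ 'n) measure" by (rule sigma_finite_lebesgue)
  obtain v where v: "\<And>m. v m \<in> midpoint_closure (d ` {m..})" "AE x in lebesgue. convergent (\<lambda>m. v m x)"
    by (rule L.convergent_midpoint_sequence_sigma_finite[OF d_meas d_le]) (rule that)
  have vv: "v m \<in> borel_measurable lebesgue \<and> (\<forall>x. \<bar>v m x\<bar> \<le> 1)" for m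
  proof (rule midpoint_closure_bounded[OF v(1)[of m]])
    show "u \<in> borel_measurable lebesgue" if "u \<in> d ` {m..}" for u using that d_meas by auto
    show "\<bar>u x\<bar> \<le> 1" if "u \<in> d ` {m..}" for u x using that d_le by auto
  qed
  have v_meas[measurable]: "v m \<in> borel_measurable lebesgue" and v_le: "\<bar>v m x\<bar> \<le> 1" for m x
    using vv[of m] by auto
  \<comment> \<open>Clipping gives the bound also where the sequence diverges and the limit is unspecified.\<close>
  define l where "l x = max (- 1) (min 1 (lim (\<lambda>m. v m x)))" for x
  have l_meas[measurable]: "l \<in> borel_measurable lebesgue"
    unfolding l_def[abs_def] by (intro borel_measurable_max borel_measurable_min borel_measurable_const borel_measurable_lim_metric v_meas)
  have l_le: "\<bar>l x\<bar> \<le> 1" for x unfolding l_def by linarith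
  have v_lim: "AE x in lebesgue. (\<lambda>m. v m x) \<longlonglongrightarrow> l x"
    using v(2)
  proof eventually_elim
    case (elim x)
    hence lm: "(\<lambda>m. v m x) \<longlonglongrightarrow> lim (\<lambda>m. v m x)" by (rule convergent_LIMSEQ_iff[THEN iffD1])
    have v1: "v m x \<le> 1" "- 1 \<le> v m x" for m using v_le[of m x] by linarith+
    have "lim (\<lambda>m. v m x) \<le> 1" by (rule LIMSEQ_le_const2[OF lm]) (intro exI allI impI v1)
    moreover have "- 1 \<le> lim (\<lambda>m. v m x)" by (rule LIMSEQ_le_const[OF lm]) (intro exI allI impI v1)
    ultimately have "l x = lim (\<lambda>m. v m x)" by (simp add: l_def)
    thus ?case using lm by (simp only:)
  qed
  show thesis
  proof (rule that[of "\<lambda>x. C * F x * l x"])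
    show "(\<lambda>x. C * F x * l x) \<in> borel_measurable lebesgue" by measurable
    show "\<bar>C * F x * l x\<bar> \<le> 2 ^ (CARD('n) + 1) * F x" for x
    proof -
      have "\<bar>C * F x\<bar> * \<bar>l x\<bar> \<le> \<bar>C * F x\<bar> * 1" by (intro mult_left_mono l_le) simp
      thus ?thesis using C F(2)[of x] by (simp add: abs_mult C_def)
    qed
    fix \<phi> :: "real ^ 'n \<Rightarrow> real" assume \<phi>: "test_function \<phi>"
    let ?I = "\<lambda>u. \<integral>x. C * F x * u x * \<phi> x \<partial>lebesgue"
    have \<phi>b[measurable]: "\<phi> \<in> borel_measurable borel"
      using test_function_continuous[OF \<phi>] by (rule borel_measurable_continuous_onI)
    have \<phi>l[measurable]: "\<phi> \<in> borel_measurable lebesgue" by (intro continuous_lebesgue_measurable test_function_continuous \<phi>)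
    have F\<phi>: "integrable lebesgue (\<lambda>x. C * F x * \<phi> x)"
      using integrable_times_test_function[OF F(1) \<phi>] by (simp add: mult.assoc)
    define T where "T = (\<integral>x. f x * frechet_derivative \<phi> (at x) ?e \<partial>lborel)"
    have T_eq: "(\<integral>x. f x * frechet_derivative \<phi> (at x) ?e \<partial>lebesgue) = T"
    proof -
      have [measurable]: "(\<lambda>x. frechet_derivative \<phi> (at x) ?e) \<in> borel_measurable borel"
        by (intro borel_measurable_continuous_onI test_function_continuous test_function_derivative \<phi>)
      show ?thesis unfolding T_def by (rule integral_completion) measurable
    qed
    have D_lim: "(\<lambda>k. ?I (d k)) \<longlonglongrightarrow> - T"
    proof -
      have "?I (d k) = (\<integral>x. D k x * \<phi> x \<partial>lborel)" for k
      proof -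
        have "?I (d k) = (\<integral>x. D k x * \<phi> x \<partial>lebesgue)"
        proof (rule integral_cong_AE)
          show "AE x in lebesgue. C * F x * d k x * \<phi> x = D k x * \<phi> x"
            using D_eq[of k] by eventually_elim simp
        qed measurable
        also have "\<dots> = (\<integral>x. D k x * \<phi> x \<partial>lborel)" by (rule integral_completion) measurable
        finally show ?thesis .
      qed
      thus ?thesis
        using difference_quotients_converge_weakly[OF f fb \<phi> h h0, of i] unfolding D_def c_def T_def by simp
    qed
    have int_u: "integrable lebesgue (\<lambda>x. C * F x * u x * \<phi> x)"
      if "u \<in> borel_measurable lebesgue" "\<And>x. \<bar>u x\<bar> \<le> 1" for u
    proof (rule Bochner_Integration.integrable_bound[OF F\<phi>])
      show "(\<lambda>x. C * F x * u x * \<phi> x) \<in> borel_measurable lebesgue" using that(1) by measurable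
      show "AE x in lebesgue. norm (C * F x * u x * \<phi> x) \<le> norm (C * F x * \<phi> x)"
      proof (rule AE_I2)
        fix x
        have "\<bar>C * F x * \<phi> x\<bar> * \<bar>u x\<bar> \<le> \<bar>C * F x * \<phi> x\<bar> * 1" by (intro mult_left_mono that) simp
        thus "norm (C * F x * u x * \<phi> x) \<le> norm (C * F x * \<phi> x)" by (simp add: abs_mult ac_simps)
      qed
    qed
    have "(\<lambda>m. ?I (v m)) \<longlonglongrightarrow> - T"
    proof (rule LIMSEQ_I)
      fix e :: real assume e: "0 < e"
      obtain k0 where k0: "\<And>k. k \<ge> k0 \<Longrightarrow> \<bar>?I (d k) + T\<bar> < e"
        using LIMSEQ_D[OF D_lim e] by auto
      have "\<bar>?I (v m) + T\<bar> < e" if m: "m \<ge> k0" for m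
      proof -
        have "u \<in> borel_measurable lebesgue \<and> (\<forall>x. \<bar>u x\<bar> \<le> 1) \<and> \<bar>?I u + T\<bar> < e"
          if "u \<in> midpoint_closure (d ` {m..})" for u
          using that
        proof induction
          case (base u)
          thus ?case using k0 m d_meas d_le by auto
        next
          case (midpoint u1 u2)
          have iu: "integrable lebesgue (\<lambda>x. C * F x * u1 x * \<phi> x)" "integrable lebesgue (\<lambda>x. C * F x * u2 x * \<phi> x)"
            using midpoint by (auto intro: int_u)
          have "(?I (\<lambda>x. (u1 x + u2 x) / 2))
             = (\<integral>x. (C * F x * u1 x * \<phi> x + C * F x * u2 x * \<phi> x) / 2 \<partial>lebesgue)"
            by (intro Bochner_Integration.integral_cong refl) (simp add: algebra_simps)
          also have "\<dots> = (?I u1 + (?I u2)) / 2"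
            using iu by simp
          finally have eq: "(?I (\<lambda>x. (u1 x + u2 x) / 2))
             = (?I u1 + (?I u2)) / 2" .
          have "\<bar>(u1 x + u2 x) / 2\<bar> \<le> 1" for x
          proof -
            have "\<bar>u1 x\<bar> \<le> 1" "\<bar>u2 x\<bar> \<le> 1" using midpoint by auto
            hence "\<bar>u1 x + u2 x\<bar> \<le> 2" by linarith
            thus ?thesis by simp
          qed
          moreover have "(\<lambda>x. (u1 x + u2 x) / 2) \<in> borel_measurable lebesgue" using midpoint by auto
          moreover have "\<bar>(?I (\<lambda>x. (u1 x + u2 x) / 2)) + T\<bar> < e"
          proof -
            have "\<bar>?I u1 + T\<bar> < e" "\<bar>?I u2 + T\<bar> < e"
              using midpoint by auto
            thus ?thesis unfolding eq abs_less_iff by (auto simp: field_simps)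
          qed
          ultimately show ?case by blast
        qed
        thus ?thesis using v(1)[of m] by blast
      qed
      thus "\<exists>no. \<forall>m\<ge>no. norm (?I (v m) - - T) < e" by auto
    qed
    moreover have "(\<lambda>m. ?I (v m)) \<longlonglongrightarrow> (?I l)"
    proof (rule integral_dominated_convergence[where w="\<lambda>x. norm (C * F x * \<phi> x)"])
      show "AE x in lebesgue. (\<lambda>m. C * F x * v m x * \<phi> x) \<longlonglongrightarrow> C * F x * l x * \<phi> x"
        using v_lim by eventually_elim (intro tendsto_intros)
      show "AE x in lebesgue. norm (C * F x * v m x * \<phi> x) \<le> norm (C * F x * \<phi> x)" for m
      proof (rule AE_I2)
        fix x
        have "\<bar>C * F x * \<phi> x\<bar> * \<bar>v m x\<bar> \<le> \<bar>C * F x * \<phi> x\<bar> * 1" by (intro mult_left_mono v_le) simp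
        thus "norm (C * F x * v m x * \<phi> x) \<le> norm (C * F x * \<phi> x)" by (simp add: abs_mult ac_simps)
      qed
      show "integrable lebesgue (\<lambda>x. norm (C * F x * \<phi> x))" by (rule integrable_norm[OF F\<phi>])
      show "(\<lambda>x. C * F x * l x * \<phi> x) \<in> borel_measurable lebesgue" by measurable
      show "(\<lambda>x. C * F x * v m x * \<phi> x) \<in> borel_measurable lebesgue" for m by measurable
    qed
    ultimately have "?I l = - T" using LIMSEQ_unique by blast
    thus "(\<integral>x. f x * frechet_derivative \<phi> (at x) ?e \<partial>lebesgue) = - (?I l)"
      using T_eq by simp
  qed
qed


lemma maximal_function_cong_AE:
  assumes "AE y in lebesgue. f y = g y"
  shows "maximal_function lebesgue f = maximal_function lebesgue g"
proof -
  have "(\<integral>\<^sup>+y\<in>ball a r. f y \<partial>lebesgue) = (\<integral>\<^sup>+y\<in>ball a r. g y \<partial>lebesgue)" for a r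
    by (rule nn_integral_cong_AE) (use assms in eventually_elim, simp)
  thus ?thesis unfolding maximal_function_def[abs_def] by simp
qed

text \<open>
  For Fubini's theorem, \<open>f\<close> and \<open>g\<close> are replaced by Borel functions that agree with them outside a Borel null set; neither
  the maximal function nor the integrals against test functions change.
\<close>
theorem pointwise_inequality_imp_weak_gradient:
  fixes f g F :: "real ^ 'n \<Rightarrow> real"
  assumes f: "locally_integrable f" and g: "g \<in> borel_measurable lebesgue" "\<And>x. 0 \<le> g x"
    and S: "S \<in> null_sets lebesgue"
    and ineq: "\<And>x y. x \<notin> S \<Longrightarrow> y \<notin> S \<Longrightarrow> \<bar>f x - f y\<bar> \<le> norm (x - y) * (g x + g y)"
    and F: "locally_integrable F" "\<And>x. 0 \<le> F x"
    and M: "AE x in lebesgue. maximal_function lebesgue (\<lambda>y. ennreal (g y)) x \<le> ennreal (F x)"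
  obtains G where "weak_gradient f G" "\<And>x. norm (G x) \<le> real CARD('n) * 2 ^ (CARD('n) + 1) * F x"
proof -
  have fl: "f \<in> borel_measurable lebesgue" by (rule locally_integrable_measurable[OF f])
  obtain f' where f': "f' \<in> borel_measurable lborel" "AE x in lborel. f x = f' x"
    using completion_ex_borel_measurable_real[OF fl] by blast
  obtain g0 where g0: "g0 \<in> borel_measurable lborel" "AE x in lborel. g x = g0 x"
    using completion_ex_borel_measurable_real[OF g(1)] by blast
  define g' where "g' x = max 0 (g0 x)" for x
  have g'b: "g' \<in> borel_measurable borel" using g0(1) unfolding g'_def by simp
  have g'_eq: "AE x in lborel. g x = g' x"
    using g0(2)
  proof eventually_elim
    case (elim x)
    thus ?case using g(2)[of x] by (simp add: g'_def)
  qed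
  have "AE x in lborel. x \<notin> S"
    using AE_not_in[OF S] by (simp add: AE_completion_iff)
  hence "AE x in lborel. x \<notin> S \<and> f x = f' x \<and> g x = g' x"
    using f'(2) g'_eq by eventually_elim simp
  then obtain N where N: "{x \<in> space lborel. \<not> (x \<notin> S \<and> f x = f' x \<and> g x = g' x)} \<subseteq> N" "emeasure lborel N = 0" "N \<in> sets lborel"
    by (rule AE_E)
  hence Nn: "N \<in> null_sets lborel" by (simp add: null_sets_def)
  have eq: "x \<notin> S" "f x = f' x" "g x = g' x" if "x \<notin> N" for x
    using N(1) that by auto
  have ineq': "\<bar>f' x - f' y\<bar> \<le> norm (x - y) * (g' x + g' y)" if "x \<notin> N" "y \<notin> N" for x y
    using ineq[of x y] eq[OF that(1)] eq[OF that(2)] by simp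
  have f'l: "f' \<in> borel_measurable lebesgue" using f'(1) by (rule measurable_completion)
  have f_AE: "AE x in lebesgue. f x = f' x" using f'(2) by (rule AE_completion)
  have floc: "locally_integrable f'" by (rule locally_integrable_AE_eq[OF f f'l f_AE])
  have "AE y in lebesgue. ennreal (g y) = ennreal (g' y)"
    using AE_completion[OF g'_eq] by eventually_elim simp
  hence M': "AE x in lebesgue. maximal_function lebesgue (\<lambda>y. ennreal (g' y)) x \<le> ennreal (F x)"
    using M by (simp add: maximal_function_cong_AE)
  have "\<forall>i::'n. \<exists>H. H \<in> borel_measurable lebesgue \<and> (\<forall>x. \<bar>H x\<bar> \<le> 2 ^ (CARD('n) + 1) * F x) \<and> (\<forall>\<phi>. test_function \<phi> \<longrightarrow>
      (\<integral>x. f' x * frechet_derivative \<phi> (at x) (axis i 1) \<partial>lebesgue) = - (\<integral>x. H x * \<phi> x \<partial>lebesgue))"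
  proof
    fix i
    have f'b: "f' \<in> borel_measurable borel" using f'(1) by simp
    have g'0: "0 \<le> g' x" for x by (simp add: g'_def)
    show "\<exists>H. H \<in> borel_measurable lebesgue \<and> (\<forall>x. \<bar>H x\<bar> \<le> 2 ^ (CARD('n) + 1) * F x) \<and> (\<forall>\<phi>. test_function \<phi> \<longrightarrow>
      (\<integral>x. f' x * frechet_derivative \<phi> (at x) (axis i 1) \<partial>lebesgue) = - (\<integral>x. H x * \<phi> x \<partial>lebesgue))"
      by (rule weak_partial_derivative[OF floc f'b g'b g'0 Nn ineq' F M', of i]) blast+
  qed
  from choice[OF this] obtain H where H: "H i \<in> borel_measurable lebesgue" "\<bar>H i x\<bar> \<le> 2 ^ (CARD('n) + 1) * F x"
    "test_function \<phi> \<Longrightarrow> (\<integral>x. f' x * frechet_derivative \<phi> (at x) (axis i 1) \<partial>lebesgue) = - (\<integral>x. H i x * \<phi> x \<partial>lebesgue)"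
    for i x \<phi>
    by blast
  define G where "G x = (\<chi> i. H i x)" for x
  have G_le: "norm (G x) \<le> real CARD('n) * 2 ^ (CARD('n) + 1) * F x" for x
  proof -
    have "norm (G x) \<le> (\<Sum>i\<in>UNIV. \<bar>G x $ i\<bar>)" by (rule norm_le_l1_cart)
    also have "\<dots> \<le> (\<Sum>i\<in>(UNIV :: 'n set). 2 ^ (CARD('n) + 1) * F x)"
      using H(2) by (intro sum_mono) (simp add: G_def)
    finally show ?thesis by (simp add: mult.assoc)
  qed
  have G_meas: "G \<in> borel_measurable lebesgue"
    unfolding borel_measurable_euclidean_space[of G]
  proof
    fix b :: "real ^ 'n" assume "b \<in> Basis"
    then obtain i where "b = axis i 1" by (auto simp: Basis_vec_def)
    hence "(\<lambda>x. G x \<bullet> b) = H i" by (intro ext) (simp add: inner_axis G_def)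
    thus "(\<lambda>x. G x \<bullet> b) \<in> borel_measurable lebesgue" using H(1) by simp
  qed
  have G_loc: "locally_integrable G"
    unfolding locally_integrable_def set_integrable_def
  proof (intro allI impI)
    fix K :: "(real ^ 'n) set" assume K: "compact K"
    have KS: "K \<in> sets lebesgue" using K by (simp add: compact_imp_closed borel_closed)
    have "integrable lebesgue (\<lambda>x. indicat_real K x *\<^sub>R F x)"
      using F(1) K by (auto simp: locally_integrable_def set_integrable_def)
    hence i: "integrable lebesgue (\<lambda>x. real CARD('n) * 2 ^ (CARD('n) + 1) * (indicat_real K x *\<^sub>R F x))"
      by (rule integrable_mult_right)
    show "integrable lebesgue (\<lambda>x. indicat_real K x *\<^sub>R G x)"
    proof (rule Bochner_Integration.integrable_bound[OF i])
      show "(\<lambda>x. indicat_real K x *\<^sub>R G x) \<in> borel_measurable lebesgue"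
        using KS G_meas by (intro borel_measurable_scaleR borel_measurable_indicator)
      show "AE x in lebesgue. norm (indicat_real K x *\<^sub>R G x) \<le> norm (real CARD('n) * 2 ^ (CARD('n) + 1) * (indicat_real K x *\<^sub>R F x))"
        by (rule AE_I2) (use G_le F(2) in \<open>auto simp: indicator_def abs_mult\<close>)
    qed
  qed
  show thesis
  proof (rule that[OF _ G_le])
    show "weak_gradient f G"
      unfolding weak_gradient_def
    proof (intro conjI allI impI f G_loc)
      fix \<phi> :: "real ^ 'n \<Rightarrow> real" and i assume \<phi>: "test_function \<phi>"
      have \<psi>: "(\<lambda>x. frechet_derivative \<phi> (at x) (axis i 1)) \<in> borel_measurable lebesgue"
        by (intro continuous_lebesgue_measurable test_function_continuous test_function_derivative \<phi>)
      have "(\<integral>x. f x * frechet_derivative \<phi> (at x) (axis i 1) \<partial>lebesgue) = (\<integral>x. f' x * frechet_derivative \<phi> (at x) (axis i 1) \<partial>lebesgue)"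
      proof (rule integral_cong_AE)
        show "AE x in lebesgue. f x * frechet_derivative \<phi> (at x) (axis i 1) = f' x * frechet_derivative \<phi> (at x) (axis i 1)"
          using f_AE by eventually_elim simp
      qed (intro borel_measurable_times fl f'l \<psi>)+
      thus "(\<integral>x. f x * frechet_derivative \<phi> (at x) (axis i 1) \<partial>lebesgue) = - (\<integral>x. G x $ i * \<phi> x \<partial>lebesgue)"
        using H(3)[OF \<phi>] by (simp add: G_def)
    qed
  qed
qed

section \<open>Characterization of the weighted Sobolev space\<close>
lemma (in muckenhoupt_weight) locally_integrable_weighted:
  fixes f :: "'a \<Rightarrow> real"
  assumes [measurable]: "f \<in> borel_measurable lebesgue"
    and f: "(\<integral>\<^sup>+x. ennreal (\<bar>f x\<bar> powr q) * ennreal (w x) \<partial>lebesgue) < \<infinity>"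
    and K: "compact K"
  shows "set_integrable lebesgue K f"
  unfolding set_integrable_def
proof (rule integrableI_bounded)
  have KS: "K \<in> sets lebesgue" using K by (simp add: compact_imp_closed borel_closed)
  show "(\<lambda>x. indicat_real K x *\<^sub>R f x) \<in> borel_measurable lebesgue"
    using KS assms(1) by (intro borel_measurable_scaleR borel_measurable_indicator)
  obtain r where r: "K \<subseteq> ball 0 r" using bounded_subset_ballD[OF compact_imp_bounded[OF K], of 0] by blast
  have "(\<integral>\<^sup>+x. ennreal (norm (indicat_real K x *\<^sub>R f x)) \<partial>lebesgue) \<le> (\<integral>\<^sup>+x\<in>ball 0 r. ennreal \<bar>f x\<bar> \<partial>lebesgue)"
    using r by (intro nn_integral_mono) (auto simp: indicator_def)
  also have "\<dots> < \<infinity>" by (rule nn_integral_ball_finite) (use assms in auto)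
  finally show "(\<integral>\<^sup>+x. ennreal (norm (indicat_real K x *\<^sub>R f x)) \<partial>lebesgue) < \<infinity>" .
qed

lemma (in muckenhoupt_weight) maximal_function_weighted:
  fixes f :: "'a \<Rightarrow> real"
  assumes fm[measurable]: "f \<in> borel_measurable lebesgue" and f0: "\<And>x. 0 \<le> f x"
    and f: "(\<integral>\<^sup>+x. ennreal (\<bar>f x\<bar> powr q) * ennreal (w x) \<partial>lebesgue) < \<infinity>"
  defines "M \<equiv> maximal_function lebesgue (\<lambda>x. ennreal (f x))"
  shows "AE x in lebesgue. M x < \<infinity>" "M \<in> borel_measurable lebesgue"
    "(\<integral>\<^sup>+x. ennreal (\<bar>enn2real (M x)\<bar> powr q) * ennreal (w x) \<partial>lebesgue) < \<infinity>"
proof -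
  show M[measurable]: "M \<in> borel_measurable lebesgue"
    unfolding M_def by (rule borel_measurable_maximal_function) auto
  have "\<exists>K. \<forall>u. u \<in> borel_measurable lebesgue \<longrightarrow>
    (\<integral>\<^sup>+x. ennreal_powr (maximal_function lebesgue u x) q * ennreal (w x) \<partial>lebesgue)
     \<le> ennreal K * (\<integral>\<^sup>+x. ennreal_powr (u x) q * ennreal (w x) \<partial>lebesgue)"
    by (rule maximal_function_bounded) blast
  then obtain K where K: "\<And>u. u \<in> borel_measurable lebesgue \<Longrightarrow>
    (\<integral>\<^sup>+x. ennreal_powr (maximal_function lebesgue u x) q * ennreal (w x) \<partial>lebesgue)
     \<le> ennreal K * (\<integral>\<^sup>+x. ennreal_powr (u x) q * ennreal (w x) \<partial>lebesgue)" by auto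
  have "(\<integral>\<^sup>+x. ennreal_powr (M x) q * ennreal (w x) \<partial>lebesgue)
     \<le> ennreal K * (\<integral>\<^sup>+x. ennreal_powr (ennreal (f x)) q * ennreal (w x) \<partial>lebesgue)"
    unfolding M_def by (rule K) simp
  also have "(\<integral>\<^sup>+x. ennreal_powr (ennreal (f x)) q * ennreal (w x) \<partial>lebesgue) = (\<integral>\<^sup>+x. ennreal (\<bar>f x\<bar> powr q) * ennreal (w x) \<partial>lebesgue)"
    using f0 by (simp add: ennreal_powr_ennreal)
  also have "ennreal K * \<dots> < \<infinity>" using f by (simp add: ennreal_mult_less_top)
  finally have fin: "(\<integral>\<^sup>+x. ennreal_powr (M x) q * ennreal (w x) \<partial>lebesgue) < \<infinity>" .
  have "AE x in lebesgue. ennreal_powr (M x) q * ennreal (w x) \<noteq> \<infinity>"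
    by (rule nn_integral_noteq_infinite) (use fin in auto)
  thus "AE x in lebesgue. M x < \<infinity>"
  proof eventually_elim
    case (elim x)
    show ?case
    proof (rule ccontr)
      assume "\<not> M x < \<infinity>"
      hence "M x = top" by (simp add: less_top[symmetric])
      thus False using elim w_pos[of x] by (simp add: ennreal_top_mult ennreal_eq_0_iff)
    qed
  qed
  have "(\<integral>\<^sup>+x. ennreal (\<bar>enn2real (M x)\<bar> powr q) * ennreal (w x) \<partial>lebesgue)
      \<le> (\<integral>\<^sup>+x. ennreal_powr (M x) q * ennreal (w x) \<partial>lebesgue)"
    by (intro nn_integral_mono mult_right_mono) (auto simp: ennreal_powr_def)
  with fin show "(\<integral>\<^sup>+x. ennreal (\<bar>enn2real (M x)\<bar> powr q) * ennreal (w x) \<partial>lebesgue) < \<infinity>" by simp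
qed

lemma weighted_Lq_AE_eq_weight:
  assumes "AE x in lebesgue. w x = ennreal (w' x)"
  shows "f \<in> weighted_Lq q w \<longleftrightarrow> f \<in> borel_measurable lebesgue \<and>
    (\<integral>\<^sup>+x. ennreal (\<bar>f x\<bar> powr q) * ennreal (w' x) \<partial>lebesgue) < \<infinity>"
proof -
  have "(\<integral>\<^sup>+x. ennreal (\<bar>f x\<bar> powr q) * w x \<partial>lebesgue) = (\<integral>\<^sup>+x. ennreal (\<bar>f x\<bar> powr q) * ennreal (w' x) \<partial>lebesgue)"
    by (rule nn_integral_cong_AE) (use assms in eventually_elim, simp)
  thus ?thesis by (simp add: weighted_Lq_def)
qed

lemma weighted_Lq_dominated:
  fixes f g :: "real ^ 'n \<Rightarrow> real"
  assumes q: "0 < q" and g: "g \<in> weighted_Lq q w" and f: "f \<in> borel_measurable lebesgue"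
    and w: "w \<in> borel_measurable lebesgue"
    and le: "\<And>x. \<bar>f x\<bar> \<le> C * \<bar>g x\<bar>" and C: "0 \<le> C"
  shows "f \<in> weighted_Lq q w"
proof -
  have [measurable]: "g \<in> borel_measurable lebesgue" using g by (simp add: weighted_Lq_def)
  note [measurable] = w
  have "(\<integral>\<^sup>+x. ennreal (\<bar>f x\<bar> powr q) * w x \<partial>lebesgue) \<le> (\<integral>\<^sup>+x. ennreal (C powr q) * (ennreal (\<bar>g x\<bar> powr q) * w x) \<partial>lebesgue)"
  proof (rule nn_integral_mono)
    fix x
    have "\<bar>f x\<bar> powr q \<le> (C * \<bar>g x\<bar>) powr q" using q le[of x] by (intro powr_mono2) auto
    hence "ennreal (\<bar>f x\<bar> powr q) \<le> ennreal (C powr q) * ennreal (\<bar>g x\<bar> powr q)"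
      using C by (simp add: powr_mult ennreal_leI flip: ennreal_mult)
    hence "ennreal (\<bar>f x\<bar> powr q) * w x \<le> ennreal (C powr q) * ennreal (\<bar>g x\<bar> powr q) * w x"
      by (rule mult_right_mono) simp
    thus "ennreal (\<bar>f x\<bar> powr q) * w x \<le> ennreal (C powr q) * (ennreal (\<bar>g x\<bar> powr q) * w x)"
      by (simp add: mult.assoc)
  qed
  also have "\<dots> = ennreal (C powr q) * (\<integral>\<^sup>+x. ennreal (\<bar>g x\<bar> powr q) * w x \<partial>lebesgue)"
    by (rule nn_integral_cmult) measurable
  also have "\<dots> < \<infinity>" using g by (simp add: weighted_Lq_def ennreal_mult_less_top)
  finally show ?thesis using f by (simp add: weighted_Lq_def)
qed

theorem corollary4p21:
  fixes q :: real and w :: "real ^ 'n \<Rightarrow> ennreal" and f :: "real ^ 'n \<Rightarrow> real"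
  assumes "1 < q" and "w \<in> Muckenhoupt q"
  shows "f \<in> weighted_Sobolev q w \<longleftrightarrow>
    f \<in> weighted_Lq q w \<and>
    (\<exists>g \<in> weighted_Lq q w. (\<forall>x. 0 \<le> g x) \<and>
      (\<exists>S \<in> null_sets lebesgue. \<forall>x\<in>-S. \<forall>y\<in>-S.
        \<bar>f x - f y\<bar> \<le> norm (x - y) * (g x + g y)))"
proof -
  have w_meas: "w \<in> borel_measurable lebesgue"
    using assms(2) by (simp add: Muckenhoupt_def weight_def)
  have q0: "0 < q" using assms(1) by simp
  obtain A w' where A: "muckenhoupt_weight q A w'" and w': "AE x in lebesgue. w x = ennreal (w' x)"
    by (rule Muckenhoupt_imp_muckenhoupt_weight[OF assms])
  interpret W: muckenhoupt_weight q A w' by (rule A)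
  note Lq = weighted_Lq_AE_eq_weight[OF w']
  show ?thesis
  proof
    assume "f \<in> weighted_Sobolev q w"
    then obtain G where f: "f \<in> weighted_Lq q w" and G: "weak_gradient f G" "(\<lambda>x. norm (G x)) \<in> weighted_Lq q w"
      by (auto simp: weighted_Sobolev_def)
    let ?M = "gradient_maximal G"
    have GL: "(\<lambda>x. norm (G x)) \<in> borel_measurable lebesgue"
      "(\<integral>\<^sup>+x. ennreal (\<bar>norm (G x)\<bar> powr q) * ennreal (w' x) \<partial>lebesgue) < \<infinity>"
      using G(2) unfolding Lq by auto
    note M = W.maximal_function_weighted[OF GL(1) norm_ge_zero GL(2)]
    obtain C N where C: "0 \<le> C" and N: "N \<in> null_sets lebesgue"
      and ineq: "\<And>x z. x \<notin> N \<Longrightarrow> z \<notin> N \<Longrightarrow> ?M x < \<infinity> \<Longrightarrow> ?M z < \<infinity> \<Longrightarrow>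
         \<bar>f x - f z\<bar> \<le> C * norm (x - z) * (enn2real (?M x) + enn2real (?M z))"
      by (rule weak_gradient_imp_pointwise_inequality[OF G(1)]) blast
    have M_Lq: "(\<lambda>x. enn2real (?M x)) \<in> weighted_Lq q w"
      unfolding Lq using M(2,3) by auto
    have "(\<lambda>x. C * enn2real (?M x)) \<in> weighted_Lq q w"
      by (rule weighted_Lq_dominated[OF q0 M_Lq _ w_meas _ C]) (use M(2) C in auto)
    moreover have "N \<union> {x. \<not> ?M x < \<infinity>} \<in> null_sets lebesgue"
    proof -
      have "{x. \<not> ?M x < \<infinity>} \<in> null_sets lebesgue"
      proof -
        have "{x \<in> space lebesgue. \<not> ?M x < \<infinity>} \<in> sets lebesgue" using M(2) by measurable
        from AE_iff_null[OF this] M(1) show ?thesis by simp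
      qed
      thus ?thesis using N by (rule null_sets.Un[rotated])
    qed
    moreover have "\<bar>f x - f y\<bar> \<le> norm (x - y) * (C * enn2real (?M x) + C * enn2real (?M y))"
      if "x \<in> - (N \<union> {x. \<not> ?M x < \<infinity>})" "y \<in> - (N \<union> {x. \<not> ?M x < \<infinity>})" for x y
      using ineq[of x y] that by (simp add: algebra_simps)
    ultimately show "f \<in> weighted_Lq q w \<and> (\<exists>g \<in> weighted_Lq q w. (\<forall>x. 0 \<le> g x) \<and>
      (\<exists>S \<in> null_sets lebesgue. \<forall>x\<in>-S. \<forall>y\<in>-S. \<bar>f x - f y\<bar> \<le> norm (x - y) * (g x + g y)))"
      using f C by (intro conjI bexI[of _ "\<lambda>x. C * enn2real (?M x)"] bexI[of _ "N \<union> {x. \<not> ?M x < \<infinity>}"]) auto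
  next
    assume "f \<in> weighted_Lq q w \<and> (\<exists>g \<in> weighted_Lq q w. (\<forall>x. 0 \<le> g x) \<and>
      (\<exists>S \<in> null_sets lebesgue. \<forall>x\<in>-S. \<forall>y\<in>-S. \<bar>f x - f y\<bar> \<le> norm (x - y) * (g x + g y)))"
    then obtain g S where f: "f \<in> weighted_Lq q w" and g: "g \<in> weighted_Lq q w" "\<And>x. 0 \<le> g x"
      and S: "S \<in> null_sets lebesgue"
      and ineq: "\<And>x y. x \<notin> S \<Longrightarrow> y \<notin> S \<Longrightarrow> \<bar>f x - f y\<bar> \<le> norm (x - y) * (g x + g y)"
      by auto
    have fL: "f \<in> borel_measurable lebesgue" "(\<integral>\<^sup>+x. ennreal (\<bar>f x\<bar> powr q) * ennreal (w' x) \<partial>lebesgue) < \<infinity>"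
      using f unfolding Lq by auto
    have gL: "g \<in> borel_measurable lebesgue" "(\<integral>\<^sup>+x. ennreal (\<bar>g x\<bar> powr q) * ennreal (w' x) \<partial>lebesgue) < \<infinity>"
      using g unfolding Lq by auto
    let ?M = "maximal_function lebesgue (\<lambda>x. ennreal (g x))"
    let ?F = "\<lambda>x. enn2real (?M x)"
    note M = W.maximal_function_weighted[OF gL(1) g(2) gL(2)]
    have f_loc: "locally_integrable f"
      unfolding locally_integrable_def using W.locally_integrable_weighted[OF fL] by blast
    have FL: "?F \<in> borel_measurable lebesgue" using M(2) by simp
    have F_loc: "locally_integrable ?F"
      unfolding locally_integrable_def using W.locally_integrable_weighted[OF FL M(3)] by blast
    have M_le: "AE x in lebesgue. ?M x \<le> ennreal (?F x)"
      using M(1) by eventually_elim simp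
    have "\<exists>G. weak_gradient f G \<and> (\<forall>x. norm (G x) \<le> real CARD('n) * 2 ^ (CARD('n) + 1) * ?F x)"
    proof (rule pointwise_inequality_imp_weak_gradient[OF f_loc gL(1) g(2) S _ F_loc enn2real_nonneg M_le])
      show "\<bar>f x - f y\<bar> \<le> norm (x - y) * (g x + g y)" if "x \<notin> S" "y \<notin> S" for x y
        using that by (rule ineq)
    qed blast
    then obtain G where G: "weak_gradient f G" "\<And>x. norm (G x) \<le> real CARD('n) * 2 ^ (CARD('n) + 1) * ?F x"
      by blast
    have GL: "(\<lambda>x. norm (G x)) \<in> borel_measurable lebesgue"
    proof -
      have "locally_integrable G" using G(1) by (simp add: weak_gradient_def)
      thus ?thesis by (auto dest: locally_integrable_measurable)
    qed
    have "?F \<in> weighted_Lq q w" unfolding Lq using FL M(3) by blast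
    hence "(\<lambda>x. norm (G x)) \<in> weighted_Lq q w"
      by (rule weighted_Lq_dominated[OF q0 _ GL w_meas, where C="real CARD('n) * 2 ^ (CARD('n) + 1)"]) (use G(2) in auto)
    thus "f \<in> weighted_Sobolev q w" using f G(1) by (auto simp: weighted_Sobolev_def)
  qed
qed

end
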